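(* Let $0<p<\infty$, $\alpha>-1$, $\beta>1$, and let $\mu$ be a positive Borel measure on $[0,1)$ satisfying condition $(W_{p,\alpha})$. (i) Let $q\ge p$ and $q>1$. If $\mathcal{H}_{\mu,\beta}$ is a bounded operator from $A^p_\alpha$ into $A^q_{\beta-2}$, then $\mu$ is a $\left(\frac{\alpha+2}{p}+\frac{\beta}{q'}\right)$-Carleson measure. Conversely, if $\mu$ is a $\left(\max\{\alpha+2,\beta\}\left(\frac1p+\frac1{q'}\right)\right)$-Carleson measure, then $\mathcal{H}_{\mu,\beta}$ is a bounded operator from $A^p_\alpha$ into $A^q_{\beta-2}$. (ii) Let $q\ge p$ and $q=1$. Then $\mathcal{H}_{\mu,\beta}$ is a bounded operator from $A^p_\alpha$ into $A^1_{\beta-2}$ if and only if $\mu$ is a $1$-logarithmic $\frac{\alpha+2}{p}$-Carleson measure.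
   Context: $\mathbb{D}$ is the open unit disc, $dA=\frac1\pi dx\,dy$. For $0<p<\infty$, $\alpha>-1$, $A^p_\alpha$ is the space of analytic $f$ on $\mathbb{D}$ with $\|f\|_{A^p_\alpha}=\left((\alpha+1)\int_{\mathbb{D}}|f|^p(1-|z|^2)^\alpha dA\right)^{1/p}<\infty$. For $q>1$, $q'$ is defined by $1/q+1/q'=1$. For a positive Borel measure $\mu$ on $[0,1)$ and $\beta>0$, $\mu_{n,k,\beta}=\frac{\Gamma(n+\beta)}{n!\Gamma(\beta)}\int_{[0,1)}t^{n+k}d\mu(t)$ and for $f(z)=\sum_k a_kz^k$ analytic, $\mathcal{H}_{\mu,\beta}(f)(z)=\sum_n\left(\sum_k\mu_{n,k,\beta}a_k\right)z^n$. Boundedness from $X$ into $Y$ means $\mathcal{H}_{\mu,\beta}(f)$ is defined and lies in $Y$ for all $f\in X$ with $\|\mathcal{H}_{\mu,\beta}(f)\|_Y\le C\|f\|_X$. A measure $\mu$ on $[0,1)$ is regarded as a measure on $\mathbb{D}$ via $\mu(E)=\mu(E\cap[0,1))$. For an arc $I\subset\partial\mathbb{D}$ with length $|I|$, $S(I)=\{re^{i\theta}:e^{i\theta}\in I,\ 1-\frac{|I|}{2\pi}\le r\le1\}$. For $s>0$, $\mu$ is an $s$-Carleson measure if $\mu([t,1))\le C(1-t)^s$ for $0\le t<1$ (equivalently $\mu(S(I))\le C|I|^s$ for all arcs $I$). For $\gamma\ge0$, $\mu$ is a $\gamma$-logarithmic $s$-Carleson measure if there is $C$ with $\mu(S(I))\left(\log\frac{2\pi}{|I|}\right)^\gamma\le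 C|I|^s$ for all arcs $I\subset\partial\mathbb{D}$. Condition $(W_{p,\alpha})$: if $0<p\le1$, $\mu$ is a $\frac{\alpha+2}{p}$-Carleson measure; if $1\le p\le 2$, $\mu$ is a $\frac{\alpha+2-(p-1)^2}{p}$-Carleson measure; if $2\le p<\infty$, $\mu$ is a $\frac{\alpha+1}{p}$-Carleson measure. *)

theory Defs
  imports "HOL-Analysis.Analysis"
begin

definition taylor_coeff :: "(complex \<Rightarrow> complex) \<Rightarrow> nat \<Rightarrow> complex" where
  "taylor_coeff f k = (deriv ^^ k) f 0 / of_nat (fact k)"

text \<open>mu_{n,k,beta} for a measure mu on the reals concentrated on [0,1).\<close>
definition hmu :: "real measure \<Rightarrow> real \<Rightarrow> nat \<Rightarrow> nat \<Rightarrow> real" where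
  "hmu \<mu> \<beta> n k = Gamma (real n + \<beta>) / (fact n * Gamma \<beta>) *
      (LINT t:{0..<1}|\<mu>. t ^ (n + k))"

definition H_coef :: "real measure \<Rightarrow> real \<Rightarrow> (complex \<Rightarrow> complex) \<Rightarrow> nat \<Rightarrow> complex" where
  "H_coef \<mu> \<beta> f n = (\<Sum>k. complex_of_real (hmu \<mu> \<beta> n k) * taylor_coeff f k)"

definition H_defined :: "real measure \<Rightarrow> real \<Rightarrow> (complex \<Rightarrow> complex) \<Rightarrow> bool" where
  "H_defined \<mu> \<beta> f \<longleftrightarrow>
     (\<forall>n. summable (\<lambda>k. complex_of_real (hmu \<mu> \<beta> n k) * taylor_coeff f k)) \<and>
     (\<forall>z\<in>ball 0 1. summable (\<lambda>n. H_coef \<mu> \<beta> f n * z ^ n))"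

definition H_op :: "real measure \<Rightarrow> real \<Rightarrow> (complex \<Rightarrow> complex) \<Rightarrow> complex \<Rightarrow> complex" where
  "H_op \<mu> \<beta> f z = (\<Sum>n. H_coef \<mu> \<beta> f n * z ^ n)"

text \<open>Weighted Bergman spaces; dA = dx dy / pi.\<close>
definition bergman_integral :: "real \<Rightarrow> real \<Rightarrow> (complex \<Rightarrow> complex) \<Rightarrow> ennreal" where
  "bergman_integral p \<alpha> f =
     (\<integral>\<^sup>+ z \<in> ball 0 1. ennreal (norm (f z) powr p * (1 - (norm z)\<^sup>2) powr \<alpha> / pi) \<partial>lborel)"

definition in_bergman :: "real \<Rightarrow> real \<Rightarrow> (complex \<Rightarrow> complex) \<Rightarrow> bool" where
  "in_bergman p \<alpha> f \<longleftrightarrow> f holomorphic_on ball 0 1 \<and> bergman_integral p \<alpha> f < \<infinity>"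

definition bergman_norm :: "real \<Rightarrow> real \<Rightarrow> (complex \<Rightarrow> complex) \<Rightarrow> real" where
  "bergman_norm p \<alpha> f = ((\<alpha> + 1) * enn2real (bergman_integral p \<alpha> f)) powr (1 / p)"

definition H_bounded :: "real measure \<Rightarrow> real \<Rightarrow> real \<Rightarrow> real \<Rightarrow> real \<Rightarrow> real \<Rightarrow> bool" where
  "H_bounded \<mu> \<beta> p \<alpha> q \<gamma> \<longleftrightarrow>
     (\<exists>C. \<forall>f. in_bergman p \<alpha> f \<longrightarrow>
        H_defined \<mu> \<beta> f \<and> in_bergman q \<gamma> (H_op \<mu> \<beta> f) \<and>
        bergman_norm q \<gamma> (H_op \<mu> \<beta> f) \<le> C * bergman_norm p \<alpha> f)"

definition carleson :: "real measure \<Rightarrow> real \<Rightarrow> bool" where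
  "carleson \<mu> s \<longleftrightarrow> (\<exists>C. \<forall>t\<in>{0..<1}. emeasure \<mu> {t..<1} \<le> ennreal (C * (1 - t) powr s))"

text \<open>Carleson box S(I) over the closed arc I = {e^{i theta}: a <= theta <= a + l},
  whose length is |I| = l (0 < l <= 2 pi).\<close>
definition carleson_box :: "real \<Rightarrow> real \<Rightarrow> complex set" where
  "carleson_box a l = {complex_of_real r * cis \<theta> | r \<theta>.
      a \<le> \<theta> \<and> \<theta> \<le> a + l \<and> 1 - l / (2 * pi) \<le> r \<and> r \<le> 1}"

definition disc_measure :: "real measure \<Rightarrow> complex set \<Rightarrow> ennreal" where
  "disc_measure \<mu> E = emeasure \<mu> {t\<in>{0..<1}. complex_of_real t \<in> E}"

definition log_carleson :: "real measure \<Rightarrow> real \<Rightarrow> real \<Rightarrow> bool" where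
  "log_carleson \<mu> \<gamma> s \<longleftrightarrow> (\<exists>C. \<forall>a l. 0 < l \<and> l \<le> 2 * pi \<longrightarrow>
      disc_measure \<mu> (carleson_box a l) *
        ennreal (if \<gamma> = 0 then 1 else (ln (2 * pi / l)) powr \<gamma>)
      \<le> ennreal (C * l powr s))"

definition W_cond :: "real measure \<Rightarrow> real \<Rightarrow> real \<Rightarrow> bool" where
  "W_cond \<mu> p \<alpha> \<longleftrightarrow>
     (if p \<le> 1 then carleson \<mu> ((\<alpha> + 2) / p)
      else if p \<le> 2 then carleson \<mu> ((\<alpha> + 2 - (p - 1)\<^sup>2) / p)
      else carleson \<mu> ((\<alpha> + 1) / p))"

definition conj_exp :: "real \<Rightarrow> real" where
  "conj_exp q = q / (q - 1)"

end

theory Submission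
  imports Defs "HOL-Complex_Analysis.Complex_Analysis"
begin

text \<open>On the disc, \<open>H_op \<mu> \<beta> f z\<close> is the integral of \<open>f t (1 - t z)^(-\<beta>)\<close> against \<open>\<mu>\<close>. Since \<open>\<mu>\<close> lives
  on the radius, \<open>|1 - t z|\<close> is comparable to the maximum of \<open>1 - t\<close> and \<open>|1 - z|\<close>, and every kernel integral
  is governed by the distribution functions of these two distances.

  Sufficiency: Holder's inequality in \<open>\<mu>\<close>, balanced by a power of \<open>1 - t\<close>, followed by integration in \<open>z\<close>
  leaves an integral of \<open>|f|^q\<close> against a weighted \<open>\<mu>\<close>, which a local sub-mean value estimate bounds by
  the Bergman norm of \<open>f\<close>. For \<open>q = 1\<close> the integral in \<open>z\<close> diverges logarithmically at the endpoint;
  this is the origin of the logarithmic condition.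

  Necessity: test with \<open>f z = (1 - b z)^(-N)\<close>, which is positive on the radius. For \<open>q > 1\<close> the growth estimate
  for the image at the point \<open>b\<close> suffices. For \<open>q = 1\<close> one uses a Hardy inequality for the Taylor
  coefficients of the image, where the terms \<open>b^n / (n + 1)\<close> sum up to the logarithm.\<close>

subsection \<open>Rotation invariance of area\<close>

text \<open>The operator is given by its coefficients, so before anything can be estimated the
  series over k must converge and be exchanged with the integral. One inequality serves here and
  again for the logarithm: \<open>bergman_coeff_sum_le\<close> bounds the sum of
  \<open>norm (taylor_coeff f k) * Beta (real k + 1) s\<close> by the A^1 integral with weight
  exponent s - 2. An s-Carleson measure has moments at most a multiple of
  \<open>Beta (real k + 1) s\<close>, and A^p with weight \<alpha> lies in this A^1 space once s is
  as in \<open>in_bergman_imp_A1\<close>. For q = 1 the same sum, applied to the image with s =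
  \<beta>, has terms of size 1 / (n + 1). Both variables are treated by the same layer cake lemmas:
  the sublevel sets of \<open>gap\<close> have \<mu>-mass of order at most v^s, those of
  \<open>disc_gap\<close> weighted area of order at most v^\<beta>. For q > 1 the two directions
  meet: with \<tau> = \<beta> / q', the exponent (\<alpha> + 2) / p + \<tau> that boundedness forces
  is also enough, and the exponent with the maximum dominates it. Averages over rotations of area
  take the place of polar coordinates.\<close>

lemma lborel_complex_conv_prod:
  "(lborel :: complex measure) = distr (lborel \<Otimes>\<^sub>M lborel) borel (\<lambda>(x, y). Complex x y)"
proof (rule lborel_eqI)
  have [measurable]: "(\<lambda>(x, y). Complex x y) \<in> borel_measurable (lborel \<Otimes>\<^sub>M lborel)"
    unfolding borel_measurable_complex_iff by (simp add: split_beta)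
  fix l u :: complex
  assume lu: "\<And>b. b \<in> Basis \<Longrightarrow> l \<bullet> b \<le> u \<bullet> b"
  have vim: "(\<lambda>(x, y). Complex x y) -` box l u \<inter> space (lborel \<Otimes>\<^sub>M lborel)
      = {Re l<..<Re u} \<times> {Im l<..<Im u}"
    by (auto simp: box_def Basis_complex_def inner_complex_def space_pair_measure)
  have "Re l \<le> Re u" "Im l \<le> Im u"
    using lu[of 1] lu[of \<i>] by (auto simp: Basis_complex_def inner_complex_def)
  then show "emeasure (distr (lborel \<Otimes>\<^sub>M lborel) borel (\<lambda>(x, y). Complex x y)) (box l u)
      = ennreal (\<Prod>b\<in>Basis. (u - l) \<bullet> b)"
    by (subst emeasure_distr)
       (auto simp: vim lborel.emeasure_pair_measure_Times Basis_complex_def inner_complex_def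
          ennreal_mult')
qed simp

lemma nn_integral_complex_conv_prod:
  assumes [measurable]: "f \<in> borel_measurable borel"
  shows "(\<integral>\<^sup>+z. f z \<partial>lborel) = (\<integral>\<^sup>+x. \<integral>\<^sup>+y. f (Complex x y) \<partial>lborel \<partial>lborel)"
    and "(\<integral>\<^sup>+z. f z \<partial>lborel) = (\<integral>\<^sup>+y. \<integral>\<^sup>+x. f (Complex x y) \<partial>lborel \<partial>lborel)"
proof -
  have m [measurable]: "(\<lambda>(x, y). Complex x y) \<in> borel_measurable (lborel \<Otimes>\<^sub>M lborel)"
    unfolding borel_measurable_complex_iff by (simp add: split_beta)
  have m2: "(\<lambda>p. f (case p of (x, y) \<Rightarrow> Complex x y)) \<in> borel_measurable (lborel \<Otimes>\<^sub>M lborel)"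
    by measurable
  have e: "(\<integral>\<^sup>+z. f z \<partial>lborel) = (\<integral>\<^sup>+p. f (case p of (x, y) \<Rightarrow> Complex x y) \<partial>(lborel \<Otimes>\<^sub>M lborel))"
    by (subst lborel_complex_conv_prod, subst nn_integral_distr) auto
  show "(\<integral>\<^sup>+z. f z \<partial>lborel) = (\<integral>\<^sup>+x. \<integral>\<^sup>+y. f (Complex x y) \<partial>lborel \<partial>lborel)"
    unfolding e using lborel.nn_integral_fst[OF m2] by simp
  show "(\<integral>\<^sup>+z. f z \<partial>lborel) = (\<integral>\<^sup>+y. \<integral>\<^sup>+x. f (Complex x y) \<partial>lborel \<partial>lborel)"
    unfolding e using lborel_pair.nn_integral_snd[OF m2] by simp
qed

text \<open>On every horizontal line the shear is a translation, so slicing by the imaginary part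
  leaves each inner integral unchanged.\<close>

lemma nn_integral_shear_Re:
  assumes [measurable]: "f \<in> borel_measurable borel"
  shows "(\<integral>\<^sup>+z. f (Complex (Re z + a * Im z) (Im z)) \<partial>lborel) = (\<integral>\<^sup>+z. f z \<partial>lborel)"
proof -
  have [measurable]: "(\<lambda>z. Complex (Re z + a * Im z) (Im z)) \<in> borel_measurable borel"
    "\<And>y. (\<lambda>x. Complex x y) \<in> borel_measurable borel"
    by (auto simp: borel_measurable_complex_iff)
  show ?thesis
    apply (subst (1 2) nn_integral_complex_conv_prod(2))
    subgoal by measurable
    subgoal by measurable
    apply (rule nn_integral_cong)
    subgoal for y
      using nn_integral_real_affine[of "\<lambda>x. f (Complex x y)" 1 "a * y"]
      by (simp add: add.commute)
    done
qed

lemma nn_integral_shear_Im: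
  assumes [measurable]: "f \<in> borel_measurable borel"
  shows "(\<integral>\<^sup>+z. f (Complex (Re z) (Im z + a * Re z)) \<partial>lborel) = (\<integral>\<^sup>+z. f z \<partial>lborel)"
proof -
  have [measurable]: "(\<lambda>z. Complex (Re z) (Im z + a * Re z)) \<in> borel_measurable borel"
    "\<And>x. (\<lambda>y. Complex x y) \<in> borel_measurable borel"
    by (auto simp: borel_measurable_complex_iff)
  show ?thesis
    apply (subst (1 2) nn_integral_complex_conv_prod(1))
    subgoal by measurable
    subgoal by measurable
    apply (rule nn_integral_cong)
    subgoal for x
      using nn_integral_real_affine[of "\<lambda>y. f (Complex x y)" 1 "a * x"]
      by (simp add: add.commute)
    done
qed

text \<open>A rotation other than the half turn is a product of three shears.\<close>

lemma nn_integral_rotate: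
  fixes c :: complex
  assumes [measurable]: "f \<in> borel_measurable borel" and "norm c = 1"
  shows "(\<integral>\<^sup>+z. f (c * z) \<partial>lborel) = (\<integral>\<^sup>+z. f z \<partial>lborel)"
proof -
  have main: "(\<integral>\<^sup>+z. g (d * z) \<partial>lborel) = (\<integral>\<^sup>+z. g z \<partial>lborel)"
    if [measurable]: "g \<in> borel_measurable borel" and d: "norm d = 1" "d \<noteq> -1"
    for g :: "complex \<Rightarrow> ennreal" and d
  proof -
    have ab: "(Re d)\<^sup>2 + (Im d)\<^sup>2 = 1"
      using d by (simp add: cmod_power2[symmetric])
    have "Re d \<noteq> -1"
    proof
      assume "Re d = -1"
      then show False using ab d(2) by (auto simp: complex_eq_iff)
    qed
    \<comment> \<open>For \<open>d = cis \<theta>\<close> this is tan (\<theta> / 2). The shears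
      have factors \<open>- t\<close>, sin \<theta> and \<open>- t\<close>, and
      \<open>d = -1\<close> is the one rotation for which the tangent is undefined.\<close>
    define t where "t = Im d / (1 + Re d)"
    let ?S = "\<lambda>z. Complex (Re z + (- t) * Im z) (Im z)" and ?T = "\<lambda>z. Complex (Re z) (Im z + Im d * Re z)"
    have t1: "t * (1 + Re d) = Im d"
      using \<open>Re d \<noteq> -1\<close> by (simp add: t_def)
    have "(1 + Re d) * (1 - t * Im d) = (1 + Re d) - (Im d)\<^sup>2"
      unfolding t1[symmetric] by (simp add: algebra_simps power2_eq_square)
    also have "\<dots> = (1 + Re d) * Re d"
      using ab by (simp add: algebra_simps power2_eq_square)
    finally have t2: "1 - t * Im d = Re d"
      using \<open>Re d \<noteq> -1\<close> by (simp add: add_eq_0_iff)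
    have [measurable]: "(\<lambda>z. Complex (Re z + a * Im z) (Im z)) \<in> borel_measurable borel"
      "(\<lambda>z. Complex (Re z) (Im z + a * Re z)) \<in> borel_measurable borel" for a
      by (auto simp: borel_measurable_complex_iff)
    have "(\<integral>\<^sup>+z. g z \<partial>lborel) = (\<integral>\<^sup>+z. g (?S z) \<partial>lborel)"
      by (rule nn_integral_shear_Re[symmetric]) measurable
    also have "\<dots> = (\<integral>\<^sup>+z. (\<lambda>z. g (?S z)) (?T z) \<partial>lborel)"
      by (rule nn_integral_shear_Im[symmetric]) measurable
    also have "\<dots> = (\<integral>\<^sup>+z. (\<lambda>z. (\<lambda>z. g (?S z)) (?T z)) (?S z) \<partial>lborel)"
      by (rule nn_integral_shear_Re[symmetric]) measurable
    also have "\<dots> = (\<integral>\<^sup>+z. g (d * z) \<partial>lborel)"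
    proof (rule nn_integral_cong)
      fix z :: complex
      have i: "Im z + Im d * (Re z + - t * Im z) = (1 - t * Im d) * Im z + Im d * Re z"
        by (simp add: algebra_simps)
      have "Re z + - t * Im z + - t * (Im z + Im d * (Re z + - t * Im z))
        = (1 - t * Im d) * Re z - (t * (1 + (1 - t * Im d))) * Im z"
        by (simp add: algebra_simps)
      then have r: "Re z + - t * Im z + - t * (Im z + Im d * (Re z + - t * Im z))
         = Re d * Re z - Im d * Im z"
        by (simp only: t2 t1)
      show "(\<lambda>z. (\<lambda>z. g (?S z)) (?T z)) (?S z) = g (d * z)"
        using i r unfolding t2 by (auto intro!: arg_cong[where f=g] simp: complex_eq_iff)
    qed
    finally show ?thesis ..
  qed
  show ?thesis
  proof (cases "c = -1")
    case True
    \<comment> \<open>The half turn is two quarter turns, each covered by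
      \<open>main\<close>.\<close>
    have "(\<integral>\<^sup>+z. f (c * z) \<partial>lborel) = (\<integral>\<^sup>+z. (\<lambda>z. f (\<i> * z)) (\<i> * z) \<partial>lborel)"
      using True by (simp add: mult.assoc[symmetric])
    also have "\<dots> = (\<integral>\<^sup>+z. f (\<i> * z) \<partial>lborel)"
      by (rule main) (auto simp: complex_eq_iff)
    also have "\<dots> = (\<integral>\<^sup>+z. f z \<partial>lborel)"
      by (rule main) (auto simp: complex_eq_iff)
    finally show ?thesis .
  qed (use main assms in blast)
qed

text \<open>The mean over the circle through \<open>z\<close> centred at 0, with the angle measured
  in full turns so that the parameter interval has length 1.\<close>

abbreviation circle_integral :: "(complex \<Rightarrow> ennreal) \<Rightarrow> complex \<Rightarrow> ennreal" where
  "circle_integral f z \<equiv> (\<integral>\<^sup>+x. f (cis (2 * pi * x) * z) * indicator {0..1} x \<partial>lborel)"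

text \<open>Tonelli moves the rotation outside, where area is invariant. Replacing an integrand by
  its circular mean in this way does the work of polar coordinates.\<close>

lemma nn_integral_rotation_average:
  fixes f :: "complex \<Rightarrow> ennreal"
  assumes [measurable]: "f \<in> borel_measurable borel"
  shows "(\<integral>\<^sup>+z. circle_integral f z \<partial>lborel)
       = (\<integral>\<^sup>+z. f z \<partial>lborel)"
proof -
  have [measurable]: "(\<lambda>x. cis (2 * pi * x)) \<in> borel_measurable borel"
    by (intro borel_measurable_continuous_onI continuous_intros)
  have [measurable]: "(\<lambda>(z, x). f (cis (2 * pi * x) * z) * indicator {0..1} x)
     \<in> borel_measurable (lborel \<Otimes>\<^sub>M lborel)"
    by measurable
  have "(\<integral>\<^sup>+z. circle_integral f z \<partial>lborel)
      = (\<integral>\<^sup>+x. (\<integral>\<^sup>+z. f (cis (2 * pi * x) * z) * indicator {0..1} x \<partial>lborel) \<partial>lborel)"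
    by (rule lborel_pair.Fubini'[symmetric]) measurable
  also have "\<dots> = (\<integral>\<^sup>+x. (\<integral>\<^sup>+z. f z \<partial>lborel) * indicator {0..1::real} x \<partial>lborel)"
  proof (rule nn_integral_cong)
    fix x :: real
    show "(\<integral>\<^sup>+z. f (cis (2 * pi * x) * z) * indicator {0..1} x \<partial>lborel)
        = (\<integral>\<^sup>+z. f z \<partial>lborel) * indicator {0..1} x"
      by (subst nn_integral_multc) (auto simp: nn_integral_rotate)
  qed
  also have "\<dots> = (\<integral>\<^sup>+z. f z \<partial>lborel)"
    by (subst nn_integral_cmult) auto
  finally show ?thesis .
qed

subsection \<open>Mean value estimates\<close>

text \<open>Cauchy's integral formula for the k-th derivative on the circle of radius
  \<open>norm z\<close>. The circle is described by the point \<open>z\<close> and not by its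
  radius, so that the right-hand side can be integrated in \<open>z\<close> as a rotation
  average.\<close>

lemma taylor_coeff_le_circle_mean:
  fixes f :: "complex \<Rightarrow> complex"
  assumes hol: "f holomorphic_on ball w R" and z: "norm z < R"
  shows "ennreal (norm ((deriv ^^ k) f w / fact k) * norm z ^ k)
     \<le> (\<integral>\<^sup>+x. ennreal (norm (f (w + cis (2 * pi * x) * z))) * indicator {0..1} x \<partial>lborel)"
proof (cases "z = 0")
  case True
  show ?thesis
  proof (cases k)
    case 0
    then show ?thesis using True by (simp add: nn_integral_cmult)
  next
    case (Suc n)
    then show ?thesis using True by simp
  qed
next
  case False
  define r where "r = norm z"
  \<comment> \<open>Turning the variable by \<open>c\<close> makes the circle start at
    \<open>w + z\<close>, as the parametrisation on the right-hand side does; the modulus of the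
    derivative is unaffected because \<open>norm c = 1\<close>.\<close>
  define c where "c = sgn z"
  have r: "r > 0" "r < R" using False z by (auto simp: r_def)
  have c: "norm c = 1" using False by (simp add: c_def norm_sgn)
  have zc: "z = c * of_real r"
    using False by (simp add: c_def r_def sgn_eq)
  define g where "g = (\<lambda>v. f (c * v + w))"
  have maps: "(\<lambda>v. c * v + w) ` ball 0 R \<subseteq> ball w R"
    using c by (auto simp: dist_norm norm_mult)
  have "(f \<circ> (\<lambda>v. c * v + w)) holomorphic_on ball 0 R"
    by (rule holomorphic_on_compose_gen[OF _ hol]) (use maps in \<open>auto intro!: holomorphic_intros\<close>)
  then have ghol: "g holomorphic_on ball 0 R"
    by (simp add: g_def o_def)
  have "(deriv ^^ k) g 0 = c ^ k * (deriv ^^ k) f (c * 0 + w)"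
    unfolding g_def
    by (rule higher_deriv_compose_linear'[OF hol, of "ball 0 R"])
       (use maps r in \<open>auto simp: image_subset_iff\<close>)
  then have dg: "norm ((deriv ^^ k) g 0) = norm ((deriv ^^ k) f w)"
    using c by (simp add: norm_mult norm_power)
  have cb: "cball 0 r \<subseteq> ball 0 R" using r by auto
  have gc: "continuous_on (cball 0 r) g"
    using cb ghol holomorphic_on_imp_continuous_on continuous_on_subset by blast
  let ?u = "\<lambda>x. complex_of_real r * cis (2 * pi * x)"
  have "((\<lambda>u. g u / (u - 0) ^ Suc k) has_contour_integral (2 * pi * \<i>) / fact k * (deriv ^^ k) g 0) (circlepath 0 r)"
    by (rule Cauchy_has_contour_integral_higher_derivative_circlepath)
       (use gc ghol cb r in \<open>auto intro: holomorphic_on_subset\<close>)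
  \<comment> \<open>On the circle the speed \<open>2 * pi * \<i> * ?u x\<close> cancels one of the k
    + 1 powers in the denominator, so the integrand has modulus |g| 2 pi / r^k.\<close>
  then have hi: "((\<lambda>x. g (?u x) / (?u x) ^ Suc k * (2 * pi * \<i> * ?u x))
      has_integral (2 * pi * \<i>) / fact k * (deriv ^^ k) g 0) {0..1}"
    unfolding has_contour_integral_def
  proof (rule has_integral_eq[rotated])
    fix x :: real assume x: "x \<in> {0..1}"
    have e: "exp (2 * of_real pi * \<i> * of_real x) = cis (2 * pi * x)"
      by (simp add: cis_conv_exp mult_ac)
    have "circlepath 0 r x = ?u x"
      by (simp add: circlepath e)
    moreover have "vector_derivative (circlepath 0 r) (at x within {0..1})
        = 2 * pi * \<i> * ?u x"
      using x by (simp add: vector_derivative_circlepath01 e)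
    ultimately show "g (circlepath 0 r x) / (circlepath 0 r x - 0) ^ Suc k *
         vector_derivative (circlepath 0 r) (at x within {0..1}) =
         g (?u x) / (?u x) ^ Suc k * (2 * pi * \<i> * ?u x)"
      by simp
  qed
  define I where "I = integral {0..1} (\<lambda>x. norm (g (?u x)))"
  have im: "(\<lambda>x. ?u x) ` {0..1} \<subseteq> cball 0 r"
    using r by (auto simp: norm_mult)
  have cn: "continuous_on {0..1} (\<lambda>x. norm (g (?u x)))"
    by (intro continuous_intros continuous_on_compose2[OF gc]) (use im in auto)
  have hI: "((\<lambda>x. norm (g (?u x))) has_integral I) {0..1}"
    unfolding I_def by (intro integrable_integral integrable_continuous_interval cn)
  have "norm ((2 * pi * \<i>) / fact k * (deriv ^^ k) g 0) \<le> I * (2 * pi / r ^ k)"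
  proof -
    have "norm (integral {0..1} (\<lambda>x. g (?u x) / (?u x) ^ Suc k * (2 * pi * \<i> * ?u x)))
      \<le> integral {0..1} (\<lambda>x. norm (g (?u x)) * (2 * pi / r ^ k))"
    proof (rule integral_norm_bound_integral)
      show "(\<lambda>x. norm (g (?u x)) * (2 * pi / r ^ k)) integrable_on {0..1}"
        using has_integral_mult_left[OF hI] by blast
      fix x :: real
      show "norm (g (?u x) / (?u x) ^ Suc k * (2 * pi * \<i> * ?u x))
        \<le> norm (g (?u x)) * (2 * pi / r ^ k)"
        using r by (simp add: norm_mult norm_divide norm_power)
    qed (use hi in blast)
    then show ?thesis
      unfolding integral_unique[OF hi] integral_unique[OF has_integral_mult_left[OF hI, of "2 * pi / r ^ k"]] .
  qed
  then have "norm ((deriv ^^ k) f w / fact k) * norm z ^ k \<le> I"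
    using r dg by (simp add: norm_mult norm_divide field_simps r_def[symmetric])
  also have "ennreal I = (\<integral>\<^sup>+x. indicator {0..1} x * norm (g (?u x)) \<partial>lborel)"
    by (rule nn_integral_has_integral_lebesgue[symmetric, OF _ hI]) auto
  also have "\<dots> = (\<integral>\<^sup>+x. ennreal (norm (f (w + cis (2 * pi * x) * z))) * indicator {0..1} x \<partial>lborel)"
    by (rule nn_integral_cong) (auto simp: g_def zc r_def[symmetric] mult_ac add.commute split: split_indicator)
  finally show ?thesis by (simp add: ennreal_leI)
qed

lemma borel_measurable_indicator_times_norm_powr:
  fixes f :: "complex \<Rightarrow> complex"
  assumes "continuous_on A f" and [measurable]: "A \<in> sets borel"
  shows "(\<lambda>z. ennreal (norm (f z) powr p) * indicator A z) \<in> borel_measurable borel"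
proof -
  have [measurable]: "(\<lambda>z. indicator A z *\<^sub>R f z) \<in> borel_measurable borel"
    by (rule borel_measurable_continuous_on_indicator) (use assms in auto)
  have "(\<lambda>z. ennreal (norm (f z) powr p) * indicator A z)
      = (\<lambda>z. ennreal (norm (indicator A z *\<^sub>R f z) powr p) * indicator A z)"
    by (auto split: split_indicator)
  moreover have "\<dots> \<in> borel_measurable borel" by measurable
  ultimately show ?thesis by (simp only:)
qed

text \<open>The circle mean bound with \<open>k = 0\<close>, integrated over all \<open>z\<close> in
  the disc; the rotation average then removes the circle integral.\<close>

lemma area_mean_value_inequality:
  fixes f :: "complex \<Rightarrow> complex"
  assumes hol: "f holomorphic_on ball w R" and r: "0 < r" "r \<le> R"
  shows "ennreal (pi * r\<^sup>2 * norm (f w)) \<le> (\<integral>\<^sup>+z. ennreal (norm (f z)) * indicator (ball w r) z \<partial>lborel)"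
proof -
  have cf: "continuous_on (ball w r) f"
    using hol r by (meson holomorphic_on_imp_continuous_on continuous_on_subset subset_ball)
  have m: "(\<lambda>z. ennreal (norm (f z)) * indicator (ball w r) z) \<in> borel_measurable borel"
    using borel_measurable_indicator_times_norm_powr[OF cf, of 1] by simp
  define F where "F z = ennreal (norm (f (w + z))) * indicator (ball w r) (w + z)" for z
  have [measurable]: "F \<in> borel_measurable borel"
    unfolding F_def by (rule measurable_compose[OF _ m]) auto
  have Fb: "indicator (ball w r) (w + z) = (indicator (ball 0 r) z :: ennreal)" for z
    by (auto simp: dist_norm split: split_indicator)
  have "ennreal (pi * r\<^sup>2 * norm (f w)) = (\<integral>\<^sup>+z. ennreal (norm (f w)) * indicator (ball (0::complex) r) z \<partial>lborel)"
    using r by (subst nn_integral_cmult_indicator)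
      (auto simp: emeasure_ball unit_ball_vol_2 ennreal_mult' [symmetric] mult_ac)
  also have "\<dots> \<le> (\<integral>\<^sup>+z. circle_integral F z \<partial>lborel)"
  proof (rule nn_integral_mono)
    fix z :: complex
    show "ennreal (norm (f w)) * indicator (ball 0 r) z
       \<le> circle_integral F z"
    proof (cases "norm z < r")
      case True
      have "ennreal (norm (f w)) \<le> (\<integral>\<^sup>+x. ennreal (norm (f (w + cis (2 * pi * x) * z))) * indicator {0..1} x \<partial>lborel)"
        using taylor_coeff_le_circle_mean[OF hol, of z 0] True r by simp
      also have "\<dots> = circle_integral F z"
        using True by (intro nn_integral_cong) (auto simp: F_def Fb norm_mult)
      finally show ?thesis using True by simp
    qed simp
  qed
  also have "\<dots> = (\<integral>\<^sup>+z. F z \<partial>lborel)"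
    by (rule nn_integral_rotation_average) simp
  also have "\<dots> = (\<integral>\<^sup>+z. ennreal (norm (f z)) * indicator (ball w r) z \<partial>lborel)"
    unfolding F_def using nn_integral_distr[of "(+) w" lborel borel "\<lambda>z. ennreal (norm (f z)) * indicator (ball w r) z"] m
    by (simp add: lborel_distr_plus)
  finally show ?thesis .
qed

text \<open>The sub-mean value property of powers below 1 is obtained without subharmonicity: a point
  maximising |f(v)| (r - |v - w|)^(2/p) allows the integrand |f| in the ordinary mean value
  inequality to be traded for |f|^p.\<close>

lemma area_mean_value_inequality_powr_le_1:
  fixes f :: "complex \<Rightarrow> complex"
  assumes hol: "f holomorphic_on ball w R" and r: "0 < r" "r < R" and p: "0 < p" "p \<le> 1"
  shows "ennreal (r\<^sup>2 * norm (f w) powr p)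
     \<le> ennreal (2 powr (2/p) / pi) * (\<integral>\<^sup>+z. ennreal (norm (f z) powr p) * indicator (ball w r) z \<partial>lborel)"
proof (cases "f w = 0")
  case False
  define \<Phi> where "\<Phi> v = norm (f v) * (r - norm (v - w)) powr (2/p)" for v
  have cf: "continuous_on (cball w r) f"
    using hol r by (intro holomorphic_on_imp_continuous_on holomorphic_on_subset[OF hol]) auto
  have "continuous_on (cball w r) \<Phi>"
    unfolding \<Phi>_def using p
    by (intro continuous_intros cf continuous_on_powr') (auto simp: dist_norm norm_minus_commute)
  then obtain v where v: "v \<in> cball w r" and vmax: "\<And>u. u \<in> cball w r \<Longrightarrow> \<Phi> u \<le> \<Phi> v"
    using continuous_attains_sup[of "cball w r" \<Phi>] r by auto
  define M where "M = \<Phi> v"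
  have "0 < \<Phi> w" using False r p by (simp add: \<Phi>_def)
  also have "\<Phi> w \<le> M" unfolding M_def using vmax r by simp
  finally have M: "M > 0" .
  \<comment> \<open>Half the distance from \<open>v\<close> to the boundary of
    \<open>ball w r\<close>: on \<open>ball v \<rho>\<close> that distance stays at least \<rho>, so
    maximality of \<open>\<Phi> v\<close> gives |f| \<le> M \<rho>^(-2/p) there.\<close>
  define \<rho> where "\<rho> = (r - norm (v - w)) / 2"
  have rho: "\<rho> > 0"
  proof -
    have "r - norm (v - w) \<noteq> 0" using M p by (auto simp: M_def \<Phi>_def)
    then show ?thesis using v by (auto simp: \<rho>_def dist_norm norm_minus_commute)
  qed
  have sub: "ball v \<rho> \<subseteq> ball w r"
  proof
    fix u assume "u \<in> ball v \<rho>"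
    then have "norm (v - u) < \<rho>" by (simp add: dist_norm)
    moreover have "norm (u - w) \<le> norm (u - v) + norm (v - w)" using norm_triangle_ineq[of "u - v" "v - w"] by simp
    ultimately have "norm (u - w) < r" using rho by (simp add: \<rho>_def norm_minus_commute)
    then show "u \<in> ball w r" by (simp add: dist_norm norm_minus_commute)
  qed
  define I where "I = (\<integral>\<^sup>+z. ennreal (norm (f z) powr p) * indicator (ball w r) z \<partial>lborel)"
  \<comment> \<open>The resulting bound for |f|^(1 - p), the factor lost when |f| is replaced by
    |f|^p.\<close>
  define K where "K = (M * \<rho> powr (-2/p)) powr (1 - p)"
  have K: "K \<ge> 0" by (simp add: K_def)
  have pt: "norm (f u) \<le> K * norm (f u) powr p" if u: "u \<in> ball v \<rho>" for u
  proof (cases "f u = 0")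
    case False
    have "norm (v - u) < \<rho>" using u by (simp add: dist_norm)
    moreover have "norm (u - w) \<le> norm (u - v) + norm (v - w)" using norm_triangle_ineq[of "u - v" "v - w"] by simp
    ultimately have d: "\<rho> \<le> r - norm (u - w)" by (simp add: \<rho>_def norm_minus_commute field_simps)
    have "norm (f u) * \<rho> powr (2/p) \<le> \<Phi> u"
      unfolding \<Phi>_def using d rho p by (intro mult_left_mono powr_mono2) auto
    also have "\<Phi> u \<le> M" unfolding M_def using sub u by (intro vmax) auto
    finally have "norm (f u) \<le> M * \<rho> powr (-2/p)"
      using rho by (simp add: powr_minus field_simps)
    then have "norm (f u) powr (1 - p) \<le> K"
      unfolding K_def using p by (intro powr_mono2) auto
    then have "norm (f u) powr (1 - p) * norm (f u) powr p \<le> K * norm (f u) powr p"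
      by (intro mult_right_mono) auto
    then show ?thesis using False by (simp add: powr_add[symmetric])
  qed simp
  have "ennreal (pi * \<rho>\<^sup>2 * norm (f v)) \<le> (\<integral>\<^sup>+z. ennreal (norm (f z)) * indicator (ball v \<rho>) z \<partial>lborel)"
  proof (rule area_mean_value_inequality[OF _ rho order_refl])
    show "f holomorphic_on ball v \<rho>"
      using sub r hol by (meson holomorphic_on_subset subset_ball order_trans less_imp_le)
  qed
  also have "\<dots> \<le> (\<integral>\<^sup>+z. ennreal K * (ennreal (norm (f z) powr p) * indicator (ball w r) z) \<partial>lborel)"
    using sub pt K by (intro nn_integral_mono)
      (auto split: split_indicator simp: ennreal_mult'[symmetric] intro!: ennreal_leI)
  also have "\<dots> = ennreal K * I"
    unfolding I_def
  proof (rule nn_integral_cmult)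
    have "continuous_on (ball w r) f" using cf continuous_on_subset ball_subset_cball by blast
    then show "(\<lambda>z. ennreal (norm (f z) powr p) * indicator (ball w r) z) \<in> borel_measurable lborel"
      using borel_measurable_indicator_times_norm_powr[of "ball w r" f p] by simp
  qed
  finally have 1: "ennreal (pi * \<rho>\<^sup>2 * norm (f v)) \<le> ennreal K * I" .
  \<comment> \<open>At \<open>v\<close> the distance is exactly 2 \<rho>, so |f v| is known in terms
    of M; with the exponent 2/p all powers of \<rho> then cancel from the mean value
    inequality.\<close>
  have fv: "norm (f v) = M * (2 * \<rho>) powr (-2/p)"
  proof -
    have "2 * \<rho> = r - norm (v - w)" by (simp add: \<rho>_def)
    then have "M = norm (f v) * (2 * \<rho>) powr (2/p)" by (simp add: M_def \<Phi>_def)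
    then show ?thesis using rho by (simp add: powr_minus field_simps)
  qed
  show ?thesis
  proof (cases "I = \<infinity>")
    case True
    then show ?thesis by (simp add: I_def[symmetric] ennreal_mult_top)
  next
    case False
    define J where "J = enn2real I"
    have J: "I = ennreal J" "J \<ge> 0" using False by (auto simp: J_def less_top)
    have "pi * \<rho>\<^sup>2 * norm (f v) \<le> K * J"
      using 1 K J by (simp add: ennreal_mult'[symmetric])
    also have "K = M powr (1 - p) * \<rho> powr (2 - 2/p)"
    proof -
      have "-2/p * (1 - p) = 2 - 2/p" using p by (simp add: field_simps)
      then show ?thesis using M rho unfolding K_def by (simp only: powr_mult powr_powr)
    qed
    also have "norm (f v) = M * (2 powr (-2/p) * \<rho> powr (-2/p))"
      using rho by (simp add: fv powr_mult)
    finally have "pi * (\<rho> powr 2 * \<rho> powr (-2/p)) * M * 2 powr (-2/p) \<le> M powr (1 - p) * \<rho> powr (2 - 2/p) * J"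
      using rho by (simp add: mult_ac powr_numeral)
    also have "\<rho> powr 2 * \<rho> powr (-2/p) = \<rho> powr (2 - 2/p)"
      by (simp add: powr_add[symmetric])
    finally have "\<rho> powr (2 - 2/p) * (pi * M * 2 powr (-2/p)) \<le> \<rho> powr (2 - 2/p) * (M powr (1 - p) * J)"
      by (simp add: mult_ac)
    then have "pi * M * 2 powr (-2/p) \<le> M powr (1 - p) * J"
      using rho by simp
    moreover have "M = M powr (1 - p) * M powr p"
      using M by (simp add: powr_add[symmetric])
    ultimately have "pi * (M powr (1 - p) * M powr p) * 2 powr (-2/p) \<le> M powr (1 - p) * J"
      by simp
    then have "M powr (1 - p) * (pi * M powr p * 2 powr (-2/p)) \<le> M powr (1 - p) * J"
      by (simp add: mult_ac)
    then have le: "pi * M powr p * 2 powr (-2/p) \<le> J"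
      using M by simp
    have "(norm (f w) * r powr (2/p)) powr p \<le> M powr p"
      using \<open>\<Phi> w \<le> M\<close> r p by (intro powr_mono2) (auto simp: \<Phi>_def)
    then have "r\<^sup>2 * norm (f w) powr p \<le> M powr p"
      using r p by (simp add: powr_mult powr_powr powr_numeral mult.commute)
    also have "\<dots> \<le> 2 powr (2/p) / pi * J"
      using le by (simp add: powr_minus field_simps)
    finally show ?thesis
      unfolding I_def[symmetric] J by (simp add: ennreal_mult'[symmetric] J(2) ennreal_leI)
  qed
qed (use p in simp)

text \<open>A large exponent is brought down to at most 1 by passing to \<open>f v ^ n\<close>,
  since |f^n|^(p/n) = |f|^p.\<close>

lemma area_mean_value_inequality_powr:
  fixes p :: real
  assumes p: "0 < p"
  obtains C where "C > 0"
    "\<And>f w r R. \<lbrakk>f holomorphic_on ball w R; 0 < r; r < R\<rbrakk> \<Longrightarrow>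
       ennreal (r\<^sup>2 * norm (f w) powr p)
       \<le> ennreal C * (\<integral>\<^sup>+z. ennreal (norm (f z) powr p) * indicator (ball w r) z \<partial>lborel)"
proof -
  define n where "n = nat \<lceil>p\<rceil>"
  have n: "n > 0" "p \<le> real n" using p by (auto simp: n_def)
  have e: "norm (f v ^ n) powr (p / real n) = norm (f v) powr p" for f :: "complex \<Rightarrow> complex" and v
  proof (cases "f v = 0")
    case False
    then show ?thesis using n
      by (simp add: norm_power powr_realpow[symmetric] powr_powr)
  qed (use n p in auto)
  show ?thesis
  proof (rule that[of "2 powr (2/(p / real n)) / pi"])
    fix f :: "complex \<Rightarrow> complex" and w r R
    assume *: "f holomorphic_on ball w R" "0 < r" "r < R"
    show "ennreal (r\<^sup>2 * norm (f w) powr p)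
       \<le> ennreal (2 powr (2/(p / real n)) / pi) * (\<integral>\<^sup>+z. ennreal (norm (f z) powr p) * indicator (ball w r) z \<partial>lborel)"
      using area_mean_value_inequality_powr_le_1[of "\<lambda>v. f v ^ n" w R r "p / real n"] * n p
      unfolding e by (auto intro: holomorphic_intros)
  qed simp
qed

section \<open>Bergman densities and the local growth estimate\<close>

definition disc_weight :: "real \<Rightarrow> complex \<Rightarrow> ennreal" where
  "disc_weight \<gamma> z = ennreal ((1 - (norm z)\<^sup>2) powr \<gamma> / pi) * indicator (ball 0 1) z"

lemma borel_measurable_disc_weight [measurable]: "disc_weight \<gamma> \<in> borel_measurable borel"
  unfolding disc_weight_def[abs_def] by (measurable, simp)

definition bergman_density :: "real \<Rightarrow> real \<Rightarrow> (complex \<Rightarrow> complex) \<Rightarrow> complex \<Rightarrow> ennreal" where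
  "bergman_density p \<alpha> f z = ennreal (norm (f z) powr p) * disc_weight \<alpha> z"

lemma bergman_density_eq:
  "bergman_density p \<alpha> f z = ennreal (norm (f z) powr p * (1 - (norm z)\<^sup>2) powr \<alpha> / pi) * indicator (ball 0 1) z"
  by (auto simp: bergman_density_def disc_weight_def ennreal_mult'[symmetric] split: split_indicator)

lemma bergman_integral_eq: "bergman_integral p \<alpha> f = (\<integral>\<^sup>+z. bergman_density p \<alpha> f z \<partial>lborel)"
  by (simp add: bergman_integral_def bergman_density_eq)

lemma borel_measurable_bergman_density [measurable]:
  assumes "f holomorphic_on ball 0 1"
  shows "bergman_density p \<alpha> f \<in> borel_measurable borel"
proof -
  have m: "(\<lambda>z. ennreal (norm (f z) powr p) * indicator (ball 0 1) z) \<in> borel_measurable borel"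
    by (rule borel_measurable_indicator_times_norm_powr) (use assms holomorphic_on_imp_continuous_on in auto)
  have "bergman_density p \<alpha> f = (\<lambda>z. (ennreal (norm (f z) powr p) * indicator (ball 0 1) z) * disc_weight \<alpha> z)"
    by (auto simp: bergman_density_def disc_weight_def fun_eq_iff split: split_indicator)
  then show ?thesis using borel_measurable_times_ennreal[OF m borel_measurable_disc_weight] by simp
qed

text \<open>Within half the distance to the unit circle, all distances to the circle are comparable;
  passing from 1 - |u| to 1 - |u|^2 costs a factor 1 + |u| between 1 and 2.\<close>

lemma one_minus_norm_bounds:
  fixes u z :: complex
  assumes u: "u \<in> ball z ((1 - norm z) / 2)" and z: "norm z < 1"
  shows "(1 - norm z) / 2 < 1 - norm u" "1 - norm u < 3 / 2 * (1 - norm z)" "norm u < 1"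
    "(1 - norm z) / 2 < 1 - (norm u)\<^sup>2" "1 - (norm u)\<^sup>2 < 3 * (1 - norm z)"
proof -
  have d: "norm (z - u) < (1 - norm z) / 2" using u by (simp add: dist_norm)
  show 1: "(1 - norm z) / 2 < 1 - norm u"
    using d norm_triangle_ineq2[of u z] by (simp add: norm_minus_commute field_simps)
  show 2: "1 - norm u < 3 / 2 * (1 - norm z)"
    using d norm_triangle_ineq2[of z u] by (simp add: field_simps)
  show 3: "norm u < 1" using 1 z by simp
  have e: "1 - (norm u)\<^sup>2 = (1 - norm u) * (1 + norm u)"
    by (simp add: power2_eq_square algebra_simps)
  have "(1 - norm u) * 1 \<le> (1 - norm u) * (1 + norm u)"
    using 3 by (intro mult_left_mono) auto
  then show "(1 - norm z) / 2 < 1 - (norm u)\<^sup>2" using 1 e by simp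
  have "(1 - norm u) * (1 + norm u) \<le> (1 - norm u) * 2"
    using 3 by (intro mult_left_mono) auto
  then show "1 - (norm u)\<^sup>2 < 3 * (1 - norm z)" using 2 e by simp
qed

text \<open>The integral is kept on the small disc. Growth estimates enlarge it to the whole disc,
  while \<open>carleson_embedding\<close> needs the localisation to control which \<open>t\<close>
  can see a given point of the disc.\<close>

abbreviation bergman_local_bound :: "real \<Rightarrow> real \<Rightarrow> real \<Rightarrow> bool" where
  "bergman_local_bound C p \<alpha> \<equiv> (\<forall>f z. f holomorphic_on ball 0 1 \<longrightarrow> norm z < 1 \<longrightarrow>
     ennreal ((1 - norm z) powr (\<alpha> + 2) * norm (f z) powr p)
     \<le> ennreal C * (\<integral>\<^sup>+u. bergman_density p \<alpha> f u * indicator (ball z ((1 - norm z) / 2)) u \<partial>lborel))"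

text \<open>The sub-mean value inequality with radius (1 - |z|) / 2: on that disc the weight is
  comparable to (1 - |z|)^\<alpha>, and the squared radius supplies the 2 in the exponent.\<close>

lemma bergman_local_estimate:
  fixes p \<alpha> :: real
  assumes p: "0 < p"
  obtains C where "C > 0"
    "bergman_local_bound C p \<alpha>"
proof -
  obtain C where C: "C > 0" and Cb:
    "\<And>f w r R. \<lbrakk>f holomorphic_on ball w R; 0 < r; r < R\<rbrakk> \<Longrightarrow>
       ennreal (r\<^sup>2 * norm (f w) powr p)
       \<le> ennreal C * (\<integral>\<^sup>+z. ennreal (norm (f z) powr p) * indicator (ball w r) z \<partial>lborel)"
    using area_mean_value_inequality_powr[OF p] by blast
  \<comment> \<open>Lower bound for the ratio of (1 - |u|^2)^\<alpha> to d^\<alpha> when 1 - |u|^2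
    lies between d/2 and 3 d; which entry is relevant depends on the sign of \<alpha>.\<close>
  define k :: real where "k = min ((1/2) powr \<alpha>) (3 powr \<alpha>)"
  have k: "k > 0" by (auto simp: k_def)
  show ?thesis
  proof (rule that[of "4 * C * pi / k"]; (intro allI impI)?)
    show "4 * C * pi / k > 0" using C k by simp
    fix f :: "complex \<Rightarrow> complex" and z :: complex
    assume hol: "f holomorphic_on ball 0 1" and z: "norm z < 1"
    have [measurable]: "bergman_density p \<alpha> f \<in> borel_measurable borel" "ball v r \<in> sets borel" for v :: complex and r
      using borel_measurable_bergman_density[OF hol] by simp_all
    define d where "d = 1 - norm z"
    have d: "d > 0" using z by (simp add: d_def)
    have "ball z d \<subseteq> ball 0 1"
    proof
      fix u assume "u \<in> ball z d"
      then show "u \<in> ball 0 1"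
        using norm_triangle_ineq2[of u z] by (simp add: d_def dist_norm norm_minus_commute)
    qed
    then have holz: "f holomorphic_on ball z d" using hol holomorphic_on_subset by blast
    have "ennreal ((d/2)\<^sup>2 * norm (f z) powr p)
       \<le> ennreal C * (\<integral>\<^sup>+u. ennreal (norm (f u) powr p) * indicator (ball z (d/2)) u \<partial>lborel)"
      using Cb[OF holz, of "d/2"] d by simp
    also have "\<dots> \<le> ennreal C * (\<integral>\<^sup>+u. ennreal (pi / (k * d powr \<alpha>)) * (bergman_density p \<alpha> f u * indicator (ball z (d/2)) u) \<partial>lborel)"
    proof (intro mult_left_mono nn_integral_mono)
      fix u :: complex
      show "ennreal (norm (f u) powr p) * indicator (ball z (d/2)) u
        \<le> ennreal (pi / (k * d powr \<alpha>)) * (bergman_density p \<alpha> f u * indicator (ball z (d/2)) u)"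
      proof (cases "u \<in> ball z (d/2)")
        case True
        note b = one_minus_norm_bounds[OF True[unfolded d_def] z, folded d_def]
        have "k * d powr \<alpha> \<le> (1 - (norm u)\<^sup>2) powr \<alpha>"
        proof (cases "\<alpha> \<ge> 0")
          case True
          have "k * d powr \<alpha> \<le> (1/2) powr \<alpha> * d powr \<alpha>" by (intro mult_right_mono) (auto simp: k_def)
          also have "\<dots> = (d/2) powr \<alpha>" using d by (simp add: powr_divide)
          also have "\<dots> \<le> (1 - (norm u)\<^sup>2) powr \<alpha>"
            using b d True by (intro powr_mono2) auto
          finally show ?thesis .
        next
          case False
          have "k * d powr \<alpha> \<le> 3 powr \<alpha> * d powr \<alpha>" by (intro mult_right_mono) (auto simp: k_def)
          also have "\<dots> = (3*d) powr \<alpha>" using d by (simp add: powr_mult)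
          also have "\<dots> \<le> (1 - (norm u)\<^sup>2) powr \<alpha>"
            using b d False by (intro powr_mono2') auto
          finally show ?thesis .
        qed
        then have "norm (f u) powr p * (k * d powr \<alpha>) \<le> norm (f u) powr p * (1 - (norm u)\<^sup>2) powr \<alpha>"
          by (intro mult_left_mono) auto
        then have "norm (f u) powr p \<le> pi / (k * d powr \<alpha>) * (norm (f u) powr p * (1 - (norm u)\<^sup>2) powr \<alpha> / pi)"
          using k d by (simp add: field_simps)
        then show ?thesis using True b k d
          by (simp add: bergman_density_eq ennreal_mult'[symmetric] ennreal_leI)
      qed simp
    qed simp
    also have "\<dots> = ennreal C * (ennreal (pi / (k * d powr \<alpha>)) * (\<integral>\<^sup>+u. bergman_density p \<alpha> f u * indicator (ball z (d/2)) u \<partial>lborel))"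
      by (subst nn_integral_cmult) simp_all
    finally have *: "ennreal ((d/2)\<^sup>2 * norm (f z) powr p) \<le> \<dots>" .
    have "ennreal (d powr (\<alpha> + 2) * norm (f z) powr p) = ennreal (4 * d powr \<alpha>) * ennreal ((d/2)\<^sup>2 * norm (f z) powr p)"
      using d by (simp add: ennreal_mult'[symmetric] powr_add powr_numeral power_divide)
    also have "\<dots> \<le> ennreal (4 * d powr \<alpha>) * (ennreal C * (ennreal (pi / (k * d powr \<alpha>)) * (\<integral>\<^sup>+u. bergman_density p \<alpha> f u * indicator (ball z (d/2)) u \<partial>lborel)))"
      by (intro mult_left_mono *) simp
    also have "\<dots> = ennreal (4 * C * pi / k) * (\<integral>\<^sup>+u. bergman_density p \<alpha> f u * indicator (ball z (d/2)) u \<partial>lborel)"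
      using C k d by (simp add: ennreal_mult'[symmetric] mult.assoc[symmetric])
    finally show "ennreal ((1 - norm z) powr (\<alpha> + 2) * norm (f z) powr p)
       \<le> ennreal (4 * C * pi / k) * (\<integral>\<^sup>+u. bergman_density p \<alpha> f u * indicator (ball z ((1 - norm z) / 2)) u \<partial>lborel)"
      by (simp add: d_def)
  qed
qed

subsection \<open>Integrals controlled by distribution functions\<close>

lemma nn_integral_powr_Icc_0:
  fixes e c :: real
  assumes "e > -1" "c \<ge> 0"
  shows "(\<integral>\<^sup>+x. ennreal (x powr e) * indicator {0..c} x \<partial>lborel) = ennreal (c powr (e + 1) / (e + 1))"
  by (rule nn_integral_has_integral_lebesgue'[OF _ has_integral_powr_from_0]) (use assms in auto)

lemma nn_integral_powr_Ici:
  fixes b a :: real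
  assumes "b > 0" "a > 0"
  shows "(\<integral>\<^sup>+x. ennreal (b * x powr (- b - 1)) * indicator {a..} x \<partial>lborel) = ennreal (a powr - b)"
proof -
  have "(\<integral>\<^sup>+x. ennreal (b * x powr (- b - 1)) * indicator {a..} x \<partial>lborel) = ennreal (0 - (- (a powr - b)))"
  proof (rule nn_integral_FTC_atLeast)
    show "((\<lambda>x. - (x powr - b)) has_real_derivative b * x powr (- b - 1)) (at x)" if "a \<le> x" for x
      using assms that by (auto intro!: derivative_eq_intros)
    have "((\<lambda>x. x powr - b) \<longlongrightarrow> 0) at_top"
      using assms by (intro tendsto_neg_powr) (auto simp: filterlim_ident)
    then show "((\<lambda>x. - (x powr - b)) \<longlongrightarrow> 0) at_top"
      using tendsto_minus by fastforce
  qed (use assms in auto)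
  then show ?thesis by simp
qed

lemma nn_integral_powr_Icc:
  fixes e a c :: real
  assumes "e \<ge> 0" "0 < a" "a \<le> c"
  shows "(\<integral>\<^sup>+x. ennreal (e * x powr (- e - 1)) * indicator {a..c} x \<partial>lborel) = ennreal (a powr - e - c powr - e)"
proof -
  have "((\<lambda>x. e * x powr (- e - 1)) has_integral (- (c powr - e) - (- (a powr - e)))) {a..c}"
    by (rule fundamental_theorem_of_calculus)
       (use assms in \<open>auto intro!: derivative_eq_intros simp: has_real_derivative_iff_has_vector_derivative[symmetric]\<close>)
  from nn_integral_has_integral_lebesgue'[OF _ this] assms show ?thesis by simp
qed

lemma nn_integral_inverse_Icc:
  fixes a c :: real
  assumes "0 < a" "a \<le> c"
  shows "(\<integral>\<^sup>+x. ennreal (1 / x) * indicator {a..c} x \<partial>lborel) = ennreal (ln (c / a))"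
proof -
  have "((\<lambda>x. 1 / x) has_integral (ln c - ln a)) {a..c}"
    by (rule fundamental_theorem_of_calculus)
       (use assms in \<open>auto intro!: derivative_eq_intros simp: has_real_derivative_iff_has_vector_derivative[symmetric]\<close>)
  from nn_integral_has_integral_lebesgue'[OF _ this] assms show ?thesis by (simp add: ln_div)
qed

abbreviation tail_integral :: "(real \<Rightarrow> ennreal) \<Rightarrow> real \<Rightarrow> ennreal" where
  "tail_integral \<phi> a \<equiv> (\<integral>\<^sup>+v. (if a \<le> v then \<phi> v else 0) \<partial>lborel)"

abbreviation sublevel :: "'a measure \<Rightarrow> ('a \<Rightarrow> real) \<Rightarrow> real \<Rightarrow> 'a set" where
  "sublevel M h v \<equiv> {x \<in> space M. h x \<le> v}"

text \<open>Tonelli's theorem on the region h x \<le> v. The decreasing functions of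
  \<open>h\<close> estimated below are written as tail integrals, so that only the masses of
  sublevel sets enter.\<close>

lemma nn_integral_layer_cake:
  fixes h :: "'a \<Rightarrow> real" and \<phi> :: "real \<Rightarrow> ennreal"
  assumes "finite_measure M" and [measurable]: "h \<in> borel_measurable M" "\<phi> \<in> borel_measurable borel"
  shows "(\<integral>\<^sup>+x. tail_integral \<phi> (h x) \<partial>M)
       = (\<integral>\<^sup>+v. \<phi> v * emeasure M (sublevel M h v) \<partial>lborel)"
proof -
  interpret finite_measure M by fact
  interpret pair_sigma_finite M lborel ..
  have "(\<integral>\<^sup>+x. tail_integral \<phi> (h x) \<partial>M)
     = (\<integral>\<^sup>+v. (\<integral>\<^sup>+x. (if h x \<le> v then \<phi> v else 0) \<partial>M) \<partial>lborel)"
    by (rule Fubini'[symmetric]) measurable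
  also have "\<dots> = (\<integral>\<^sup>+v. (\<integral>\<^sup>+x. \<phi> v * indicator (sublevel M h v) x \<partial>M) \<partial>lborel)"
    by (intro nn_integral_cong) auto
  also have "\<dots> = (\<integral>\<^sup>+v. \<phi> v * emeasure M (sublevel M h v) \<partial>lborel)"
    by (subst nn_integral_cmult_indicator) auto
  finally show ?thesis .
qed

text \<open>Used with \<open>gap\<close> under \<mu>, where it expresses the Carleson condition, and
  with \<open>disc_gap\<close> under weighted area, where the exponent is \<gamma> + 2.\<close>

abbreviation sublevel_growth :: "'a measure \<Rightarrow> ('a \<Rightarrow> real) \<Rightarrow> real \<Rightarrow> real \<Rightarrow> bool" where
  "sublevel_growth M h C s \<equiv> \<forall>v>0. emeasure M (sublevel M h v) \<le> ennreal (C * v powr s)"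

text \<open>In effect the density h^(-e) lowers the growth exponent from s to s - e; the condition e
  < s makes the singularity at h = 0 integrable.\<close>

lemma nn_integral_powr_sublevel_le:
  fixes h :: "'a \<Rightarrow> real"
  assumes fin: "finite_measure M" and [measurable]: "h \<in> borel_measurable M"
    and h0: "\<And>x. x \<in> space M \<Longrightarrow> 0 \<le> h x"
    and N: "sublevel_growth M h C s"
    and C: "C \<ge> 0" and e: "0 \<le> e" "e < s" and u: "u > 0"
  shows "(\<integral>\<^sup>+x. ennreal (h x powr - e) * indicator {x. h x \<le> u} x \<partial>M)
       \<le> ennreal (C * s / (s - e) * u powr (s - e))"
proof -
  define \<phi> where "\<phi> v = ennreal (e * v powr (- e - 1)) * indicator {0..u} v" for v
  have [measurable]: "\<phi> \<in> borel_measurable borel" unfolding \<phi>_def by measurable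
  have "(\<integral>\<^sup>+x. ennreal (h x powr - e) * indicator {x. h x \<le> u} x \<partial>M)
     \<le> (\<integral>\<^sup>+x. ennreal (u powr - e) * indicator (sublevel M h u) x + tail_integral \<phi> (h x) \<partial>M)"
  proof (rule nn_integral_mono)
    fix x assume x: "x \<in> space M"
    show "ennreal (h x powr - e) * indicator {x. h x \<le> u} x
      \<le> ennreal (u powr - e) * indicator (sublevel M h u) x + tail_integral \<phi> (h x)"
    \<comment> \<open>Points with \<open>h x = 0\<close> contribute nothing because
      \<open>0 powr a = 0\<close>. Otherwise h^(-e) is u^(-e) plus the integral of e v^(-e - 1) from
      h to u.\<close>
    proof (cases "0 < h x \<and> h x \<le> u")
      case True
      have "ennreal (h x powr - e) = ennreal (u powr - e) + ennreal (h x powr - e - u powr - e)"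
        using True e by (subst ennreal_plus[symmetric]) (auto intro!: powr_mono2')
      also have "ennreal (h x powr - e - u powr - e) = (\<integral>\<^sup>+v. ennreal (e * v powr (- e - 1)) * indicator {h x..u} v \<partial>lborel)"
        using nn_integral_powr_Icc[of e "h x" u] True e by simp
      also have "\<dots> = tail_integral \<phi> (h x)"
        using True by (intro nn_integral_cong) (auto simp: \<phi>_def split: split_indicator)
      finally show ?thesis using True x by simp
    next
      case False
      then show ?thesis using h0[OF x] by (auto split: split_indicator)
    qed
  qed
  also have "\<dots> = ennreal (u powr - e) * emeasure M (sublevel M h u)
      + (\<integral>\<^sup>+v. \<phi> v * emeasure M (sublevel M h v) \<partial>lborel)"
    using nn_integral_layer_cake[OF fin, of h \<phi>]
    by (subst nn_integral_add) (auto simp: nn_integral_cmult_indicator)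
  also have "\<dots> \<le> ennreal (u powr - e) * ennreal (C * u powr s)
      + (\<integral>\<^sup>+v. ennreal (e * C) * (ennreal (v powr (s - e - 1)) * indicator {0..u} v) \<partial>lborel)"
  proof (intro add_mono mult_left_mono N[rule_format] u nn_integral_mono)
    fix v :: real
    show "\<phi> v * emeasure M (sublevel M h v) \<le> ennreal (e * C) * (ennreal (v powr (s - e - 1)) * indicator {0..u} v)"
    proof (cases "0 < v \<and> v \<le> u")
      case True
      have "\<phi> v * emeasure M (sublevel M h v) \<le> ennreal (e * v powr (- e - 1)) * ennreal (C * v powr s)"
        using True unfolding \<phi>_def by (intro mult_mono N[rule_format]) auto
      also have "\<dots> = ennreal (e * C) * ennreal (v powr (s - e - 1))"
        using True C e by (simp add: ennreal_mult'[symmetric] powr_add[symmetric] mult_ac) (simp add: algebra_simps)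
      finally show ?thesis using True by simp
    qed (auto simp: \<phi>_def split: split_indicator)
  qed simp
  also have "\<dots> = ennreal (C * u powr (s - e)) + ennreal (e * C) * ennreal (u powr (s - e) / (s - e))"
    using nn_integral_powr_Icc_0[of "s - e - 1" u] e u C
    by (subst nn_integral_cmult) (auto simp: ennreal_mult'[symmetric] powr_add[symmetric] mult_ac)
  also have "\<dots> = ennreal (C * s / (s - e) * u powr (s - e))"
    using e C by (simp add: ennreal_mult'[symmetric] ennreal_plus[symmetric] field_simps del: ennreal_plus)
  finally show ?thesis .
qed

text \<open>The integrand is the tail integral of b v^(-b - 1) cut off below \<delta>; against a
  mass of order v^s it converges at infinity because s < b.\<close>

lemma nn_integral_max_powr_le:
  fixes h :: "'a \<Rightarrow> real"
  assumes fin: "finite_measure M" and [measurable]: "h \<in> borel_measurable M"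
    and N: "sublevel_growth M h C s"
    and C: "C \<ge> 0" and s: "0 < b" "s < b" and d: "\<delta> > 0"
  shows "(\<integral>\<^sup>+x. ennreal (max (h x) \<delta> powr - b) \<partial>M) \<le> ennreal (C * b / (b - s) * \<delta> powr (s - b))"
proof -
  define \<phi> where "\<phi> v = ennreal (b * v powr (- b - 1)) * indicator {\<delta>..} v" for v
  have [measurable]: "\<phi> \<in> borel_measurable borel" unfolding \<phi>_def by measurable
  have "(\<integral>\<^sup>+x. ennreal (max (h x) \<delta> powr - b) \<partial>M) = (\<integral>\<^sup>+x. tail_integral \<phi> (h x) \<partial>M)"
  proof (rule nn_integral_cong)
    fix x
    show "ennreal (max (h x) \<delta> powr - b) = tail_integral \<phi> (h x)"
      using d s by (subst nn_integral_powr_Ici[symmetric])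
        (auto intro!: nn_integral_cong simp: \<phi>_def split: split_indicator)
  qed
  also have "\<dots> = (\<integral>\<^sup>+v. \<phi> v * emeasure M (sublevel M h v) \<partial>lborel)"
    by (rule nn_integral_layer_cake[OF fin]) auto
  also have "\<dots> \<le> (\<integral>\<^sup>+v. ennreal (C * b / (b - s)) * (ennreal ((b - s) * v powr (- (b - s) - 1)) * indicator {\<delta>..} v) \<partial>lborel)"
  proof (rule nn_integral_mono)
    fix v :: real
    show "\<phi> v * emeasure M (sublevel M h v)
      \<le> ennreal (C * b / (b - s)) * (ennreal ((b - s) * v powr (- (b - s) - 1)) * indicator {\<delta>..} v)"
    proof (cases "\<delta> \<le> v")
      case True
      have "\<phi> v * emeasure M (sublevel M h v) \<le> ennreal (b * v powr (- b - 1)) * ennreal (C * v powr s)"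
        using True d unfolding \<phi>_def by (intro mult_mono N[rule_format]) auto
      also have "\<dots> = ennreal (C * b / (b - s)) * ennreal ((b - s) * v powr (- (b - s) - 1))"
        using True d C s by (simp add: ennreal_mult'[symmetric] powr_add[symmetric] mult_ac) (simp add: algebra_simps)
      finally show ?thesis using True by simp
    qed (auto simp: \<phi>_def)
  qed
  also have "\<dots> = ennreal (C * b / (b - s)) * ennreal (\<delta> powr - (b - s))"
    using nn_integral_powr_Ici[of "b - s" \<delta>] s d by (subst nn_integral_cmult) auto
  also have "\<dots> = ennreal (C * b / (b - s) * \<delta> powr (s - b))"
    using s C by (simp add: ennreal_mult'[symmetric])
  finally show ?thesis .
qed

text \<open>The borderline case b = s of the preceding estimate: the layers now contribute dv / v,
  so an upper bound \<open>H\<close> for \<open>h\<close> is needed and the logarithm of H /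
  \<delta> appears.\<close>

lemma nn_integral_max_powr_le_log:
  fixes h :: "'a \<Rightarrow> real"
  assumes fin: "finite_measure M" and [measurable]: "h \<in> borel_measurable M"
    and N: "sublevel_growth M h C s"
    and C: "C \<ge> 0" and s: "0 < s" and d: "0 < \<delta>" "\<delta> \<le> H"
    and H: "\<And>x. x \<in> space M \<Longrightarrow> h x \<le> H"
  shows "(\<integral>\<^sup>+x. ennreal (max (h x) \<delta> powr - s) \<partial>M) \<le> ennreal (C + C * s * ln (H / \<delta>))"
proof -
  define \<phi> where "\<phi> v = ennreal (s * v powr (- s - 1)) * indicator {\<delta>..H} v" for v
  have [measurable]: "\<phi> \<in> borel_measurable borel" unfolding \<phi>_def by measurable
  have "(\<integral>\<^sup>+x. ennreal (max (h x) \<delta> powr - s) \<partial>M)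
     = (\<integral>\<^sup>+x. ennreal (H powr - s) * indicator (sublevel M h H) x + tail_integral \<phi> (h x) \<partial>M)"
  proof (rule nn_integral_cong)
    fix x assume x: "x \<in> space M"
    have m: "0 < max (h x) \<delta>" "max (h x) \<delta> \<le> H" using d H[OF x] by auto
    have "ennreal (max (h x) \<delta> powr - s) = ennreal (H powr - s) + ennreal (max (h x) \<delta> powr - s - H powr - s)"
      using m s by (subst ennreal_plus[symmetric]) (auto intro!: powr_mono2')
    also have "ennreal (max (h x) \<delta> powr - s - H powr - s) = (\<integral>\<^sup>+v. ennreal (s * v powr (- s - 1)) * indicator {max (h x) \<delta>..H} v \<partial>lborel)"
      using nn_integral_powr_Icc[of s "max (h x) \<delta>" H] m s by simp
    also have "\<dots> = tail_integral \<phi> (h x)"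
      by (intro nn_integral_cong) (auto simp: \<phi>_def split: split_indicator)
    finally show "ennreal (max (h x) \<delta> powr - s)
      = ennreal (H powr - s) * indicator (sublevel M h H) x + tail_integral \<phi> (h x)"
      using H[OF x] x by simp
  qed
  also have "\<dots> = ennreal (H powr - s) * emeasure M (sublevel M h H)
      + (\<integral>\<^sup>+v. \<phi> v * emeasure M (sublevel M h v) \<partial>lborel)"
    using nn_integral_layer_cake[OF fin, of h \<phi>]
    by (subst nn_integral_add) (auto simp: nn_integral_cmult_indicator)
  also have "\<dots> \<le> ennreal (H powr - s) * ennreal (C * H powr s)
      + (\<integral>\<^sup>+v. ennreal (C * s) * (ennreal (1 / v) * indicator {\<delta>..H} v) \<partial>lborel)"
  proof (intro add_mono mult_left_mono N[rule_format] nn_integral_mono)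
    fix v :: real
    show "\<phi> v * emeasure M (sublevel M h v) \<le> ennreal (C * s) * (ennreal (1 / v) * indicator {\<delta>..H} v)"
    proof (cases "\<delta> \<le> v \<and> v \<le> H")
      case True
      have "\<phi> v * emeasure M (sublevel M h v) \<le> ennreal (s * v powr (- s - 1)) * ennreal (C * v powr s)"
        using True d unfolding \<phi>_def by (intro mult_mono N[rule_format]) auto
      also have "\<dots> = ennreal (C * s) * ennreal (1 / v)"
        using True d C s by (simp add: ennreal_mult'[symmetric] powr_add[symmetric] mult_ac powr_diff powr_minus field_simps)
      finally show ?thesis using True by simp
    qed (auto simp: \<phi>_def split: split_indicator)
  qed (use d in auto)
  also have "\<dots> = ennreal C + ennreal (C * s) * ennreal (ln (H / \<delta>))"
    using nn_integral_inverse_Icc[of \<delta> H] d C s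
    by (subst nn_integral_cmult) (auto simp: ennreal_mult'[symmetric] powr_minus)
  also have "\<dots> = ennreal (C + C * s * ln (H / \<delta>))"
    using d C s by (simp add: ennreal_mult'[symmetric] ennreal_plus[symmetric] del: ennreal_plus)
  finally show ?thesis .
qed

text \<open>The factor h^(-e) is put into the measure, whose growth exponent becomes s - e by
  \<open>nn_integral_powr_sublevel_le\<close>; then \<open>nn_integral_max_powr_le\<close> applies.
  The bound \<open>H\<close> makes the new measure finite.\<close>

lemma nn_integral_powr_max_powr_le:
  fixes h :: "'a \<Rightarrow> real"
  assumes fin: "finite_measure M" and [measurable]: "h \<in> borel_measurable M"
    and h0: "\<And>x. x \<in> space M \<Longrightarrow> 0 \<le> h x" and H: "\<And>x. x \<in> space M \<Longrightarrow> h x \<le> H" "H > 0"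
    and N: "sublevel_growth M h C s"
    and C: "C \<ge> 0" and e: "0 \<le> e" "e < s" "s < e + b" and d: "\<delta> > 0"
  shows "(\<integral>\<^sup>+x. ennreal (h x powr - e * max (h x) \<delta> powr - b) \<partial>M)
     \<le> ennreal (C * s / (s - e) * b / (b - (s - e)) * \<delta> powr (s - e - b))"
proof -
  define M' where "M' = density M (\<lambda>x. ennreal (h x powr - e))"
  have [simp]: "space M' = space M" "sets M' = sets M" by (auto simp: M'_def)
  have [measurable]: "h \<in> borel_measurable M'" by (simp add: M'_def)
  have N': "sublevel_growth M' h (C * s / (s - e)) (s - e)"
  proof (intro allI impI)
    fix v :: real assume v: "v > 0"
    have "emeasure M' (sublevel M' h v) = (\<integral>\<^sup>+x. ennreal (h x powr - e) * indicator {x. h x \<le> v} x \<partial>M)"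
      unfolding M'_def by (subst emeasure_density) (auto intro!: nn_integral_cong split: split_indicator)
    also have "\<dots> \<le> ennreal (C * s / (s - e) * v powr (s - e))"
      by (rule nn_integral_powr_sublevel_le) (use assms v in auto)
    finally show "emeasure M' (sublevel M' h v) \<le> \<dots>" .
  qed
  have "sublevel M' h H = space M'" using H by auto
  then have "emeasure M' (space M') \<noteq> \<infinity>"
    using N'[rule_format, OF H(2)] by (auto simp: top_unique)
  then have fin': "finite_measure M'" by (rule finite_measureI)
  have "(\<integral>\<^sup>+x. ennreal (h x powr - e * max (h x) \<delta> powr - b) \<partial>M) = (\<integral>\<^sup>+x. ennreal (max (h x) \<delta> powr - b) \<partial>M')"
    unfolding M'_def by (subst nn_integral_density) (auto simp: ennreal_mult')
  also have "\<dots> \<le> ennreal (C * s / (s - e) * b / (b - (s - e)) * \<delta> powr ((s - e) - b))"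
    by (rule nn_integral_max_powr_le[OF fin' _ N']) (use assms in auto)
  finally show ?thesis by simp
qed

text \<open>Young's inequality with the scale \<open>c = X / T\<close>, for which one of its two terms can be absorbed by \<open>X\<close>.\<close>

lemma nn_integral_Jensen_powr:
  fixes g k :: "'a \<Rightarrow> real"
  assumes [measurable]: "g \<in> borel_measurable M" "k \<in> borel_measurable M"
    and g0: "\<And>x. x \<in> space M \<Longrightarrow> 0 \<le> g x" and k0: "\<And>x. x \<in> space M \<Longrightarrow> 0 \<le> k x"
    and T: "(\<integral>\<^sup>+x. ennreal (k x) \<partial>M) \<le> ennreal T" "T > 0"
    and q: "q > 1"
    and X: "X \<ge> 0" "ennreal X \<le> (\<integral>\<^sup>+x. ennreal (g x * k x) \<partial>M)"
  shows "ennreal (X powr q) \<le> ennreal (T powr (q - 1)) * (\<integral>\<^sup>+x. ennreal (g x powr q * k x) \<partial>M)"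
proof (cases "X = 0 \<or> (\<integral>\<^sup>+x. ennreal (g x powr q * k x) \<partial>M) = \<infinity>")
  case True
  then show ?thesis using T q by (auto simp: ennreal_mult_top)
next
  case False
  define A where "A = enn2real (\<integral>\<^sup>+x. ennreal (g x powr q * k x) \<partial>M)"
  have A: "(\<integral>\<^sup>+x. ennreal (g x powr q * k x) \<partial>M) = ennreal A" "A \<ge> 0"
    using False by (auto simp: A_def less_top)
  define c where "c = X / T"
  have c: "c > 0" using X T False by (simp add: c_def)
  define q' where "q' = q / (q - 1)"
  have q': "q' > 1" "1/q + 1/q' = 1" "1 / q' = 1 - 1/q" using q by (auto simp: q'_def field_simps)
  let ?d = "c powr (1 - q) / q"
  have pt: "g x \<le> g x powr q * ?d + c / q'" if "x \<in> space M" for x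
  proof -
    \<comment> \<open>Young's inequality against the constant 1; after integration the second term
      is at most X (1 - 1/q), which leaves X / q on the left.\<close>
    have "(g x / c) * 1 \<le> (g x / c) powr q / q + 1 powr q' / q'"
      by (rule Youngs_inequality) (use q q' c g0[OF that] in auto)
    then have "c * ((g x / c) * 1) \<le> c * ((g x / c) powr q / q + 1 powr q' / q')"
      using c by (intro mult_left_mono) auto
    also have "c * ((g x / c) powr q / q + 1 powr q' / q') = g x powr q * (c / c powr q / q) + c / q'"
      using c g0[OF that] by (simp add: powr_divide field_simps)
    finally show ?thesis using c by (simp add: powr_diff)
  qed
  have "ennreal X \<le> (\<integral>\<^sup>+x. ennreal (g x * k x) \<partial>M)" by (rule X)
  also have "\<dots> \<le> (\<integral>\<^sup>+x. ennreal ?d * ennreal (g x powr q * k x) + ennreal (c / q') * ennreal (k x) \<partial>M)"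
  proof (rule nn_integral_mono)
    fix x assume x: "x \<in> space M"
    have "g x * k x \<le> ?d * (g x powr q * k x) + (c / q') * k x"
      using mult_right_mono[OF pt[OF x] k0[OF x]] by (simp add: algebra_simps)
    then have "ennreal (g x * k x) \<le> ennreal (?d * (g x powr q * k x) + (c / q') * k x)"
      by (rule ennreal_leI)
    also have "\<dots> = ennreal ?d * ennreal (g x powr q * k x) + ennreal (c / q') * ennreal (k x)"
      using c q q' k0[OF x] by (subst ennreal_plus) (auto simp: ennreal_mult'[symmetric])
    finally show "ennreal (g x * k x) \<le> \<dots>" .
  qed
  also have "\<dots> = ennreal ?d * ennreal A + ennreal (c / q') * (\<integral>\<^sup>+x. ennreal (k x) \<partial>M)"
    unfolding A(1)[symmetric] by (subst nn_integral_add) (auto simp: nn_integral_cmult)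
  also have "\<dots> \<le> ennreal ?d * ennreal A + ennreal (c / q') * ennreal T"
    by (intro add_mono mult_left_mono T) auto
  also have "\<dots> = ennreal (?d * A + c / q' * T)"
    using c q q' A T by (subst ennreal_plus) (auto simp: ennreal_mult'[symmetric])
  finally have "X \<le> ?d * A + c / q' * T" using c q q' A T by (subst (asm) ennreal_le_iff) auto
  also have "c / q' * T = X * (1 / q')" using T by (simp add: c_def)
  also have "\<dots> = X - X / q" unfolding q'(3) by (simp add: algebra_simps)
  finally have "X \<le> c powr (1 - q) * A" using q by (simp add: field_simps)
  then have "X powr q \<le> X powr (q - 1) * (c powr (1 - q) * A)"
    using X False powr_add[of X 1 "q - 1"] by (simp add: mult_left_mono mult.commute)
  also have "\<dots> = T powr (q - 1) * A"
    using X T False by (simp add: c_def powr_divide powr_diff)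
  finally show ?thesis using A by (simp add: ennreal_mult'[symmetric] ennreal_leI)
qed

subsection \<open>Weighted area near the boundary\<close>

lemma sets_ball_complex [measurable]: "ball (z :: complex) r \<in> sets borel"
  by simp

text \<open>The disc |z|^2 \<le> x has area pi x, so the image of normalised area under |z|^2 is
  Lebesgue measure on the unit interval; it suffices to compare half-lines.\<close>

lemma nn_integral_disc_radial:
  fixes g :: "real \<Rightarrow> ennreal"
  assumes [measurable]: "g \<in> borel_measurable borel"
  shows "(\<integral>\<^sup>+z. g ((norm z)\<^sup>2) * (ennreal (1 / pi) * indicator (ball (0::complex) 1) z) \<partial>lborel)
       = (\<integral>\<^sup>+u. g u * indicator {0..1} u \<partial>lborel)"
proof -
  define M where "M = density lborel (\<lambda>z. ennreal (1 / pi) * indicator (ball (0::complex) 1) z)"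
  define N where "N = density lborel (\<lambda>u::real. indicator {0..1} u :: ennreal)"
  have [simp]: "space M = UNIV" "sets M = sets borel" by (auto simp: M_def)
  have [measurable]: "(\<lambda>z::complex. (norm z)\<^sup>2) \<in> borel_measurable M" unfolding M_def by measurable
  have eM: "emeasure M A = ennreal (1 / pi) * emeasure lborel (ball 0 1 \<inter> A)" if [measurable]: "A \<in> sets borel" for A
    unfolding M_def
    by (subst emeasure_density)
       (auto simp: nn_integral_cmult_indicator[symmetric] indicator_inter_arith mult_ac intro!: nn_integral_cong)
  have R: "emeasure N {x<..} = emeasure lborel ({0..1} \<inter> {x<..})" for x
    unfolding N_def by (subst emeasure_density)
      (auto simp: nn_integral_indicator[symmetric] indicator_inter_arith simp del: nn_integral_indicator intro!: nn_integral_cong)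
  have eq: "emeasure (distr M borel (\<lambda>z. (norm z)\<^sup>2)) {x<..} = emeasure N {x<..}" for x
  proof -
    have [measurable]: "{z::complex. x < (norm z)\<^sup>2} \<in> sets borel"
      by measurable
    have L: "emeasure (distr M borel (\<lambda>z. (norm z)\<^sup>2)) {x<..}
        = ennreal (1 / pi) * emeasure lborel (ball 0 1 \<inter> {z::complex. x < (norm z)\<^sup>2})"
      by (subst emeasure_distr) (auto simp: vimage_def eM)
    consider "x < 0" | "0 \<le> x" "x < 1" | "1 \<le> x" by linarith
    then show ?thesis
    proof cases
      case 1
      have "ball 0 1 \<inter> {z::complex. x < (norm z)\<^sup>2} = ball 0 1"
        using 1 by (auto intro: less_le_trans)
      moreover have "{0..1} \<inter> {x<..} = {0..1}" using 1 by auto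
      ultimately show ?thesis unfolding L R
        by (simp add: emeasure_ball unit_ball_vol_2 ennreal_mult'[symmetric])
    next
      case 2
      have h: "x < (norm z)\<^sup>2 \<longleftrightarrow> sqrt x < norm z" for z :: complex
        using real_sqrt_less_iff[of x "(norm z)\<^sup>2"] by simp
      have "ball 0 1 \<inter> {z::complex. x < (norm z)\<^sup>2} = ball 0 1 - cball 0 (sqrt x)"
        unfolding h by (rule set_eqI) (simp add: not_le conj_commute)
      moreover have "emeasure lborel (ball 0 1 - cball (0::complex) (sqrt x)) = ennreal (pi * (1 - x))"
      proof -
        have "cball (0::complex) (sqrt x) \<subseteq> ball 0 1"
          using 2 by (simp add: cball_subset_ball_iff)
        then have "emeasure lborel (ball 0 1 - cball (0::complex) (sqrt x))
           = emeasure lborel (ball (0::complex) 1) - emeasure lborel (cball (0::complex) (sqrt x))"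
          using 2 by (intro emeasure_Diff) (simp_all add: emeasure_cball ennreal_mult'[symmetric])
        also have "\<dots> = ennreal pi - ennreal (pi * x)"
          using 2 by (simp add: emeasure_ball emeasure_cball unit_ball_vol_2 ennreal_mult'[symmetric])
        also have "\<dots> = ennreal (pi - pi * x)"
          using 2 by (intro ennreal_minus) auto
        finally show ?thesis by (simp add: algebra_simps)
      qed
      moreover have "{0..1} \<inter> {x<..} = {x<..1}" using 2 by auto
      ultimately show ?thesis unfolding L R using 2
        by (simp add: ennreal_mult'[symmetric])
    next
      case 3
      have "ball 0 1 \<inter> {z::complex. x < (norm z)\<^sup>2} = {}"
      proof -
        have "(norm z)\<^sup>2 < 1" if "norm z < 1" for z :: complex
          using that by (simp add: power_less_one_iff abs_square_less_1)
        then show ?thesis using 3 by force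
      qed
      moreover have "{0..1} \<inter> {x<..} = {}" using 3 by auto
      ultimately show ?thesis unfolding L R by simp
    qed
  qed
  have "distr M borel (\<lambda>z. (norm z)\<^sup>2) = N"
  proof (rule measure_eqI_lessThan)
    fix x :: real
    have "emeasure N {x<..} \<le> emeasure lborel {0..1::real}" unfolding R by (intro emeasure_mono) auto
    also have "\<dots> < \<infinity>" by simp
    finally show "emeasure (distr M borel (\<lambda>z. (norm z)\<^sup>2)) {x<..} < \<infinity>" using eq by simp
  qed (auto simp: N_def eq)
  then have "(\<integral>\<^sup>+z. g ((norm z)\<^sup>2) \<partial>M) = (\<integral>\<^sup>+u. g u \<partial>N)"
    by (subst nn_integral_distr[symmetric, of _ M borel]) auto
  then show ?thesis
    unfolding M_def N_def by (simp add: nn_integral_density mult_ac)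
qed

lemma nn_integral_disc_weight_radial:
  fixes g :: "real \<Rightarrow> ennreal"
  assumes [measurable]: "g \<in> borel_measurable borel"
  shows "(\<integral>\<^sup>+z. g ((norm z)\<^sup>2) * disc_weight \<gamma> z \<partial>lborel)
       = (\<integral>\<^sup>+u. g u * ennreal ((1 - u) powr \<gamma>) * indicator {0..1} u \<partial>lborel)"
proof -
  have "(\<integral>\<^sup>+z. g ((norm z)\<^sup>2) * disc_weight \<gamma> z \<partial>lborel)
     = (\<integral>\<^sup>+z. (g ((norm z)\<^sup>2) * ennreal ((1 - (norm z)\<^sup>2) powr \<gamma>)) * (ennreal (1 / pi) * indicator (ball (0::complex) 1) z) \<partial>lborel)"
    by (intro nn_integral_cong) (auto simp: disc_weight_def mult.assoc ennreal_mult'[symmetric] split: split_indicator)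
  also have "\<dots> = (\<integral>\<^sup>+u. (g u * ennreal ((1 - u) powr \<gamma>)) * indicator {0..1} u \<partial>lborel)"
    by (rule nn_integral_disc_radial) measurable
  finally show ?thesis .
qed

lemma nn_integral_power_disc_weight:
  assumes s: "s > (0::real)"
  shows "(\<integral>\<^sup>+z. ennreal (norm z ^ (2 * k)) * disc_weight (s - 1) z \<partial>lborel) = ennreal (Beta (real k + 1) s)"
proof -
  have "(\<integral>\<^sup>+z. ennreal (norm z ^ (2 * k)) * disc_weight (s - 1) z \<partial>lborel)
     = (\<integral>\<^sup>+u. ennreal (u ^ k) * ennreal ((1 - u) powr (s - 1)) * indicator {0..1} u \<partial>lborel)"
    using nn_integral_disc_weight_radial[of "\<lambda>u. ennreal (u ^ k)" "s - 1"] by (simp add: power_mult)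
  also have "\<dots> = (\<integral>\<^sup>+u. ennreal (u powr (real k + 1 - 1) * (1 - u) powr (s - 1)) * indicator {0..1} u \<partial>lborel)"
  \<comment> \<open>At u = 0 and k = 0 the two integrands differ, since \<open>0 ^ 0 = 1\<close> but
    \<open>0 powr 0 = 0\<close>.\<close>
  proof (rule nn_integral_cong_AE, rule AE_mp)
    show "AE u in lborel. u \<noteq> (0::real)" by (rule AE_lborel_singleton)
    show "AE u in lborel. u \<noteq> (0::real) \<longrightarrow> ennreal (u ^ k) * ennreal ((1 - u) powr (s - 1)) * indicator {0..1} u
        = ennreal (u powr (real k + 1 - 1) * (1 - u) powr (s - 1)) * indicator {0..1} u"
      by (intro AE_I2) (auto simp: ennreal_mult' powr_realpow split: split_indicator)
  qed
  also have "\<dots> = ennreal (Beta (real k + 1) s)"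
    by (rule nn_integral_has_integral_lebesgue'[OF _ has_integral_Beta_real]) (use s in auto)
  finally show ?thesis .
qed

lemma nn_integral_disc_weight:
  assumes "\<gamma> > -1"
  shows "(\<integral>\<^sup>+z. disc_weight \<gamma> z \<partial>lborel) = ennreal (1 / (\<gamma> + 1))"
proof -
  have "Gamma (1 + (\<gamma> + 1)) = (\<gamma> + 1) * Gamma (\<gamma> + 1)"
    using Gamma_plus1[of "\<gamma> + 1"] assms
    by (metis add.commute add_pos_pos less_diff_eq minus_less_iff nonpos_Ints_nonpos not_le diff_gt_0_iff_gt diff_minus_eq_add)
  moreover have "Gamma (\<gamma> + 1) > 0" using assms by (simp add: Gamma_real_pos)
  ultimately have "Beta 1 (\<gamma> + 1) = 1 / (\<gamma> + 1)"
    by (simp add: Beta_def)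
  then show ?thesis using nn_integral_power_disc_weight[of "\<gamma> + 1" 0] assms by simp
qed

text \<open>At height \<open>y\<close> the disc ends at x = c, and 1 - |z|^2 factors as (c + x) (c -
  x). Near 1 the first factor lies between 1/2 and 2, so on the slice the weight is at most a
  multiple of (c - x)^\<gamma>.\<close>

lemma disc_weight_slice_le:
  fixes x y :: real
  assumes u: "0 < u" "u < 1 / 2" and z: "norm (Complex x y) < 1" "norm (1 - Complex x y) \<le> u"
  defines "c \<equiv> sqrt (1 - y\<^sup>2)"
  shows "\<bar>y\<bar> \<le> u" "0 < c - x" "c - x \<le> u"
    "(1 - (norm (Complex x y))\<^sup>2) powr \<gamma> \<le> max (2 powr \<gamma>) ((1/2) powr \<gamma>) * (c - x) powr \<gamma>"
proof -
  have "\<bar>Im (1 - Complex x y)\<bar> \<le> norm (1 - Complex x y)" by (rule abs_Im_le_cmod)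
  then show yu: "\<bar>y\<bar> \<le> u" using z by simp
  have "\<bar>Re (1 - Complex x y)\<bar> \<le> norm (1 - Complex x y)" by (rule abs_Re_le_cmod)
  then have x: "1 - x \<le> u" using z by simp
  have xy: "x\<^sup>2 + y\<^sup>2 < 1"
    using z by (simp add: cmod_def)
  have y1: "y\<^sup>2 \<le> 1" using xy by (smt (verit) zero_le_power2)
  have cc: "c\<^sup>2 = 1 - y\<^sup>2" using y1 by (simp add: c_def)
  have "c \<ge> 0" "c \<le> 1" using y1 by (auto simp: c_def)
  have "x\<^sup>2 < c\<^sup>2" using xy cc by simp
  then show cx: "0 < c - x" using \<open>c \<ge> 0\<close> power2_less_imp_less[of x c] by simp
  show "c - x \<le> u" using x \<open>c \<le> 1\<close> by simp
  have e: "1 - (norm (Complex x y))\<^sup>2 = (c + x) * (c - x)"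
    using cc by (simp add: cmod_def power2_eq_square algebra_simps)
  have b: "1/2 \<le> c + x" "c + x \<le> 2" using x u \<open>c \<ge> 0\<close> \<open>c \<le> 1\<close> cx by auto
  have "(c + x) powr \<gamma> \<le> max (2 powr \<gamma>) ((1/2) powr \<gamma>)"
  proof (cases "\<gamma> \<ge> 0")
    case True
    then have "(c + x) powr \<gamma> \<le> 2 powr \<gamma>" using b by (intro powr_mono2) auto
    then show ?thesis by simp
  next
    case False
    then have "(c + x) powr \<gamma> \<le> (1/2) powr \<gamma>" using b by (intro powr_mono2') auto
    then show ?thesis by simp
  qed
  then show "(1 - (norm (Complex x y))\<^sup>2) powr \<gamma> \<le> max (2 powr \<gamma>) ((1/2) powr \<gamma>) * (c - x) powr \<gamma>"
    unfolding e using b cx by (simp add: powr_mult mult_right_mono)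
qed

text \<open>For small u only the heights |y| \<le> u contribute, and each slice has weighted length
  of order at most u^(\<gamma> + 1). For u \<ge> 1/2 the total mass suffices.\<close>

lemma disc_weight_near_1:
  assumes g: "\<gamma> > -1"
  obtains C where "C > 0"
    "\<And>u. u > 0 \<Longrightarrow> (\<integral>\<^sup>+z. disc_weight \<gamma> z * indicator {z. norm (1 - z) \<le> u} z \<partial>lborel) \<le> ennreal (C * u powr (\<gamma> + 2))"
proof -
  define k :: real where "k = max (2 powr \<gamma>) ((1/2) powr \<gamma>) / pi"
  have k: "k \<ge> 0" by (simp add: k_def le_max_iff_disj)
  define C where "C = max (2 powr (\<gamma> + 2) / (\<gamma> + 1)) (2 * k / (\<gamma> + 1))"
  have C: "C > 0" using g by (simp add: C_def less_max_iff_disj)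
  show ?thesis
  proof (rule that[OF C])
    fix u :: real assume u: "u > 0"
    show "(\<integral>\<^sup>+z. disc_weight \<gamma> z * indicator {z. norm (1 - z) \<le> u} z \<partial>lborel) \<le> ennreal (C * u powr (\<gamma> + 2))"
    proof (cases "u < 1/2")
      case False
      have "(\<integral>\<^sup>+z. disc_weight \<gamma> z * indicator {z. norm (1 - z) \<le> u} z \<partial>lborel) \<le> (\<integral>\<^sup>+z. disc_weight \<gamma> z \<partial>lborel)"
        by (intro nn_integral_mono) (auto split: split_indicator)
      also have "\<dots> = ennreal (1 / (\<gamma> + 1))" by (rule nn_integral_disc_weight[OF g])
      also have "\<dots> \<le> ennreal (C * u powr (\<gamma> + 2))"
      proof (rule ennreal_leI)
        have "1 powr (\<gamma> + 2) \<le> (2 * u) powr (\<gamma> + 2)"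
          using False g by (intro powr_mono2) auto
        then have "1 / (\<gamma> + 1) \<le> (2 * u) powr (\<gamma> + 2) / (\<gamma> + 1)"
          using g by (intro divide_right_mono) auto
        also have "\<dots> = 2 powr (\<gamma> + 2) / (\<gamma> + 1) * u powr (\<gamma> + 2)"
          using u by (simp add: powr_mult)
        also have "\<dots> \<le> C * u powr (\<gamma> + 2)"
          by (intro mult_right_mono) (auto simp: C_def)
        finally show "1 / (\<gamma> + 1) \<le> C * u powr (\<gamma> + 2)" .
      qed
      finally show ?thesis .
    next
      case True
      have [measurable]: "(\<lambda>x. Complex x y) \<in> borel_measurable borel" for y
        by (auto simp: borel_measurable_complex_iff)
      have [measurable]: "{z::complex. norm (1 - z) \<le> u} \<in> sets borel" by measurable
      define F where "F z = disc_weight \<gamma> z * indicator {z. norm (1 - z) \<le> u} z" for z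
      have [measurable]: "F \<in> borel_measurable borel" unfolding F_def by measurable
      let ?h = "\<lambda>v. ennreal (v powr \<gamma>) * indicator {0..u} v" and ?c = "ennreal (k * u powr (\<gamma> + 1) / (\<gamma> + 1))"
      have inner: "(\<integral>\<^sup>+x. F (Complex x y) \<partial>lborel) \<le> ?c * indicator {-u..u} y" for y
      proof -
        define c where "c = sqrt (1 - y\<^sup>2)"
        have "(\<integral>\<^sup>+x. F (Complex x y) \<partial>lborel)
          \<le> (\<integral>\<^sup>+x. ennreal k * indicator {-u..u} y * ?h (c - x) \<partial>lborel)"
        proof (rule nn_integral_mono)
          fix x
          show "F (Complex x y) \<le> ennreal k * indicator {-u..u} y * ?h (c - x)"
          proof (cases "norm (Complex x y) < 1 \<and> norm (1 - Complex x y) \<le> u")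
            case T: True
            note sl = disc_weight_slice_le[OF u True conjunct1[OF T] conjunct2[OF T], folded c_def]
            have "(1 - (norm (Complex x y))\<^sup>2) powr \<gamma> / pi \<le> k * (c - x) powr \<gamma>"
              using sl(4) T unfolding k_def by (simp add: divide_right_mono)
            then have "F (Complex x y) \<le> ennreal (k * (c - x) powr \<gamma>)"
              using T by (simp add: F_def disc_weight_def ennreal_leI)
            then show ?thesis using sl(1-3) T k by (simp add: ennreal_mult' abs_le_iff)
          next
            case False
            then have "F (Complex x y) = 0" unfolding F_def disc_weight_def by (auto split: split_indicator)
            then show ?thesis by simp
          qed
        qed
        also have "\<dots> = ennreal k * indicator {-u..u} y * (\<integral>\<^sup>+x. ?h (c - x) \<partial>lborel)"
          by (rule nn_integral_cmult) measurable
        also have "(\<integral>\<^sup>+x. ?h (c - x) \<partial>lborel)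
           = (\<integral>\<^sup>+v. ?h v \<partial>lborel)"
          using nn_integral_real_affine[of ?h "-1" c] by simp
        also have "\<dots> = ennreal (u powr (\<gamma> + 1) / (\<gamma> + 1))"
          by (rule nn_integral_powr_Icc_0) (use u g in auto)
        also have "ennreal k * indicator {-u..u} y * ennreal (u powr (\<gamma> + 1) / (\<gamma> + 1))
           = ?c * indicator {-u..u} y"
          using k g by (simp add: ennreal_mult'[symmetric] mult_ac split: split_indicator)
        finally show ?thesis .
      qed
      have "(\<integral>\<^sup>+z. F z \<partial>lborel) = (\<integral>\<^sup>+y. \<integral>\<^sup>+x. F (Complex x y) \<partial>lborel \<partial>lborel)"
        by (rule nn_integral_complex_conv_prod) measurable
      also have "\<dots> \<le> (\<integral>\<^sup>+y. ?c * indicator {-u..u} y \<partial>lborel)"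
        by (intro nn_integral_mono inner)
      also have "\<dots> = ?c * ennreal (2 * u)"
        using u by (subst nn_integral_cmult_indicator) auto
      also have "\<dots> = ennreal (2 * k / (\<gamma> + 1) * u powr (\<gamma> + 2))"
      proof -
        have "u powr (\<gamma> + 1) * u = u powr (\<gamma> + 2)"
          using u powr_add[of u "\<gamma> + 1" 1] by (simp add: add.assoc)
        then show ?thesis using u g k by (simp add: ennreal_mult'[symmetric] field_simps)
      qed
      also have "\<dots> \<le> ennreal (C * u powr (\<gamma> + 2))"
        by (intro ennreal_leI mult_right_mono) (auto simp: C_def)
      finally show ?thesis by (simp add: F_def)
    qed
  qed
qed

text \<open>Radial integration makes the termwise Cauchy estimate lossless, so no factorisation of \<open>f\<close> is needed.\<close>

lemma bergman_coeff_sum_le: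
  assumes hol: "f holomorphic_on ball 0 1" and s: "s > 0"
  shows "(\<Sum>k. ennreal (norm (taylor_coeff f k) * Beta (real k + 1) s))
     \<le> 2 * (\<integral>\<^sup>+z. bergman_density 1 (s - 2) f z \<partial>lborel)"
proof -
  define D where "D = bergman_density 1 (s - 2) f"
  have [measurable]: "D \<in> borel_measurable borel"
    unfolding D_def by (rule borel_measurable_bergman_density[OF hol])
  let ?R = "\<lambda>z. \<integral>\<^sup>+x. D (cis (2 * pi * x) * z) * indicator {0..1} x \<partial>lborel" and ?w = "disc_weight (s - 1)"
    and ?a = "\<lambda>k. norm (taylor_coeff f k)"
  let ?T = "\<lambda>k z. ennreal (?a k) * (ennreal (norm z ^ (2 * k)) * ?w z)"
  have "(\<Sum>k. ennreal (?a k * Beta (real k + 1) s))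
     = (\<Sum>k. \<integral>\<^sup>+z. ?T k z \<partial>lborel)"
    by (subst nn_integral_cmult) (auto simp: nn_integral_power_disc_weight[OF s] ennreal_mult')
  also have "\<dots> = (\<integral>\<^sup>+z. (\<Sum>k. ?T k z) \<partial>lborel)"
    by (rule nn_integral_suminf[symmetric]) measurable
  also have "\<dots> \<le> (\<integral>\<^sup>+z. 2 * ?R z \<partial>lborel)"
  proof (rule nn_integral_mono)
    fix z :: complex
    show "(\<Sum>k. ?T k z)
       \<le> 2 * ?R z"
    proof (cases "norm z < 1")
      case True
      define A where "A = (\<integral>\<^sup>+x. ennreal (norm (f (cis (2 * pi * x) * z))) * indicator {0..1} x \<partial>lborel)"
      have z2: "1 - (norm z)\<^sup>2 = (1 - norm z) * (1 + norm z)" by (simp add: power2_eq_square algebra_simps)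
      then have z3: "0 < 1 - (norm z)\<^sup>2" using True by (simp add: add_pos_nonneg)
      \<comment> \<open>Of |z|^(2k), one factor |z|^k is spent on the Cauchy estimate and the other
        on a geometric series. Its sum 1 / (1 - |z|) lowers the weight exponent from s - 1 to s - 2
        at the price of 1 + |z| \<le> 2.\<close>
      have "(\<Sum>k. ?T k z)
        \<le> (\<Sum>k. ennreal (norm z ^ k) * (A * ?w z))"
      proof (rule suminf_le)
        fix k
        have "ennreal (?a k * norm z ^ k) \<le> A"
          using taylor_coeff_le_circle_mean[OF hol True, of k] by (simp add: A_def taylor_coeff_def)
        then have "ennreal (norm z ^ k) * (ennreal (?a k * norm z ^ k) * ?w z)
            \<le> ennreal (norm z ^ k) * (A * ?w z)"
          by (intro mult_left_mono mult_right_mono) auto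
        then show "?T k z
          \<le> ennreal (norm z ^ k) * (A * ?w z)"
          by (simp add: ennreal_mult' power_mult power2_eq_square power_mult_distrib mult_ac)
      qed auto
      also have "\<dots> = (\<Sum>k. ennreal (norm z ^ k)) * (A * ?w z)"
        by simp
      also have "(\<Sum>k. ennreal (norm z ^ k)) = ennreal (1 / (1 - norm z))"
        using True by (subst suminf_ennreal2) (auto simp: suminf_geometric)
      also have "ennreal (1 / (1 - norm z)) * (A * ?w z) \<le> 2 * (A * disc_weight (s - 2) z)"
      proof -
        have "(1 - (norm z)\<^sup>2) powr (s - 1) = (1 - (norm z)\<^sup>2) powr (s - 2) * ((1 - norm z) * (1 + norm z))"
          using z3 z2 powr_add[of "1 - (norm z)\<^sup>2" "s - 2" 1] by simp
        then have "1 / (1 - norm z) * ((1 - (norm z)\<^sup>2) powr (s - 1) / pi) = (1 - (norm z)\<^sup>2) powr (s - 2) / pi * (1 + norm z)"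
          using True by simp
        also have "\<dots> \<le> (1 - (norm z)\<^sup>2) powr (s - 2) / pi * 2"
          using True by (intro mult_left_mono) auto
        also have "\<dots> = 2 * ((1 - (norm z)\<^sup>2) powr (s - 2) / pi)" by simp
        finally have "ennreal (1 / (1 - norm z) * ((1 - (norm z)\<^sup>2) powr (s - 1) / pi)) \<le> ennreal (2 * ((1 - (norm z)\<^sup>2) powr (s - 2) / pi))"
          by (rule ennreal_leI)
        also have "\<dots> = 2 * ennreal ((1 - (norm z)\<^sup>2) powr (s - 2) / pi)"
          by (subst ennreal_mult) auto
        finally have "ennreal (1 / (1 - norm z)) * ?w z \<le> 2 * disc_weight (s - 2) z"
          using True by (simp add: disc_weight_def ennreal_mult'[symmetric])
        then have "A * (ennreal (1 / (1 - norm z)) * ?w z) \<le> A * (2 * disc_weight (s - 2) z)"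
          by (rule mult_left_mono) simp
        then show ?thesis by (simp add: mult_ac)
      qed
      also have "A * disc_weight (s - 2) z = ?R z"
      proof -
        have [measurable]: "(\<lambda>x. cis (2 * pi * x) * z) \<in> borel_measurable borel"
          by (intro borel_measurable_continuous_onI continuous_intros)
        have "(\<lambda>z. ennreal (norm (f z)) * indicator (ball 0 1) z) \<in> borel_measurable borel"
          using borel_measurable_indicator_times_norm_powr[of "ball 0 1" f 1] holomorphic_on_imp_continuous_on[OF hol] by simp
        then have "(\<lambda>x. ennreal (norm (f (cis (2 * pi * x) * z))) * indicator (ball 0 1) (cis (2 * pi * x) * z)) \<in> borel_measurable borel"
          by (rule measurable_compose[rotated]) measurable
        then have [measurable]: "(\<lambda>x. ennreal (norm (f (cis (2 * pi * x) * z)))) \<in> borel_measurable borel"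
          using True by (simp add: norm_mult)
        have "A * disc_weight (s - 2) z = (\<integral>\<^sup>+x. ennreal (norm (f (cis (2 * pi * x) * z))) * indicator {0..1} x * disc_weight (s - 2) z \<partial>lborel)"
          unfolding A_def by (rule nn_integral_multc[symmetric]) measurable
        also have "\<dots> = ?R z"
          unfolding D_def bergman_density_def
          by (intro nn_integral_cong) (auto simp: disc_weight_def norm_mult split: split_indicator)
        finally show ?thesis .
      qed
      finally show ?thesis .
    qed (simp add: disc_weight_def)
  qed
  also have "\<dots> = 2 * (\<integral>\<^sup>+z. ?R z \<partial>lborel)"
  proof (rule nn_integral_cmult)
    have [measurable]: "(\<lambda>x. cis (2 * pi * x)) \<in> borel_measurable borel"
      by (intro borel_measurable_continuous_onI continuous_intros)
    show "(\<lambda>z. \<integral>\<^sup>+x. D (cis (2 * pi * x) * z) * indicator {0..1} x \<partial>lborel) \<in> borel_measurable lborel"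
      by measurable
  qed
  also have "\<dots> = 2 * (\<integral>\<^sup>+z. D z \<partial>lborel)"
    by (subst nn_integral_rotation_average) auto
  finally show ?thesis by (simp add: D_def)
qed

subsection \<open>The integral representation of the operator\<close>

text \<open>The Taylor coefficients of (1 - w)^(-\<beta>), see
  \<open>binomial_kernel_sums\<close>.\<close>

abbreviation binomial_coeff :: "real \<Rightarrow> nat \<Rightarrow> real" where
  "binomial_coeff \<beta> n \<equiv> Gamma (real n + \<beta>) / (fact n * Gamma \<beta>)"

text \<open>Finiteness holds in the situation of the theorem because a Carleson bound at t = 0
  controls the whole mass; see \<open>W_cond_finite\<close>.\<close>

locale radial_measure = finite_measure \<mu> for \<mu> :: "real measure" +
  assumes sets_mu [measurable_cong]: "sets \<mu> = sets borel"
    and concentrated: "emeasure \<mu> (- {0..<1}) = 0"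
begin

lemma space_mu [simp]: "space \<mu> = UNIV"
  using sets_eq_imp_space_eq[OF sets_mu] by simp

lemma AE_unit_interval: "AE t in \<mu>. t \<in> {0..<1}"
  using concentrated by (intro AE_I'[of "- {0..<1}"]) (auto simp: null_sets_def sets_mu)

definition moment :: "nat \<Rightarrow> real" where
  "moment k = (LINT t:{0..<1}|\<mu>. t ^ k)"

lemma integrable_moment [simp]: "integrable \<mu> (\<lambda>t. indicator {0..<1} t * t ^ k)"
  by (rule integrable_const_bound[where B = 1])
     (auto intro!: AE_I2 simp: power_le_one split: split_indicator)

lemma moment_eq: "moment k = (\<integral>t. indicator {0..<1} t * t ^ k \<partial>\<mu>)"
  by (simp add: moment_def set_lebesgue_integral_def)

lemma moment_nonneg: "moment k \<ge> 0"
  unfolding moment_eq by (intro integral_nonneg_AE) (auto split: split_indicator)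

lemma moment_add_le: "moment (n + k) \<le> moment k"
  unfolding moment_eq
  by (intro integral_mono integrable_moment)
     (auto simp: power_add mult_left_le_one_le power_le_one split: split_indicator)

lemma ennreal_moment: "ennreal (moment k) = (\<integral>\<^sup>+t. ennreal (indicator {0..<1} t * t ^ k) \<partial>\<mu>)"
  unfolding moment_eq
  by (rule nn_integral_eq_integral[symmetric]) (auto split: split_indicator)

lemma hmu_eq: "hmu \<mu> \<beta> n k = binomial_coeff \<beta> n * moment (n + k)"
  by (simp add: hmu_def moment_def)

end

text \<open>The binomial series with exponent -\<beta>: the signs of (-\<beta> choose n) and of
  (-w)^n cancel, leaving pochhammer over factorial.\<close>

lemma binomial_kernel_sums:
  fixes \<beta> :: real and w :: complex
  assumes b: "\<beta> > 0" and w: "norm w < 1"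
  shows "(\<lambda>n. of_real (binomial_coeff \<beta> n) * w ^ n) sums ((1 - w) powr (- of_real \<beta>))"
proof -
  have "((- of_real \<beta>) gchoose n) * (- w) ^ n = of_real (binomial_coeff \<beta> n) * w ^ n" for n
  proof -
    have "\<beta> \<notin> \<int>\<^sub>\<le>\<^sub>0" using b nonpos_Ints_nonpos by force
    then have "pochhammer \<beta> n = Gamma (real n + \<beta>) / Gamma \<beta>"
      by (simp add: pochhammer_Gamma add.commute)
    then have p: "pochhammer (complex_of_real \<beta>) n = complex_of_real (Gamma (real n + \<beta>) / Gamma \<beta>)"
      by (metis pochhammer_of_real)
    have "(- 1) ^ n * (- w) ^ n = w ^ n"
      by (simp add: power_mult_distrib[symmetric])
    then show ?thesis
      by (simp add: gbinomial_pochhammer p) (simp add: mult_ac)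
  qed
  then show ?thesis
    using gen_binomial_complex[of "- w" "- complex_of_real \<beta>"] w by simp
qed

lemma binomial_kernel_summable:
  fixes \<beta> r :: real
  assumes b: "\<beta> > 0" and r: "0 \<le> r" "r < 1"
  shows "summable (\<lambda>n. binomial_coeff \<beta> n * r ^ n)"
proof -
  have "summable (\<lambda>n. of_real (binomial_coeff \<beta> n) * complex_of_real r ^ n)"
    using binomial_kernel_sums[OF b, of "of_real r"] r sums_summable by auto
  then have "summable (\<lambda>n. complex_of_real (binomial_coeff \<beta> n * r ^ n))"
    by simp
  then show ?thesis by (simp only: summable_complex_of_real)
qed

lemma taylor_coeff_sums:
  assumes "f holomorphic_on ball 0 R" "norm z < R"
  shows "(\<lambda>k. taylor_coeff f k * z ^ k) sums f z"
  using holomorphic_power_series[of f 0 R z] assms by (simp add: taylor_coeff_def)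

lemma taylor_coeff_abs_summable:
  assumes hol: "f holomorphic_on ball 0 R" and z: "norm z < R"
  shows "summable (\<lambda>k. norm (taylor_coeff f k * z ^ k))"
proof -
  obtain r where r: "norm z < r" "r < R" using z dense by blast
  have r0: "r > 0" using r norm_ge_zero[of z] by linarith
  show ?thesis
    by (rule powser_insidea[OF sums_summable[OF taylor_coeff_sums[OF hol, of "of_real r"]]])
       (use r r0 in auto)
qed

context radial_measure
begin

lemma borel_measurable_on_radius [measurable]:
  assumes "f holomorphic_on ball 0 1"
  shows "(\<lambda>t. indicator {0..<1} t *\<^sub>R f (of_real t)) \<in> borel_measurable borel"
  by (intro borel_measurable_continuous_on_indicator continuous_on_compose2[OF holomorphic_on_imp_continuous_on[OF assms]])
     (auto intro!: continuous_intros)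

abbreviation weighted_moment :: "(complex \<Rightarrow> complex) \<Rightarrow> nat \<Rightarrow> complex" where
  "weighted_moment f n \<equiv> (\<integral>t. indicator {0..<1} t *\<^sub>R (f (of_real t) * of_real t ^ n) \<partial>\<mu>)"

abbreviation H_kernel :: "(complex \<Rightarrow> complex) \<Rightarrow> real \<Rightarrow> complex \<Rightarrow> real \<Rightarrow> complex" where
  "H_kernel f \<beta> z t \<equiv> indicator {0..<1} t *\<^sub>R (f (of_real t) * (1 - of_real t * z) powr (- of_real \<beta>))"

context
  fixes f :: "complex \<Rightarrow> complex" and \<beta> :: real
  assumes hol: "f holomorphic_on ball 0 1"
    and summ: "summable (\<lambda>k. norm (taylor_coeff f k) * moment k)"
    and beta: "\<beta> > 0"
begin

text \<open>\<open>summ\<close> says that the L^1 norms of the terms a_k t^k are summable, which is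
  what exchanging sum and integral requires. Multiplying by t^n only decreases these norms.\<close>

lemma radial_moments_sums:
  shows "integrable \<mu> (\<lambda>t. indicator {0..<1} t *\<^sub>R (f (of_real t) * of_real t ^ n))"
    and "(\<lambda>k. taylor_coeff f k * moment (n + k)) sums weighted_moment f n"
    and "summable (\<lambda>k. norm (taylor_coeff f k * moment (n + k)))"
proof -
  let ?f = "\<lambda>t. indicator {0..<1} t *\<^sub>R (f (of_real t) * of_real t ^ n)"
  define u where "u k t = taylor_coeff f k * complex_of_real (indicator {0..<1} t * t ^ (n + k))" for k t
  have int_u: "integrable \<mu> (u k)" for k
    unfolding u_def by (intro integrable_mult_right integrable_of_real integrable_moment)
  have val_u: "(\<integral>t. u k t \<partial>\<mu>) = taylor_coeff f k * moment (n + k)" for k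
    unfolding u_def moment_eq
    by (subst integral_mult_right_zero, subst integral_complex_of_real) simp
  have norm_u: "norm (u k t) = norm (taylor_coeff f k) * (indicator {0..<1} t * t ^ (n + k))" for k t
    by (auto simp: u_def norm_mult norm_power split: split_indicator)
  have int_norm_u: "(\<integral>t. norm (u k t) \<partial>\<mu>) = norm (taylor_coeff f k) * moment (n + k)" for k
    unfolding norm_u moment_eq by simp
  have s1: "summable (\<lambda>k. norm (taylor_coeff f k) * moment (n + k))"
    by (rule summable_comparison_test'[OF summ, of 0])
       (auto intro!: mult_left_mono moment_add_le simp: moment_nonneg abs_mult)
  have pt: "(\<lambda>k. u k t) sums ?f t" for t
  proof (cases "t \<in> {0..<1}")
    case True
    then have "(\<lambda>k. taylor_coeff f k * of_real t ^ k) sums f t"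
      by (intro taylor_coeff_sums[OF hol]) auto
    from sums_mult2[OF this, of "of_real t ^ n"] show ?thesis
      using True by (simp add: u_def power_add mult_ac)
  qed (simp add: u_def)
  have pt_abs: "summable (\<lambda>k. norm (u k t))" for t
  proof (cases "t \<in> {0..<1}")
    case True
    then have "summable (\<lambda>k. norm (taylor_coeff f k * of_real t ^ k))"
      by (intro taylor_coeff_abs_summable[OF hol]) auto
    then have "summable (\<lambda>k. norm (taylor_coeff f k * of_real t ^ k) * t ^ n)"
      by (rule summable_mult2)
    moreover have "norm (u k t) = norm (taylor_coeff f k * of_real t ^ k) * t ^ n" for k
      using True by (simp add: norm_u power_add norm_mult norm_power)
    ultimately show ?thesis by simp
  qed (simp add: u_def)
  have eq: "(\<lambda>t. \<Sum>k. u k t) = (\<lambda>t. ?f t)"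
    using pt by (auto simp: sums_iff)
  show "integrable \<mu> (\<lambda>t. ?f t)"
    unfolding eq[symmetric]
    by (rule integrable_suminf) (use int_u pt_abs s1 int_norm_u in auto)
  show "(\<lambda>k. taylor_coeff f k * moment (n + k)) sums (\<integral>t. ?f t \<partial>\<mu>)"
    unfolding eq[symmetric] val_u[symmetric]
    by (rule sums_integral) (use int_u pt_abs s1 int_norm_u in auto)
  show "summable (\<lambda>k. norm (taylor_coeff f k * moment (n + k)))"
    using s1 by (simp add: norm_mult moment_nonneg)
qed

lemma H_coef_eq_integral:
  "H_coef \<mu> \<beta> f n = of_real (binomial_coeff \<beta> n) *
     weighted_moment f n"
  and H_coef_summable: "summable (\<lambda>k. of_real (hmu \<mu> \<beta> n k) * taylor_coeff f k)"
proof -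
  have "(\<lambda>k. of_real (hmu \<mu> \<beta> n k) * taylor_coeff f k) sums
      (of_real (binomial_coeff \<beta> n) * weighted_moment f n)"
    using sums_mult[OF radial_moments_sums(2)[of n], of "of_real (binomial_coeff \<beta> n)"]
    by (simp add: hmu_eq mult_ac)
  then show "H_coef \<mu> \<beta> f n = of_real (binomial_coeff \<beta> n) *
     weighted_moment f n"
    "summable (\<lambda>k. of_real (hmu \<mu> \<beta> n k) * taylor_coeff f k)"
    by (auto simp: H_coef_def sums_iff)
qed

text \<open>A second exchange, now over \<open>n\<close>: f is integrable along the radius, t^n
  \<le> 1, and the binomial series converges absolutely at |z|.\<close>

lemma H_op_sums:
  assumes z: "norm z < 1"
  shows "(\<lambda>n. H_coef \<mu> \<beta> f n * z ^ n) sums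
     (\<integral>t. H_kernel f \<beta> z t \<partial>\<mu>)"
    and "integrable \<mu> (H_kernel f \<beta> z)"
proof -
  let ?f = "\<lambda>t. indicator {0..<1} t *\<^sub>R f (of_real t)"
  define c where "c n = binomial_coeff \<beta> n" for n :: nat
  have c0: "c n \<ge> 0" for n
    using beta by (simp add: c_def Gamma_real_nonneg)
  define u where "u n t = (indicator {0..<1} t *\<^sub>R (f (of_real t) * of_real t ^ n)) * (complex_of_real (c n) * z ^ n)" for n t
  have int_u: "integrable \<mu> (u n)" for n
    unfolding u_def by (rule integrable_mult_left[OF radial_moments_sums(1)])
  have val_u: "(\<integral>t. u n t \<partial>\<mu>) = H_coef \<mu> \<beta> f n * z ^ n" for n
    unfolding u_def H_coef_eq_integral c_def
    by (subst integral_mult_left_zero) (simp only: mult_ac)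
  define J where "J = (\<integral>t. norm (indicator {0..<1} t *\<^sub>R (f (of_real t))) \<partial>\<mu>)"
  have intf: "integrable \<mu> (\<lambda>t. ?f t)"
    using radial_moments_sums(1)[of 0] by simp
  have norm_u: "norm (u n t) \<le> norm (?f t) * (c n * norm z ^ n)" for n t
  proof (cases "t \<in> {0..<1}")
    case True
    then have "norm (u n t) = norm (f (of_real t)) * (c n * norm z ^ n) * t ^ n"
      using c0 by (simp add: u_def norm_mult norm_power)
    also have "\<dots> \<le> norm (f (of_real t)) * (c n * norm z ^ n)"
      using True c0 by (intro mult_right_le_one_le) (auto simp: power_le_one)
    finally show ?thesis using True by simp
  qed (simp add: u_def)
  have cs: "summable (\<lambda>n. c n * norm z ^ n)"
    unfolding c_def by (rule binomial_kernel_summable) (use beta z in auto)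
  have s1: "summable (\<lambda>n. \<integral>t. norm (u n t) \<partial>\<mu>)"
  proof (rule summable_comparison_test'[OF summable_mult[OF cs, of J], of 0])
    fix n
    have "(\<integral>t. norm (u n t) \<partial>\<mu>) \<le> (\<integral>t. norm (?f t) * (c n * norm z ^ n) \<partial>\<mu>)"
      by (intro integral_mono norm_u integrable_norm int_u integrable_mult_left intf)
    also have "\<dots> = J * (c n * norm z ^ n)" by (simp add: J_def)
    finally show "norm (\<integral>t. norm (u n t) \<partial>\<mu>) \<le> J * (c n * norm z ^ n)" by simp
  qed
  have pt: "(\<lambda>n. u n t) sums (H_kernel f \<beta> z t)" for t
  proof (cases "t \<in> {0..<1}")
    case True
    have "norm (of_real t * z) \<le> 1 * norm z"
      using True unfolding norm_mult by (intro mult_right_mono) auto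
    then have "norm (of_real t * z) < 1" using z by simp
    from sums_mult[OF binomial_kernel_sums[OF beta this], of "f t"] show ?thesis
      using True by (simp add: u_def c_def mult_ac power_mult_distrib)
  qed (simp add: u_def)
  have pt_abs: "summable (\<lambda>n. norm (u n t))" for t
    by (rule summable_comparison_test'[OF summable_mult[OF cs, of "norm (?f t)"], of 0])
       (use norm_u in auto)
  have eq: "(\<lambda>t. \<Sum>n. u n t) = (\<lambda>t. H_kernel f \<beta> z t)"
    using pt by (auto simp: sums_iff)
  show "integrable \<mu> (\<lambda>t. H_kernel f \<beta> z t)"
    unfolding eq[symmetric]
    by (rule integrable_suminf) (use int_u pt_abs s1 in auto)
  show "(\<lambda>n. H_coef \<mu> \<beta> f n * z ^ n) sums
     (\<integral>t. H_kernel f \<beta> z t \<partial>\<mu>)"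
    unfolding eq[symmetric] val_u[symmetric]
    by (rule sums_integral) (use int_u pt_abs s1 in auto)
qed

lemma H_defined: "H_defined \<mu> \<beta> f"
  unfolding H_defined_def using H_coef_summable H_op_sums(1) by (auto simp: sums_iff)

lemma H_op_eq_integral:
  "norm z < 1 \<Longrightarrow> H_op \<mu> \<beta> f z = (\<integral>t. H_kernel f \<beta> z t \<partial>\<mu>)"
  using H_op_sums(1) by (simp add: H_op_def sums_iff)

lemma norm_H_op_le:
  assumes z: "norm z < 1"
  shows "ennreal (norm (H_op \<mu> \<beta> f z)) \<le> (\<integral>\<^sup>+t. ennreal (indicator {0..<1} t * (norm (f (of_real t)) * norm (1 - of_real t * z) powr - \<beta>)) \<partial>\<mu>)"
proof -
  have "ennreal (norm (H_op \<mu> \<beta> f z)) \<le> (\<integral>\<^sup>+t. ennreal (norm (H_kernel f \<beta> z t)) \<partial>\<mu>)"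
    unfolding H_op_eq_integral[OF z] by (rule integral_norm_bound_ennreal[OF H_op_sums(2)[OF z]])
  also have "\<dots> = (\<integral>\<^sup>+t. ennreal (indicator {0..<1} t * (norm (f (of_real t)) * norm (1 - of_real t * z) powr - \<beta>)) \<partial>\<mu>)"
    by (intro nn_integral_cong) (auto simp: norm_mult norm_powr_real_powr' split: split_indicator)
  finally show ?thesis .
qed

lemma H_op_holomorphic: "H_op \<mu> \<beta> f holomorphic_on ball 0 1"
proof -
  have "H_op \<mu> \<beta> f holomorphic_on ball 0 1 \<longleftrightarrow> True"
    using power_series_holomorphic[of 0 1 "H_coef \<mu> \<beta> f" "H_op \<mu> \<beta> f"] H_op_sums(1) H_op_eq_integral
    by auto
  then show ?thesis by simp
qed

text \<open>Uniqueness of power series expansions. It lets the coefficient inequality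
  \<open>bergman_coeff_sum_le\<close> act on the image of the operator.\<close>

lemma taylor_coeff_H_op: "taylor_coeff (H_op \<mu> \<beta> f) n = H_coef \<mu> \<beta> f n"
proof -
  have s: "(\<lambda>n. H_coef \<mu> \<beta> f n * w ^ n) sums H_op \<mu> \<beta> f w" if "norm w < 1" for w
    using H_op_sums(1)[OF that] H_op_eq_integral[OF that] by simp
  define F where "F = Abs_fps (H_coef \<mu> \<beta> f)"
  have "conv_radius (H_coef \<mu> \<beta> f) \<ge> norm (1/2 :: complex)"
    by (rule conv_radius_geI) (use s[of "1/2"] sums_summable in auto)
  then have "fps_conv_radius F \<ge> ereal (1/2)"
    by (simp add: F_def fps_conv_radius_def fps_nth_Abs_fps[abs_def])
  then have "fps_conv_radius F > 0"
    by (rule less_le_trans[rotated]) simp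
  moreover have "\<forall>\<^sub>F z in nhds 0. eval_fps F z = H_op \<mu> \<beta> f z"
    using s by (intro eventually_nhds_in_open[of "ball 0 1" 0, THEN eventually_mono])
      (auto simp: F_def eval_fps_def sums_iff)
  ultimately have "H_op \<mu> \<beta> f has_fps_expansion F"
    by (simp add: has_fps_expansion_def)
  from fps_nth_fps_expansion[OF this, of n] show ?thesis
    by (simp add: F_def taylor_coeff_def)
qed

end

end

subsection \<open>Distances to the point 1\<close>

text \<open>Totalised distance to the point 1, so that bounds hold everywhere and not just almost everywhere.\<close>

definition gap :: "real \<Rightarrow> real" where
  "gap t = (if 0 \<le> t \<and> t < 1 then 1 - t else 1)"

definition disc_gap :: "complex \<Rightarrow> real" where
  "disc_gap z = (if norm z < 1 then norm (1 - z) else 1)"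

lemma gap_bounds: "0 < gap t" "gap t \<le> 1"
  by (auto simp: gap_def)

lemma borel_measurable_gap [measurable]: "gap \<in> borel_measurable borel"
  unfolding gap_def[abs_def] by measurable

lemma disc_gap_bounds: "0 < disc_gap z" "disc_gap z \<le> 2"
proof -
  show "0 < disc_gap z" by (auto simp: disc_gap_def)
  have "norm (1 - z) \<le> 1 + norm z" using norm_triangle_ineq4[of 1 z] by simp
  then show "disc_gap z \<le> 2" by (auto simp: disc_gap_def)
qed

lemma borel_measurable_disc_gap [measurable]: "disc_gap \<in> borel_measurable borel"
  unfolding disc_gap_def[abs_def] by measurable

text \<open>From 1 - t \<le> |1 - t z| and 1 - z = (1 - t z) - (1 - t) z one gets |1 - z| \<le> 2 |1
  - t z|, whence the factor 1/2.\<close>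

lemma norm_one_minus_mult_ge:
  assumes t: "0 \<le> t" "t < 1" and z: "norm z < 1"
  shows "max (gap t) (disc_gap z) / 2 \<le> norm (1 - of_real t * z)" "0 < norm (1 - of_real t * z)"
proof -
  have tz: "norm (of_real t * z) \<le> t" using t z by (simp add: norm_mult mult_left_le)
  have "1 - norm (of_real t * z) \<le> norm (1 - of_real t * z)"
    using norm_triangle_ineq2[of 1 "of_real t * z"] by simp
  then have 1: "1 - t \<le> norm (1 - of_real t * z)" using tz by simp
  have "1 - z = (1 - of_real t * z) - of_real (1 - t) * z" by (simp add: algebra_simps)
  then have "norm (1 - z) \<le> norm (1 - of_real t * z) + norm (of_real (1 - t) * z)"
    by (metis norm_triangle_ineq4)
  also have "norm (of_real (1 - t) * z) \<le> 1 - t"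
    using t z by (simp only: norm_mult norm_of_real) (simp add: mult_left_le)
  finally show "max (gap t) (disc_gap z) / 2 \<le> norm (1 - of_real t * z)"
    using 1 t z by (auto simp: gap_def disc_gap_def max_def)
  show "0 < norm (1 - of_real t * z)" using 1 t by linarith
qed

lemma norm_one_minus_mult_powr_le:
  assumes "0 \<le> t" "t < 1" "norm z < 1" "b \<ge> 0"
  shows "norm (1 - of_real t * z) powr - b \<le> 2 powr b * max (gap t) (disc_gap z) powr - b"
proof -
  have "norm (1 - of_real t * z) powr - b \<le> (max (gap t) (disc_gap z) / 2) powr - b"
    using norm_one_minus_mult_ge[OF assms(1-3)] assms gap_bounds(1)[of t]
    by (intro powr_mono2') (auto simp: less_max_iff_disj)
  also have "\<dots> = 2 powr b * max (gap t) (disc_gap z) powr - b"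
    using gap_bounds(1)[of t] by (simp add: powr_divide powr_minus field_simps)
  finally show ?thesis .
qed

lemma carleson_mono:
  assumes "carleson \<mu> s" "s' \<le> s"
  shows "carleson \<mu> s'"
proof -
  obtain C where C: "\<forall>t\<in>{0..<1}. emeasure \<mu> {t..<1} \<le> ennreal (C * (1 - t) powr s)"
    using assms unfolding carleson_def by blast
  \<comment> \<open>\<open>C\<close> may be negative, and then enlarging the power of 1 - t would
    reverse the inequality.\<close>
  have "emeasure \<mu> {t..<1} \<le> ennreal (max C 0 * (1 - t) powr s')" if t: "t \<in> {0..<1}" for t
  proof -
    have "C * (1 - t) powr s \<le> max C 0 * (1 - t) powr s" by (intro mult_right_mono) auto
    also have "\<dots> \<le> max C 0 * (1 - t) powr s'"
      using t assms by (intro mult_left_mono powr_mono') auto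
    finally show ?thesis using C t by (meson ennreal_leI order_trans)
  qed
  then show ?thesis unfolding carleson_def by blast
qed

context radial_measure
begin

text \<open>For v < 1 the sublevel set lies in the tail from 1 - v; for larger v the tail from 0,
  that is the total mass, is used, and v^s \<ge> 1 there because s \<ge> 0.\<close>

lemma carleson_gap:
  assumes "carleson \<mu> s" and s: "s \<ge> 0"
  obtains C where "C > 0" "sublevel_growth \<mu> gap C s"
proof -
  obtain C0 where C0: "\<forall>t\<in>{0..<1}. emeasure \<mu> {t..<1} \<le> ennreal (C0 * (1 - t) powr s)"
    using assms unfolding carleson_def by blast
  define C where "C = max C0 1"
  have C: "emeasure \<mu> {t..<1} \<le> ennreal (C * (1 - t) powr s)" if "t \<in> {0..<1}" for t
  proof -
    have "C0 * (1 - t) powr s \<le> C * (1 - t) powr s" by (intro mult_right_mono) (auto simp: C_def)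
    then show ?thesis using C0 that by (meson ennreal_leI order_trans)
  qed
  show ?thesis
  proof (rule that[of C]; (intro allI impI)?)
    fix v :: real assume v: "v > 0"
    show "emeasure \<mu> (sublevel \<mu> gap v) \<le> ennreal (C * v powr s)"
    proof (cases "v < 1")
      case True
      then have "sublevel \<mu> gap v \<subseteq> {1 - v..<1}"
        by (auto simp: gap_def split: if_splits)
      then have "emeasure \<mu> (sublevel \<mu> gap v) \<le> emeasure \<mu> {1 - v..<1}"
        by (intro emeasure_mono) (auto simp: sets_mu)
      also have "\<dots> \<le> ennreal (C * v powr s)" using C[of "1 - v"] v True by simp
      finally show ?thesis .
    next
      case False
      have "AE t in \<mu>. (t \<in> sublevel \<mu> gap v) = (t \<in> {0..<1})"
        using AE_unit_interval by eventually_elim (use False in \<open>auto simp: gap_def\<close>)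
      then have "emeasure \<mu> (sublevel \<mu> gap v) = emeasure \<mu> {0..<1}"
        by (intro emeasure_eq_AE) (auto simp: sets_mu)
      also have "\<dots> \<le> ennreal (C * 1)" using C[of 0] by simp
      also have "\<dots> \<le> ennreal (C * v powr s)"
        using False s by (intro ennreal_leI mult_left_mono) (auto simp: C_def ge_one_powr_ge_zero)
      finally show ?thesis .
    qed
  qed (simp add: C_def)
qed

text \<open>t^k is the tail integral of k (1 - v)^(k - 1) from \<open>gap t\<close> to 1, and the
  layer cake formula turns the bound v^s into a Beta integral. The form
  \<open>Beta (real k + 1) s\<close> matches the weights in
  \<open>bergman_coeff_sum_le\<close>.\<close>

lemma moment_le_Beta:
  assumes N: "sublevel_growth \<mu> gap C s"
    and s: "s > 0" and C: "C \<ge> 0" and k: "k > 0"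
  shows "moment k \<le> C * s * Beta (real k + 1) s"
proof -
  obtain n where Suc: "k = Suc n" using k by (cases k) auto
  have n: "n = k - Suc 0" using Suc by simp
  define \<phi> where "\<phi> v = ennreal (real k * (1 - v) ^ n) * indicator {0..1} v" for v
  have [measurable]: "\<phi> \<in> borel_measurable borel" unfolding \<phi>_def by measurable
  have pt: "ennreal (indicator {0..<1} t * t ^ k) \<le> tail_integral \<phi> (gap t)" for t
  proof (cases "t \<in> {0..<1}")
    case True
    have "((\<lambda>v. real k * (1 - v) ^ n) has_integral (- ((1 - 1) ^ k) - (- ((1 - (1 - t)) ^ k)))) {1 - t..1}"
      by (rule fundamental_theorem_of_calculus)
         (use True n in \<open>auto intro!: derivative_eq_intros simp: has_real_derivative_iff_has_vector_derivative[symmetric]\<close>)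
    then have "((\<lambda>v. real k * (1 - v) ^ n) has_integral t ^ k) {1 - t..1}" using Suc by simp
    from nn_integral_has_integral_lebesgue'[OF _ this]
    have "ennreal (t ^ k) = (\<integral>\<^sup>+v. ennreal (real k * (1 - v) ^ n) * indicator {1 - t..1} v \<partial>lborel)"
      by simp
    also have "\<dots> = tail_integral \<phi> (gap t)"
      using True by (intro nn_integral_cong) (auto simp: \<phi>_def gap_def split: split_indicator)
    finally show ?thesis using True by simp
  qed simp
  let ?b = "\<lambda>v. ennreal (v powr ((s + 1) - 1) * (1 - v) powr (real k - 1)) * indicator {0..1} v" and ?c = "ennreal (real k * C)"
    and ?E = "\<lambda>v. \<phi> v * emeasure \<mu> (sublevel \<mu> gap v)"
  have "ennreal (moment k) \<le> (\<integral>\<^sup>+t. tail_integral \<phi> (gap t) \<partial>\<mu>)"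
    unfolding ennreal_moment by (intro nn_integral_mono pt)
  also have "\<dots> = (\<integral>\<^sup>+v. ?E v \<partial>lborel)"
    by (rule nn_integral_layer_cake) (auto intro: finite_measure_axioms)
  also have "\<dots> \<le> (\<integral>\<^sup>+v. ?c * ?b v \<partial>lborel)"
  proof (rule nn_integral_mono_AE, rule AE_mp)
    show "AE v in lborel. v \<noteq> 0 \<and> v \<noteq> (1::real)"
      using AE_lborel_singleton[of "0::real"] AE_lborel_singleton[of "1::real"] by eventually_elim auto
    show "AE v in lborel. v \<noteq> 0 \<and> v \<noteq> (1::real) \<longrightarrow> ?E v
       \<le> ?c * ?b v"
    proof (intro AE_I2 impI)
      fix v :: real assume v: "v \<noteq> 0 \<and> v \<noteq> 1"
      show "?E v
        \<le> ?c * ?b v"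
      proof (cases "0 < v \<and> v < 1")
        case True
        have "?E v \<le> ennreal (real k * (1 - v) ^ n) * ennreal (C * v powr s)"
          using True unfolding \<phi>_def by (intro mult_mono N[rule_format]) auto
        also have "\<dots> = ?c * ennreal (v powr s * (1 - v) powr (real k - 1))"
          using True Suc C by (simp add: ennreal_mult'[symmetric] powr_realpow mult_ac)
        finally show ?thesis using True by simp
      qed (use v in \<open>auto simp: \<phi>_def split: split_indicator\<close>)
    qed
  qed
  also have "\<dots> = ?c * ennreal (Beta (s + 1) (real k))"
  proof (subst nn_integral_cmult)
    show "?c * (\<integral>\<^sup>+v. ?b v \<partial>lborel)
      = ?c * ennreal (Beta (s + 1) (real k))"
      using s Suc
      by (intro arg_cong2[where f = "(*)"] refl nn_integral_has_integral_lebesgue'[OF _ has_integral_Beta_real]) auto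
  qed measurable
  also have "\<dots> = ennreal (C * s * Beta (real k + 1) s)"
  proof -
    have "s \<notin> \<int>\<^sub>\<le>\<^sub>0" "real k \<notin> \<int>\<^sub>\<le>\<^sub>0" using s Suc nonpos_Ints_nonpos by force+
    then have "Gamma (s + 1) = s * Gamma s" "Gamma (real k + 1) = real k * Gamma (real k)"
      using Gamma_plus1 by blast+
    then have "real k * Beta (s + 1) (real k) = s * Beta (real k + 1) s"
      by (simp add: Beta_def add_ac)
    then show ?thesis using C by (simp add: ennreal_mult'[symmetric] mult_ac)
  qed
  finally show ?thesis
    using C s by (subst (asm) ennreal_le_iff) (auto simp: Beta_def intro!: mult_nonneg_nonneg divide_nonneg_nonneg Gamma_real_nonneg)
qed

end

section \<open>Convergence of the coefficient series for Bergman functions\<close>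

lemma in_bergman_imp_A1:
  assumes f: "in_bergman p \<alpha> f" and p: "p > 0" and al: "\<alpha> > -1"
    and s: "p \<le> 1 \<Longrightarrow> s = (\<alpha> + 2) / p" "p > 1 \<Longrightarrow> s > (\<alpha> + 1) / p + 1"
  shows "(\<integral>\<^sup>+z. bergman_density 1 (s - 2) f z \<partial>lborel) < \<infinity>"
proof -
  have hol: "f holomorphic_on ball 0 1" and fin: "(\<integral>\<^sup>+z. bergman_density p \<alpha> f z \<partial>lborel) < \<infinity>"
    using f by (auto simp: in_bergman_def bergman_integral_eq)
  note [measurable] = borel_measurable_bergman_density[OF hol]
  have D: "0 < 1 - (norm z)\<^sup>2" "1 - (norm z)\<^sup>2 \<le> 2 * (1 - norm z)" if "norm z < 1" for z :: complex
  proof -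
    have e: "1 - (norm z)\<^sup>2 = (1 - norm z) * (1 + norm z)" by (simp add: power2_eq_square algebra_simps)
    show "0 < 1 - (norm z)\<^sup>2" unfolding e using that by (simp add: add_pos_nonneg)
    have "(1 - norm z) * (1 + norm z) \<le> (1 - norm z) * 2" using that by (intro mult_left_mono) auto
    then show "1 - (norm z)\<^sup>2 \<le> 2 * (1 - norm z)" using e by simp
  qed
  show ?thesis
  \<comment> \<open>For p \<le> 1 the growth bound for |f|^p by a multiple of (1 - |z|^2)^(-\<alpha>
    - 2) converts the surplus |f|^(1 - p) into a power of the weight, and s = (\<alpha> + 2) / p is
    where the exponents balance. For p > 1 Young's inequality separates f from a pure
    weight.\<close>
  proof (cases "p \<le> 1")
    case True
    obtain C where C: "C > 0" and loc: "bergman_local_bound C p \<alpha>"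
      by (rule bergman_local_estimate[OF p]) (use that in blast)
    define I where "I = enn2real (\<integral>\<^sup>+z. bergman_density p \<alpha> f z \<partial>lborel)"
    have I: "(\<integral>\<^sup>+z. bergman_density p \<alpha> f z \<partial>lborel) = ennreal I" "I \<ge> 0" using fin by (auto simp: I_def)
    define x where "x = (1 - p) / p"
    have x: "x \<ge> 0" using True p by (simp add: x_def)
    define K where "K = (C * I * 2 powr (\<alpha> + 2)) powr x"
    have le: "bergman_density 1 (s - 2) f z \<le> ennreal K * bergman_density p \<alpha> f z" for z
    proof (cases "norm z < 1 \<and> f z \<noteq> 0")
      case z: True
      define d where "d = 1 - (norm z)\<^sup>2"
      have d: "d > 0" "d / 2 \<le> 1 - norm z" using D[of z] z by (auto simp: d_def)
      have "ennreal ((d / 2) powr (\<alpha> + 2) * norm (f z) powr p) \<le> ennreal ((1 - norm z) powr (\<alpha> + 2) * norm (f z) powr p)"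
        using d al by (intro ennreal_leI mult_right_mono powr_mono2) auto
      also have "\<dots> \<le> ennreal C * (\<integral>\<^sup>+u. bergman_density p \<alpha> f u * indicator (ball z ((1 - norm z) / 2)) u \<partial>lborel)"
        using loc[rule_format, OF hol] z by simp
      also have "\<dots> \<le> ennreal C * (\<integral>\<^sup>+u. bergman_density p \<alpha> f u \<partial>lborel)"
        by (intro mult_left_mono nn_integral_mono) (auto split: split_indicator)
      also have "\<dots> = ennreal (C * I)" using C by (simp add: I ennreal_mult')
      finally have "(d / 2) powr (\<alpha> + 2) * norm (f z) powr p \<le> C * I"
        using C I by simp
      then have "norm (f z) powr p \<le> C * I * 2 powr (\<alpha> + 2) * d powr - (\<alpha> + 2)"
        using d by (simp add: powr_divide powr_minus_divide[of d "\<alpha> + 2"] field_simps del: minus_add_distrib)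
      then have "(norm (f z) powr p) powr x \<le> (C * I * 2 powr (\<alpha> + 2) * d powr - (\<alpha> + 2)) powr x"
        using x by (intro powr_mono2) auto
      also have "(norm (f z) powr p) powr x = norm (f z) powr (1 - p)"
        using p by (simp add: powr_powr x_def)
      also have "(C * I * 2 powr (\<alpha> + 2) * d powr - (\<alpha> + 2)) powr x = K * d powr (- (\<alpha> + 2) * x)"
        unfolding K_def using C I d by (subst powr_mult) (auto simp: powr_powr)
      finally have h: "norm (f z) powr (1 - p) \<le> K * d powr (- (\<alpha> + 2) * x)" .
      have "norm (f z) * d powr (s - 2) = norm (f z) powr p * d powr (s - 2) * norm (f z) powr (1 - p)"
        using z by (simp add: powr_add[symmetric])
      also have "\<dots> \<le> norm (f z) powr p * d powr (s - 2) * (K * d powr (- (\<alpha> + 2) * x))"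
        by (intro mult_left_mono h) auto
      also have "\<dots> = K * (norm (f z) powr p * (d powr (s - 2) * d powr (- (\<alpha> + 2) * x)))"
        by (simp add: mult_ac)
      also have "d powr (s - 2) * d powr (- (\<alpha> + 2) * x) = d powr \<alpha>"
      proof -
        have "s - 2 + - (\<alpha> + 2) * x = \<alpha>"
          using s(1)[OF True] p by (simp add: x_def field_simps)
        then show ?thesis by (simp only: powr_add[symmetric])
      qed
      finally have "norm (f z) * d powr (s - 2) / pi \<le> K * (norm (f z) powr p * d powr \<alpha> / pi)"
        by (simp add: divide_right_mono)
      then show ?thesis using z
        by (simp add: bergman_density_eq d_def ennreal_mult'[symmetric] K_def ennreal_leI)
    qed (use p in \<open>auto simp: bergman_density_eq\<close>)
    have "(\<integral>\<^sup>+z. bergman_density 1 (s - 2) f z \<partial>lborel) \<le> (\<integral>\<^sup>+z. ennreal K * bergman_density p \<alpha> f z \<partial>lborel)"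
      by (intro nn_integral_mono le)
    also have "\<dots> = ennreal K * ennreal I" by (subst nn_integral_cmult) (auto simp: I)
    also have "\<dots> < \<infinity>" by (simp add: ennreal_mult'[symmetric] K_def)
    finally show ?thesis .
  next
    case False
    then have p1: "p > 1" by simp
    define p' where "p' = p / (p - 1)"
    have p': "p' > 1" "1/p + 1/p' = 1" using p1 by (auto simp: p'_def field_simps)
    \<comment> \<open>Exponent of the pure weight; its integrability \<tau> > -1 is the condition s
      > (\<alpha> + 1) / p + 1.\<close>
    define \<tau> where "\<tau> = (s - 2 - \<alpha> / p) * p'"
    have "s - 2 - \<alpha> / p > 1 / p - 1" using s(2)[OF p1] by (simp add: add_divide_distrib)
    then have "(1 / p - 1) * p' < \<tau>" unfolding \<tau>_def using p' by (intro mult_strict_right_mono) auto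
    moreover have "(1 / p - 1) * p' = -1" using p1 by (simp add: p'_def field_simps)
    ultimately have tau: "\<tau> > -1" by simp
    have le: "bergman_density 1 (s - 2) f z \<le> bergman_density p \<alpha> f z + disc_weight \<tau> z" for z
    proof (cases "norm z < 1")
      case z: True
      define d where "d = 1 - (norm z)\<^sup>2"
      have d: "d > 0" using D[of z] z by (auto simp: d_def)
      have "(norm (f z) * d powr (\<alpha> / p)) * d powr (s - 2 - \<alpha> / p)
         \<le> (norm (f z) * d powr (\<alpha> / p)) powr p / p + (d powr (s - 2 - \<alpha> / p)) powr p' / p'"
        by (rule Youngs_inequality) (use p1 p' in auto)
      also have "(norm (f z) * d powr (\<alpha> / p)) powr p = norm (f z) powr p * d powr \<alpha>"
        using p by (simp add: powr_mult powr_powr)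
      also have "(d powr (s - 2 - \<alpha> / p)) powr p' = d powr \<tau>" by (simp add: powr_powr \<tau>_def)
      also have "norm (f z) powr p * d powr \<alpha> / p \<le> norm (f z) powr p * d powr \<alpha>"
        using p1 divide_left_mono[of 1 p "norm (f z) powr p * d powr \<alpha>"] by simp
      also have "d powr \<tau> / p' \<le> d powr \<tau>"
        using p' by (simp add: divide_le_eq mult_le_cancel_left1)
      also have "(norm (f z) * d powr (\<alpha> / p)) * d powr (s - 2 - \<alpha> / p) = norm (f z) * d powr (s - 2)"
        by (simp add: powr_add[symmetric] mult.assoc)
      finally have "norm (f z) * d powr (s - 2) / pi \<le> norm (f z) powr p * d powr \<alpha> / pi + d powr \<tau> / pi"
        by (simp add: divide_right_mono add_divide_distrib[symmetric])
      then show ?thesis using z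
        by (simp add: bergman_density_eq disc_weight_def d_def ennreal_plus[symmetric] ennreal_leI del: ennreal_plus)
    qed (auto simp: bergman_density_eq)
    have "(\<integral>\<^sup>+z. bergman_density 1 (s - 2) f z \<partial>lborel) \<le> (\<integral>\<^sup>+z. bergman_density p \<alpha> f z + disc_weight \<tau> z \<partial>lborel)"
      by (intro nn_integral_mono le)
    also have "\<dots> = (\<integral>\<^sup>+z. bergman_density p \<alpha> f z \<partial>lborel) + ennreal (1 / (\<tau> + 1))"
      by (subst nn_integral_add) (auto simp: nn_integral_disc_weight[OF tau])
    also have "\<dots> < \<infinity>" using fin by simp
    finally show ?thesis .
  qed
qed

context radial_measure
begin

text \<open>The coefficient inequality and the moment bound are paired at the same s. This is what
  makes the operator defined on the whole Bergman space in the sufficiency direction.\<close>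

lemma taylor_moment_summable:
  assumes f: "in_bergman p \<alpha> f" and p: "p > 0" and al: "\<alpha> > -1"
    and car: "carleson \<mu> s0" and s0: "p \<le> 1 \<Longrightarrow> s0 \<ge> (\<alpha> + 2) / p" "p > 1 \<Longrightarrow> s0 > (\<alpha> + 1) / p + 1"
  shows "summable (\<lambda>k. norm (taylor_coeff f k) * moment k)"
proof -
  \<comment> \<open>For p \<le> 1 the exponent is lowered to the value at which
    \<open>in_bergman_imp_A1\<close> applies; \<open>carleson_mono\<close> permits this.\<close>
  define s where "s = (if p \<le> 1 then (\<alpha> + 2) / p else s0)"
  have s: "s > 0"
  proof (cases "p \<le> 1")
    case False
    have "(\<alpha> + 1) / p > 0" using p al by simp
    then show ?thesis using False s0(2) by (simp add: s_def)
  qed (use p al in \<open>simp add: s_def\<close>)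
  have "carleson \<mu> s" using carleson_mono[OF car] s0 by (auto simp: s_def)
  then obtain C where C: "C > 0" and N: "sublevel_growth \<mu> gap C s"
    using carleson_gap s by (metis less_imp_le)
  have hol: "f holomorphic_on ball 0 1" using f by (simp add: in_bergman_def)
  have "(\<Sum>k. ennreal (norm (taylor_coeff f k) * Beta (real k + 1) s)) \<le> 2 * (\<integral>\<^sup>+z. bergman_density 1 (s - 2) f z \<partial>lborel)"
    by (rule bergman_coeff_sum_le[OF hol s])
  also have "\<dots> < \<infinity>"
    using in_bergman_imp_A1[OF f p al, of s] s0 by (auto simp: s_def ennreal_mult_less_top)
  finally have "(\<Sum>k. ennreal (norm (taylor_coeff f k) * Beta (real k + 1) s)) \<noteq> top" by simp
  moreover have B0: "Beta (real k + 1) s \<ge> 0" for k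
    using s by (auto simp: Beta_def intro!: mult_nonneg_nonneg divide_nonneg_nonneg Gamma_real_nonneg)
  ultimately have "summable (\<lambda>k. norm (taylor_coeff f k) * Beta (real k + 1) s)"
    by (intro summable_suminf_not_top) auto
  then have "summable (\<lambda>k. (C * s) * (norm (taylor_coeff f k) * Beta (real k + 1) s))"
    by (rule summable_mult)
  then show ?thesis
  proof (rule summable_comparison_test'[of _ 1])
    fix k :: nat assume "k \<ge> 1"
    have "norm (taylor_coeff f k) * moment k \<le> norm (taylor_coeff f k) * (C * s * Beta (real k + 1) s)"
      using moment_le_Beta[OF N s, of k] C \<open>k \<ge> 1\<close> by (intro mult_left_mono) auto
    then show "norm (norm (taylor_coeff f k) * moment k) \<le> (C * s) * (norm (taylor_coeff f k) * Beta (real k + 1) s)"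
      by (simp add: moment_nonneg mult_ac)
  qed
qed

abbreviation gap_shell :: "real \<Rightarrow> real set" where
  "gap_shell \<delta> \<equiv> {t. \<delta> \<le> gap t \<and> gap t \<le> 4 * \<delta>}"

text \<open>With \<open>v\<close> constant this is the Carleson embedding of A^p into L^q(\<mu>),
  with the classical exponent (\<alpha> + 2) q / p. \<open>K\<close> is uniform in \<open>f\<close>,
  \<open>v\<close> and \<open>V\<close>.\<close>

abbreviation shell_embedding :: "real \<Rightarrow> real \<Rightarrow> real \<Rightarrow> real \<Rightarrow> bool" where
  "shell_embedding p \<alpha> q K \<equiv> (\<forall>f v V. in_bergman p \<alpha> f \<longrightarrow> v \<in> borel_measurable borel \<longrightarrow> V \<ge> 0 \<longrightarrow>
     (\<forall>\<delta>. 0 < \<delta> \<longrightarrow> \<delta> \<le> 1 \<longrightarrow>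
        (\<integral>\<^sup>+t. v t * indicator (gap_shell \<delta>) t \<partial>\<mu>) \<le> ennreal (V * \<delta> powr ((\<alpha> + 2) * q / p))) \<longrightarrow>
     (\<integral>\<^sup>+t. ennreal (indicator {0..<1} t * norm (f (of_real t)) powr q) * v t \<partial>\<mu>)
       \<le> ennreal (K * V * enn2real (bergman_integral p \<alpha> f) powr (q / p)))"

text \<open>Only the mass of dyadic shells enters, which lets the weight v carry
  powers and logarithms.\<close>

lemma carleson_embedding:
  fixes p q \<alpha> :: real
  assumes p: "p > 0" and q: "q \<ge> p" and al: "\<alpha> > -1"
  obtains K where "K > 0"
    "shell_embedding p \<alpha> q K"
proof -
  obtain C where C: "C > 0" and loc: "bergman_local_bound C p \<alpha>"
    by (rule bergman_local_estimate[OF p]) (use that in blast)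
  define y where "y = (\<alpha> + 2) * q / p"
  have y: "y > 0" using p q al by (simp add: y_def)
  have qp: "q / p \<ge> 1" using p q by simp
  show ?thesis
  proof (rule that[of "C powr (q / p)"]; (intro allI impI)?)
    show "C powr (q / p) > 0" using C by simp
    fix f :: "complex \<Rightarrow> complex" and v :: "real \<Rightarrow> ennreal" and V :: real
    assume f: "in_bergman p \<alpha> f" and v [measurable]: "v \<in> borel_measurable borel" and V: "V \<ge> 0"
      and shell: "\<forall>\<delta>. 0 < \<delta> \<longrightarrow> \<delta> \<le> 1 \<longrightarrow>
          (\<integral>\<^sup>+t. v t * indicator (gap_shell \<delta>) t \<partial>\<mu>) \<le> ennreal (V * \<delta> powr ((\<alpha> + 2) * q / p))"
    have hol: "f holomorphic_on ball 0 1" and fin: "(\<integral>\<^sup>+z. bergman_density p \<alpha> f z \<partial>lborel) < \<infinity>"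
      using f by (auto simp: in_bergman_def bergman_integral_eq)
    have [measurable]: "bergman_density p \<alpha> f \<in> borel_measurable borel"
      by (rule borel_measurable_bergman_density[OF hol])
    define I where "I = enn2real (bergman_integral p \<alpha> f)"
    have I: "(\<integral>\<^sup>+z. bergman_density p \<alpha> f z \<partial>lborel) = ennreal I" "I \<ge> 0"
      using fin by (auto simp: I_def bergman_integral_eq)
    \<comment> \<open>Written as a conditional in both variables, so that it is visibly jointly
      measurable for Tonelli.\<close>
    define ind where "ind t u = (if norm (complex_of_real t - u) < (1 - norm (complex_of_real t)) / 2 then 1 else 0 :: ennreal)" for t u
    have ind: "indicator (ball (complex_of_real t) ((1 - norm (complex_of_real t)) / 2)) u = ind t u" for t u
      unfolding ind_def mem_ball dist_norm[symmetric] by (auto split: split_indicator)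
    define J where "J t = (\<integral>\<^sup>+u. bergman_density p \<alpha> f u * ind t u \<partial>lborel)" for t
    let ?n = "\<lambda>t. norm (f (of_real t))" and ?D = "bergman_density p \<alpha> f"
    let ?F = "\<lambda>t. ennreal (indicator {0..<1} t * ?n t powr q)"
      and ?g = "\<lambda>t. ennreal (indicator {0..<1} t * gap t powr - y)"
      and ?c = "ennreal (C powr (q / p) * I powr (q / p - 1))"
    \<comment> \<open>The local estimate is raised to the power q / p \<ge> 1. Of the resulting
      J^(q/p), one factor J is kept to be integrated and the rest is bounded by the total integral
      I.\<close>
    have pt: "?F t
       \<le> ?c * (?g t * J t)" for t
    proof (cases "t \<in> {0..<1}")
      case True
      have JI: "J t \<le> ennreal I"
        unfolding J_def I(1)[symmetric] by (intro nn_integral_mono) (auto simp: ind_def)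
      define j where "j = enn2real (J t)"
      have j: "J t = ennreal j" "j \<ge> 0" "j \<le> I"
        using I JI by (auto simp: j_def ennreal_enn2real_if top_unique intro: enn2real_leI)
      have g: "gap t = 1 - norm (complex_of_real t)" "gap t > 0" using True by (auto simp: gap_def)
      have "ennreal (gap t powr (\<alpha> + 2) * ?n t powr p) \<le> ennreal C * J t"
        using loc[rule_format, OF hol, of "complex_of_real t"] True unfolding g J_def ind by simp
      also have "\<dots> = ennreal (C * j)" using C j by (simp add: ennreal_mult')
      finally have "gap t powr (\<alpha> + 2) * ?n t powr p \<le> C * j"
        using C j by simp
      then have "(gap t powr (\<alpha> + 2) * ?n t powr p) powr (q / p) \<le> (C * j) powr (q / p)"
        using qp by (intro powr_mono2) auto
      also have "(gap t powr (\<alpha> + 2) * ?n t powr p) powr (q / p)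
         = gap t powr y * ?n t powr q"
        using p by (simp add: powr_mult powr_powr y_def)
      also have "(C * j) powr (q / p) \<le> C powr (q / p) * (j * I powr (q / p - 1))"
      proof (cases "j = 0")
        case False
        have "j powr (q / p) = j * j powr (q / p - 1)"
          using False j powr_add[of j 1 "q / p - 1"] by simp
        also have "\<dots> \<le> j * I powr (q / p - 1)"
          using qp j by (intro mult_left_mono powr_mono2) auto
        finally show ?thesis using C j by (simp add: powr_mult)
      qed simp
      finally have "?n t powr q \<le> C powr (q / p) * I powr (q / p - 1) * (gap t powr - y * j)"
        using g(2) by (simp add: powr_minus field_simps)
      then have "ennreal (?n t powr q) \<le> ennreal (C powr (q / p) * I powr (q / p - 1) * (gap t powr - y * j))"
        by (rule ennreal_leI)
      also have "\<dots> = ?c * (ennreal (gap t powr - y) * J t)"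
        by (simp add: j ennreal_mult')
      finally show ?thesis using True by simp
    qed simp
    interpret pair_sigma_finite \<mu> lborel ..
    define G where "G t u = v t * (?g t * ind t u)" for t u
    have Gm: "(\<lambda>(t, u). G t u * ?D u) \<in> borel_measurable (\<mu> \<Otimes>\<^sub>M lborel)"
      unfolding G_def ind_def by measurable
    have G1 [measurable]: "(\<lambda>t. G t u) \<in> borel_measurable \<mu>" for u
      unfolding G_def ind_def by measurable
    have inner: "(\<integral>\<^sup>+t. G t u \<partial>\<mu>) * ?D u \<le> ennreal V * ?D u" for u
    proof (cases "norm u < 1")
      case True
      \<comment> \<open>If the half-distance disc of \<open>t\<close> contains \<open>u\<close>,
        then \<delta> < gap t < 3 \<delta>, so all such \<open>t\<close> lie in one shell.\<close>
      define \<delta> where "\<delta> = 2 / 3 * (1 - norm u)"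
      have d: "0 < \<delta>" "\<delta> \<le> 1" using True norm_ge_zero[of u] by (auto simp: \<delta>_def simp del: norm_ge_zero)
      have "(\<integral>\<^sup>+t. G t u \<partial>\<mu>) \<le> (\<integral>\<^sup>+t. ennreal (\<delta> powr - y) * (v t * indicator (gap_shell \<delta>) t) \<partial>\<mu>)"
      proof (rule nn_integral_mono)
        fix t
        show "G t u \<le> ennreal (\<delta> powr - y) * (v t * indicator (gap_shell \<delta>) t)"
        proof (cases "t \<in> {0..<1} \<and> u \<in> ball (complex_of_real t) ((1 - norm (complex_of_real t)) / 2)")
          case T: True
          then have t: "norm (complex_of_real t) < 1" "gap t = 1 - norm (complex_of_real t)" by (auto simp: gap_def)
          have b: "\<delta> \<le> gap t" "gap t \<le> 4 * \<delta>"
            using one_minus_norm_bounds[OF conjunct2[OF T] t(1)] t(2) by (auto simp: \<delta>_def)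
          have "gap t powr - y \<le> \<delta> powr - y" using b d y by (intro powr_mono2') auto
          then have "G t u \<le> v t * (ennreal (\<delta> powr - y) * 1)"
            unfolding G_def using T by (intro mult_left_mono mult_mono) (auto simp: ind_def ennreal_leI)
          then show ?thesis using b by (simp add: mult.commute)
        next
          case False
          then have "G t u = 0" by (auto simp: G_def ind[symmetric])
          then show ?thesis by simp
        qed
      qed
      also have "\<dots> = ennreal (\<delta> powr - y) * (\<integral>\<^sup>+t. v t * indicator (gap_shell \<delta>) t \<partial>\<mu>)"
        by (rule nn_integral_cmult) measurable
      also have "\<dots> \<le> ennreal (\<delta> powr - y) * ennreal (V * \<delta> powr y)"
        unfolding y_def by (intro mult_left_mono shell[rule_format] d) simp
      also have "\<dots> = ennreal V" using d V by (simp add: ennreal_mult'[symmetric] powr_minus)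
      finally show ?thesis by (rule mult_right_mono) simp
    qed (simp add: bergman_density_eq)
    have "(\<integral>\<^sup>+t. ?F t * v t \<partial>\<mu>)
      \<le> (\<integral>\<^sup>+t. ?c * (\<integral>\<^sup>+u. G t u * ?D u \<partial>lborel) \<partial>\<mu>)"
    proof (rule nn_integral_mono)
      fix t
      have "?F t * v t
        \<le> (?c * (?g t * J t)) * v t"
        by (rule mult_right_mono[OF pt]) simp
      also have "\<dots> = ?c * ((v t * ?g t) * J t)"
        by (simp only: mult_ac)
      also have "(v t * ?g t) * J t
         = (\<integral>\<^sup>+u. (v t * ?g t) * (?D u * ind t u) \<partial>lborel)"
        unfolding J_def by (rule nn_integral_cmult[symmetric]) (unfold ind_def, measurable)
      also have "\<dots> = (\<integral>\<^sup>+u. G t u * ?D u \<partial>lborel)"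
        unfolding G_def by (simp only: mult_ac)
      finally show "?F t * v t
         \<le> ?c * (\<integral>\<^sup>+u. G t u * ?D u \<partial>lborel)" .
    qed
    also have "\<dots> = ?c * (\<integral>\<^sup>+t. \<integral>\<^sup>+u. G t u * ?D u \<partial>lborel \<partial>\<mu>)"
      by (rule nn_integral_cmult) (use Gm in measurable)
    also have "(\<integral>\<^sup>+t. \<integral>\<^sup>+u. G t u * ?D u \<partial>lborel \<partial>\<mu>) = (\<integral>\<^sup>+u. \<integral>\<^sup>+t. G t u * ?D u \<partial>\<mu> \<partial>lborel)"
      by (rule Fubini'[symmetric, OF Gm])
    also have "\<dots> \<le> (\<integral>\<^sup>+u. ennreal V * ?D u \<partial>lborel)"
      by (intro nn_integral_mono) (subst nn_integral_multc; simp add: inner)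
    also have "\<dots> = ennreal (V * I)"
      by (subst nn_integral_cmult) (auto simp: I V ennreal_mult')
    also have "?c * ennreal (V * I) = ennreal (C powr (q / p) * V * I powr (q / p))"
    proof (cases "I = 0")
      case False
      then have "I powr (q / p) = I powr (q / p - 1) * I"
        using I powr_add[of I "q / p - 1" 1] by simp
      then show ?thesis using V I by (simp add: ennreal_mult'[symmetric] mult_ac)
    qed simp
    finally show "(\<integral>\<^sup>+t. ?F t * v t \<partial>\<mu>)
         \<le> ennreal (C powr (q / p) * V * enn2real (bergman_integral p \<alpha> f) powr (q / p))"
      by (simp add: mult_left_mono I_def)
  qed
qed

end

abbreviation disc_area :: "real \<Rightarrow> complex measure" where
  "disc_area \<gamma> \<equiv> density lborel (disc_weight \<gamma>)"

lemma disc_weight_sublevel: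
  assumes g: "\<gamma> > -1"
  obtains C where "C > 0" "finite_measure (disc_area \<gamma>)"
    "sublevel_growth (disc_area \<gamma>) disc_gap C (\<gamma> + 2)"
proof -
  obtain C where C: "C > 0" and le:
    "\<And>u. u > 0 \<Longrightarrow> (\<integral>\<^sup>+z. disc_weight \<gamma> z * indicator {z. norm (1 - z) \<le> u} z \<partial>lborel) \<le> ennreal (C * u powr (\<gamma> + 2))"
    by (rule disc_weight_near_1[OF g]) (use that in blast)
  show ?thesis
  proof (rule that[OF C]; (intro allI impI)?)
    show "finite_measure (disc_area \<gamma>)"
      by (rule finite_measureI) (simp add: emeasure_density nn_integral_disc_weight[OF g])
    fix v :: real assume v: "v > 0"
    have "emeasure (disc_area \<gamma>) (sublevel (disc_area \<gamma>) disc_gap v)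
      = (\<integral>\<^sup>+z. disc_weight \<gamma> z * indicator {z. norm (1 - z) \<le> v} z \<partial>lborel)"
      by (subst emeasure_density)
         (auto intro!: nn_integral_cong simp: disc_weight_def disc_gap_def split: split_indicator)
    then show "emeasure (disc_area \<gamma>) (sublevel (disc_area \<gamma>) disc_gap v)
      \<le> ennreal (C * v powr (\<gamma> + 2))" using le[OF v] by simp
  qed
qed

subsection \<open>Sufficiency\<close>

lemma H_boundedI:
  assumes p: "p > 0" and q: "q > 0" and al: "\<alpha> > -1" and ga: "\<gamma> > -1" and K: "K \<ge> 0"
    and "\<And>f. in_bergman p \<alpha> f \<Longrightarrow> H_defined \<mu> \<beta> f" "\<And>f. in_bergman p \<alpha> f \<Longrightarrow> H_op \<mu> \<beta> f holomorphic_on ball 0 1"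
    and "\<And>f. in_bergman p \<alpha> f \<Longrightarrow> bergman_integral q \<gamma> (H_op \<mu> \<beta> f) \<le> ennreal (K * enn2real (bergman_integral p \<alpha> f) powr (q / p))"
  shows "H_bounded \<mu> \<beta> p \<alpha> q \<gamma>"
  unfolding H_bounded_def
proof (intro exI allI impI)
  fix f assume f: "in_bergman p \<alpha> f"
  define I where "I = enn2real (bergman_integral p \<alpha> f)"
  note A = assms(6-8)[OF f, folded I_def]
  have fin: "bergman_integral q \<gamma> (H_op \<mu> \<beta> f) < \<infinity>"
    using A by (auto intro: le_less_trans)
  have "enn2real (bergman_integral q \<gamma> (H_op \<mu> \<beta> f)) \<le> K * I powr (q / p)"
    using A K by (intro enn2real_leI) auto
  then have "bergman_norm q \<gamma> (H_op \<mu> \<beta> f) \<le> ((\<gamma> + 1) * (K * I powr (q / p))) powr (1 / q)"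
    unfolding bergman_norm_def using q ga by (intro powr_mono2 mult_left_mono) auto
  also have "\<dots> = ((\<gamma> + 1) * K) powr (1 / q) * I powr (1 / p)"
    using K ga q p by (simp add: powr_mult powr_powr)
  also have "\<dots> = (((\<gamma> + 1) * K) powr (1 / q) / (\<alpha> + 1) powr (1 / p)) * bergman_norm p \<alpha> f"
    unfolding bergman_norm_def I_def[symmetric] using al by (simp add: powr_mult I_def)
  finally show "H_defined \<mu> \<beta> f \<and> in_bergman q \<gamma> (H_op \<mu> \<beta> f) \<and> bergman_norm q \<gamma> (H_op \<mu> \<beta> f)
      \<le> (((\<gamma> + 1) * K) powr (1 / q) / (\<alpha> + 1) powr (1 / p)) * bergman_norm p \<alpha> f"
    using A fin by (simp add: in_bergman_def)
qed

lemma H_boundedD: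
  assumes b: "H_bounded \<mu> \<beta> p \<alpha> q \<gamma>" and p: "p > 0" and q: "q > 0" and al: "\<alpha> > -1" and ga: "\<gamma> > -1"
  obtains K where "K > 0" "\<And>f. in_bergman p \<alpha> f \<Longrightarrow> in_bergman q \<gamma> (H_op \<mu> \<beta> f) \<and>
      enn2real (bergman_integral q \<gamma> (H_op \<mu> \<beta> f)) powr (1 / q) \<le> K * enn2real (bergman_integral p \<alpha> f) powr (1 / p)"
proof -
  obtain C where C: "\<And>f. in_bergman p \<alpha> f \<Longrightarrow> in_bergman q \<gamma> (H_op \<mu> \<beta> f) \<and>
     bergman_norm q \<gamma> (H_op \<mu> \<beta> f) \<le> C * bergman_norm p \<alpha> f"
    using b unfolding H_bounded_def by blast
  define K where "K = max C 1 * (\<alpha> + 1) powr (1 / p) / (\<gamma> + 1) powr (1 / q)"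
  show ?thesis
  proof (rule that[of K])
    show "K > 0" using al ga by (simp add: K_def)
    fix f assume f: "in_bergman p \<alpha> f"
    let ?I = "enn2real (bergman_integral p \<alpha> f)" and ?J = "enn2real (bergman_integral q \<gamma> (H_op \<mu> \<beta> f))"
    have "((\<gamma> + 1) * ?J) powr (1 / q) \<le> C * ((\<alpha> + 1) * ?I) powr (1 / p)"
      using C[OF f] by (simp add: bergman_norm_def)
    also have "\<dots> \<le> max C 1 * ((\<alpha> + 1) * ?I) powr (1 / p)"
      by (intro mult_right_mono) auto
    finally have "(\<gamma> + 1) powr (1 / q) * ?J powr (1 / q) \<le> max C 1 * ((\<alpha> + 1) powr (1 / p) * ?I powr (1 / p))"
      using ga al by (simp add: powr_mult)
    then have "?J powr (1 / q) \<le> K * ?I powr (1 / p)"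
      using ga by (simp add: K_def field_simps)
    then show "in_bergman q \<gamma> (H_op \<mu> \<beta> f) \<and> ?J powr (1 / q) \<le> K * ?I powr (1 / p)"
      using C[OF f] by simp
  qed
qed

context radial_measure
begin

lemma borel_measurable_norm_on_radius:
  assumes "f holomorphic_on ball 0 1"
  shows "(\<lambda>t. indicator {0..<1} t * norm (f (of_real t))) \<in> borel_measurable borel"
proof -
  have "(\<lambda>t. norm (indicator {0..<1} t *\<^sub>R f (of_real t))) \<in> borel_measurable borel"
    using borel_measurable_on_radius[OF assms] by measurable
  then show ?thesis by simp
qed

lemma norm_H_op_le_max:
  assumes "f holomorphic_on ball 0 1" "summable (\<lambda>k. norm (taylor_coeff f k) * moment k)" "\<beta> > 0" "norm z < 1"
  shows "ennreal (norm (H_op \<mu> \<beta> f z)) \<le> (\<integral>\<^sup>+t. ennreal (2 powr \<beta> * (indicator {0..<1} t * norm (f (of_real t)))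
      * max (gap t) (disc_gap z) powr - \<beta>) \<partial>\<mu>)"
proof (rule order_trans[OF norm_H_op_le[OF assms]], rule nn_integral_mono)
  fix t
  show "ennreal (indicator {0..<1} t * (norm (f (of_real t)) * norm (1 - of_real t * z) powr - \<beta>))
    \<le> ennreal (2 powr \<beta> * (indicator {0..<1} t * norm (f (of_real t))) * max (gap t) (disc_gap z) powr - \<beta>)"
  proof (cases "t \<in> {0..<1}")
    case True
    have "norm (f (of_real t)) * norm (1 - of_real t * z) powr - \<beta>
       \<le> norm (f (of_real t)) * (2 powr \<beta> * max (gap t) (disc_gap z) powr - \<beta>)"
      using True assms by (intro mult_left_mono norm_one_minus_mult_powr_le) auto
    then show ?thesis using True by (intro ennreal_leI) (simp add: mult_ac)
  qed simp
qed

text \<open>Common to both sufficiency proofs: after a pointwise bound by a \<mu>-integral,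
  exchanging the order leaves for each t a kernel integral in z, whose bound is
  \<open>B t\<close>.\<close>

lemma bergman_integral_le_Fubini:
  assumes [measurable]: "G \<in> borel_measurable borel" "A \<in> borel_measurable borel"
      "(\<lambda>(z, t). k z t) \<in> borel_measurable (lborel \<Otimes>\<^sub>M \<mu>)"
    and nonneg: "\<And>z t. 0 \<le> k z t" "\<And>t. 0 \<le> G t" "\<And>z. 0 \<le> A z"
    and le: "\<And>z. norm z < 1 \<Longrightarrow> ennreal (norm (\<Phi> z) powr q) \<le> ennreal (A z) * (\<integral>\<^sup>+t. ennreal (G t * k z t) \<partial>\<mu>)"
    and B: "\<And>t. (\<integral>\<^sup>+z. disc_weight \<gamma> z * ennreal (A z * k z t) \<partial>lborel) \<le> ennreal (B t)"
  shows "bergman_integral q \<gamma> \<Phi> \<le> (\<integral>\<^sup>+t. ennreal (G t) * ennreal (B t) \<partial>\<mu>)"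
proof -
  interpret pair_sigma_finite lborel \<mu> ..
  let ?k = "\<lambda>z t. ennreal (G t) * (disc_weight \<gamma> z * ennreal (A z * k z t))"
  have "bergman_integral q \<gamma> \<Phi> \<le> (\<integral>\<^sup>+z. (\<integral>\<^sup>+t. ?k z t \<partial>\<mu>) \<partial>lborel)"
    unfolding bergman_integral_eq
  proof (rule nn_integral_mono)
    fix z
    have [measurable]: "k z \<in> borel_measurable \<mu>" by measurable
    have "bergman_density q \<gamma> \<Phi> z \<le> disc_weight \<gamma> z * ennreal (A z) * (\<integral>\<^sup>+t. ennreal (G t * k z t) \<partial>\<mu>)"
      using mult_left_mono[OF le, of z "disc_weight \<gamma> z"]
      by (cases "norm z < 1") (auto simp: bergman_density_def mult_ac disc_weight_def)
    also have "\<dots> = (\<integral>\<^sup>+t. disc_weight \<gamma> z * ennreal (A z) * ennreal (G t * k z t) \<partial>\<mu>)"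
      by (rule nn_integral_cmult[symmetric]) measurable
    also have "\<dots> = (\<integral>\<^sup>+t. ?k z t \<partial>\<mu>)"
      using nonneg by (intro nn_integral_cong) (simp add: ennreal_mult mult_ac)
    finally show "bergman_density q \<gamma> \<Phi> z \<le> \<dots>" .
  qed
  also have "\<dots> = (\<integral>\<^sup>+t. (\<integral>\<^sup>+z. ?k z t \<partial>lborel) \<partial>\<mu>)"
    by (rule Fubini'[symmetric]) measurable
  also have "\<dots> \<le> (\<integral>\<^sup>+t. ennreal (G t) * ennreal (B t) \<partial>\<mu>)"
    by (intro nn_integral_mono) (subst nn_integral_cmult; simp add: B mult_left_mono)
  finally show ?thesis .
qed

text \<open>The assumed exponent is the one that \<open>carleson_of_H_bounded\<close> forces, so the
  two results are converse to each other when q \<ge> p.\<close>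

theorem H_bounded_of_carleson:
  fixes p \<alpha> \<beta> q :: real
  assumes p: "p > 0" and al: "\<alpha> > -1" and be: "\<beta> > 1" and q: "q \<ge> p" "q > 1"
    and car: "carleson \<mu> ((\<alpha> + 2) / p + \<beta> / conj_exp q)"
  shows "H_bounded \<mu> \<beta> p \<alpha> q (\<beta> - 2)"
proof -
  define e where "e = (\<alpha> + 2) / p"
  define \<tau> where "\<tau> = \<beta> * (1 - 1 / q)"
  define s where "s = e + \<tau>"
  have e: "e > 0" using p al by (simp add: e_def)
  have tau: "\<tau> > 0" "\<tau> < \<beta>" using q be by (auto simp: \<tau>_def field_simps)
  have "\<beta> / conj_exp q = \<tau>" using q by (simp add: conj_exp_def \<tau>_def field_simps)
  then have car': "carleson \<mu> s" using car by (simp add: s_def e_def)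
  have s: "s > 0" "s \<ge> 0" using e tau by (auto simp: s_def)
  obtain C1 where C1: "C1 > 0" and N: "sublevel_growth \<mu> gap C1 s"
    using carleson_gap[OF car' s(2)] by blast
  obtain C2 where C2: "C2 > 0" and finA: "finite_measure (disc_area (\<beta> - 2))"
    and NA: "sublevel_growth (disc_area (\<beta> - 2)) disc_gap C2 \<beta>"
    using disc_weight_sublevel[of "\<beta> - 2"] be by (auto simp del: space_density)
  obtain K0 where K0: "K0 > 0" and emb: "shell_embedding p \<alpha> q K0"
    by (rule carleson_embedding[OF p q(1) al]) (use that in blast)
  define T1 where "T1 = C1 * s / \<tau> * \<beta> / (\<beta> - \<tau>)"
  have T1: "T1 > 0" using C1 s tau be by (simp add: T1_def)
  define T2 where "T2 = C2 * \<beta> / (\<beta> - \<tau>) * \<beta> / \<tau>"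
  have T2: "T2 > 0" using C2 tau be by (simp add: T2_def)
  \<comment> \<open>Powers of \<open>gap t\<close> that accumulate: e q from g^q, -e from the
    kernel, -\<tau> from the integral in z. Since x + s = e q, the shell exponent (\<alpha> + 2) q /
    p comes out exactly.\<close>
  define x where "x = e * q - e - \<tau>"
  \<comment> \<open>On a shell, gap^x is at most the larger of 1 and 4^x times \<delta>^x, whatever
    the sign of x; 4^s comes from the sublevel set at 4 \<delta>.\<close>
  define V where "V = max 1 (4 powr x) * C1 * 4 powr s"
  have V: "V \<ge> 0" using C1 by (simp add: V_def)
  \<comment> \<open>With the weight \<open>gap t powr e\<close> in Holder's inequality, both kernel integrals scale like a power
    whose exponent is \<open>\<tau> - \<beta>\<close> and \<open>-\<tau>\<close>, respectively; both are admissible as \<open>0 < \<tau> < \<beta>\<close>.\<close>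
  have kernel_t: "(\<integral>\<^sup>+t. ennreal (gap t powr - e * max (gap t) (disc_gap z) powr - \<beta>) \<partial>\<mu>) \<le> ennreal (T1 * disc_gap z powr (\<tau> - \<beta>))" for z
  proof -
    have "(\<integral>\<^sup>+t. ennreal (gap t powr - e * max (gap t) (disc_gap z) powr - \<beta>) \<partial>\<mu>)
      \<le> ennreal (C1 * s / (s - e) * \<beta> / (\<beta> - (s - e)) * disc_gap z powr (s - e - \<beta>))"
      by (rule nn_integral_powr_max_powr_le[where H = 1])
         (use finite_measure_axioms gap_bounds disc_gap_bounds N C1 e tau in \<open>auto simp: s_def intro: less_imp_le\<close>)
    then show ?thesis by (simp add: T1_def s_def)
  qed
  let ?m = "\<lambda>t z. disc_gap z powr - \<tau> * max (gap t) (disc_gap z) powr - \<beta>"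
  have kernel_z: "(\<integral>\<^sup>+z. disc_weight (\<beta> - 2) z * ennreal (?m t z) \<partial>lborel)
      \<le> ennreal (T2 * gap t powr - \<tau>)" for t
  proof -
    have "(\<integral>\<^sup>+z. disc_weight (\<beta> - 2) z * ennreal (?m t z) \<partial>lborel)
      = (\<integral>\<^sup>+z. ennreal (disc_gap z powr - \<tau> * max (disc_gap z) (gap t) powr - \<beta>) \<partial>disc_area (\<beta> - 2))"
      by (subst nn_integral_density) (auto simp: max.commute)
    also have "\<dots> \<le> ennreal (C2 * \<beta> / (\<beta> - \<tau>) * \<beta> / (\<beta> - (\<beta> - \<tau>)) * gap t powr (\<beta> - \<tau> - \<beta>))"
      by (rule nn_integral_powr_max_powr_le[where H = 2])
         (use finA gap_bounds disc_gap_bounds NA C2 tau be in \<open>auto intro: less_imp_le\<close>)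
    finally show ?thesis by (simp add: T2_def)
  qed
  let ?M = "max 1 (4 powr x)"
  have shell: "(\<integral>\<^sup>+t. ennreal (gap t powr x) * indicator (gap_shell \<delta>) t \<partial>\<mu>)
      \<le> ennreal (V * \<delta> powr ((\<alpha> + 2) * q / p))" if d: "\<delta> > 0" for \<delta>
  proof -
    have "(\<integral>\<^sup>+t. ennreal (gap t powr x) * indicator (gap_shell \<delta>) t \<partial>\<mu>)
      \<le> (\<integral>\<^sup>+t. ennreal (?M * \<delta> powr x) * indicator (sublevel \<mu> gap (4 * \<delta>)) t \<partial>\<mu>)"
    proof (rule nn_integral_mono)
      fix t
      show "ennreal (gap t powr x) * indicator (gap_shell \<delta>) t
        \<le> ennreal (?M * \<delta> powr x) * indicator (sublevel \<mu> gap (4 * \<delta>)) t"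
      proof (cases "\<delta> \<le> gap t \<and> gap t \<le> 4 * \<delta>")
        case True
        have "gap t powr x \<le> ?M * \<delta> powr x"
        proof (cases "x \<ge> 0")
          case x: True
          have "gap t powr x \<le> (4 * \<delta>) powr x" using True d x by (intro powr_mono2) auto
          also have "\<dots> = 4 powr x * \<delta> powr x" using d by (simp add: powr_mult)
          also have "\<dots> \<le> ?M * \<delta> powr x" by (intro mult_right_mono) auto
          finally show ?thesis .
        next
          case x: False
          have "gap t powr x \<le> 1 * \<delta> powr x" using True d x by (simp add: powr_mono2')
          also have "\<dots> \<le> ?M * \<delta> powr x" by (intro mult_right_mono) auto
          finally show ?thesis .
        qed
        then show ?thesis using True by (simp add: ennreal_leI)
      qed auto
    qed
    also have "\<dots> = ennreal (?M * \<delta> powr x) * emeasure \<mu> (sublevel \<mu> gap (4 * \<delta>))"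
      by (rule nn_integral_cmult_indicator) measurable
    also have "\<dots> \<le> ennreal (?M * \<delta> powr x) * ennreal (C1 * (4 * \<delta>) powr s)"
      using d by (intro mult_left_mono N[rule_format]) auto
    also have "\<dots> = ennreal (V * (\<delta> powr x * \<delta> powr s))"
      using d C1 by (simp add: ennreal_mult'[symmetric] V_def powr_mult mult_ac)
    also have "\<delta> powr x * \<delta> powr s = \<delta> powr ((\<alpha> + 2) * q / p)"
      by (simp add: powr_add[symmetric] x_def s_def e_def)
    finally show ?thesis .
  qed
  define K where "K = T1 powr (q - 1) * T2 * 2 powr (\<beta> * q)"
  have K: "K > 0" using T1 T2 by (simp add: K_def)
  show ?thesis
  proof (rule H_boundedI[where K = "K * (K0 * V)"])
    show "p > 0" "q > 0" "\<alpha> > -1" "\<beta> - 2 > -1" "K * (K0 * V) \<ge> 0" using p q al be K K0 V by auto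
    fix f assume f: "in_bergman p \<alpha> f"
    let ?n = "\<lambda>t. norm (f (of_real t))"
      and ?w = "disc_weight (\<beta> - 2)"
    have hol: "f holomorphic_on ball 0 1" using f by (simp add: in_bergman_def)
    have summ: "summable (\<lambda>k. norm (taylor_coeff f k) * moment k)"
    proof (rule taylor_moment_summable[OF f p al car'])
      show "s \<ge> (\<alpha> + 2) / p" using tau by (simp add: s_def e_def)
      assume "p > 1"
      \<comment> \<open>Here q \<ge> p and \<beta> > 1 enter: \<tau> > 1 - 1/q \<ge> 1 - 1/p is the
        extra room that \<open>taylor_moment_summable\<close> asks for.\<close>
      have "1 - 1 / p \<le> 1 - 1 / q" using q p by (simp add: frac_le)
      also have "\<dots> < \<tau>" using mult_strict_right_mono[OF be, of "1 - 1 / q"] q by (simp add: \<tau>_def)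
      finally have "1 - 1 / p < \<tau>" .
      moreover have "(\<alpha> + 2) / p = (\<alpha> + 1) / p + 1 / p" by (simp add: add_divide_distrib[symmetric])
      ultimately show "s > (\<alpha> + 1) / p + 1" by (simp add: s_def e_def)
    qed
    have b0: "\<beta> > 0" using be by simp
    define g where "g t = 2 powr \<beta> * (indicator {0..<1} t * ?n t) * gap t powr e" for t
    define k where "k z t = gap t powr - e * max (gap t) (disc_gap z) powr - \<beta>" for z t
    have [measurable]: "(\<lambda>t. indicator {0..<1} t * ?n t) \<in> borel_measurable borel"
      by (rule borel_measurable_norm_on_radius[OF hol])
    have [measurable]: "g \<in> borel_measurable borel" unfolding g_def by measurable
    have [measurable]: "k z \<in> borel_measurable borel" for z unfolding k_def by measurable
    have [measurable]: "(\<lambda>(z, t). k z t) \<in> borel_measurable (lborel \<Otimes>\<^sub>M \<mu>)" unfolding k_def by measurable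
    have pt: "ennreal (norm (H_op \<mu> \<beta> f z) powr q) \<le> ennreal (T1 powr (q - 1) * disc_gap z powr - \<tau>) * (\<integral>\<^sup>+t. ennreal (g t powr q * k z t) \<partial>\<mu>)"
      if z: "norm z < 1" for z
    proof -
      have "ennreal (norm (H_op \<mu> \<beta> f z) powr q) \<le> ennreal ((T1 * disc_gap z powr (\<tau> - \<beta>)) powr (q - 1)) * (\<integral>\<^sup>+t. ennreal (g t powr q * k z t) \<partial>\<mu>)"
      proof (rule nn_integral_Jensen_powr[OF _ _ _ _ _ _ q(2)])
        show "g \<in> borel_measurable \<mu>" "k z \<in> borel_measurable \<mu>" by measurable
        show "0 \<le> g t" "0 \<le> k z t" for t by (auto simp: g_def k_def)
        show "(\<integral>\<^sup>+t. ennreal (k z t) \<partial>\<mu>) \<le> ennreal (T1 * disc_gap z powr (\<tau> - \<beta>))"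
          unfolding k_def by (rule kernel_t)
        show "T1 * disc_gap z powr (\<tau> - \<beta>) > 0" using T1 disc_gap_bounds(1)[of z] by simp
        have "g t * k z t = 2 powr \<beta> * (indicator {0..<1} t * ?n t) * max (gap t) (disc_gap z) powr - \<beta>" for t
          using gap_bounds(1)[of t] by (simp add: g_def k_def powr_minus)
        then show "ennreal (norm (H_op \<mu> \<beta> f z)) \<le> (\<integral>\<^sup>+t. ennreal (g t * k z t) \<partial>\<mu>)"
          using norm_H_op_le_max[OF hol summ b0 z] by simp
      qed simp
      also have "(T1 * disc_gap z powr (\<tau> - \<beta>)) powr (q - 1) = T1 powr (q - 1) * disc_gap z powr - \<tau>"
      proof -
        \<comment> \<open>Because \<beta> - \<tau> = \<beta> / q; this turns the Jensen constant
          into the weight \<open>disc_gap z powr - \<tau>\<close> that \<open>kernel_z\<close>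
          expects.\<close>
        have "(\<tau> - \<beta>) * (q - 1) = - \<tau>" using q by (simp add: \<tau>_def field_simps)
        then show ?thesis using T1 by (simp add: powr_mult powr_powr)
      qed
      finally show ?thesis .
    qed
    have "bergman_integral q (\<beta> - 2) (H_op \<mu> \<beta> f)
      \<le> (\<integral>\<^sup>+t. ennreal (g t powr q) * ennreal (T1 powr (q - 1) * gap t powr - e * (T2 * gap t powr - \<tau>)) \<partial>\<mu>)"
    proof (rule bergman_integral_le_Fubini[OF _ _ _ _ _ _ pt])
      fix t
      let ?c = "T1 powr (q - 1) * gap t powr - e"
      have "(\<integral>\<^sup>+z. ?w z * ennreal (T1 powr (q - 1) * disc_gap z powr - \<tau> * k z t) \<partial>lborel)
        = (\<integral>\<^sup>+z. ennreal ?c * (?w z * ennreal (?m t z)) \<partial>lborel)"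
        unfolding k_def by (intro nn_integral_cong) (simp add: ennreal_mult mult_ac)
      also have "\<dots> = ennreal ?c * (\<integral>\<^sup>+z. ?w z * ennreal (?m t z) \<partial>lborel)"
        by (rule nn_integral_cmult) measurable
      also have "\<dots> \<le> ennreal ?c * ennreal (T2 * gap t powr - \<tau>)"
        by (intro mult_left_mono kernel_z) simp
      finally show "(\<integral>\<^sup>+z. ?w z * ennreal (T1 powr (q - 1) * disc_gap z powr - \<tau> * k z t) \<partial>lborel)
        \<le> ennreal (?c * (T2 * gap t powr - \<tau>))"
        by (simp add: ennreal_mult')
    qed (auto simp: k_def)
    also have "\<dots> = (\<integral>\<^sup>+t. ennreal K * (ennreal (indicator {0..<1} t * ?n t powr q) * ennreal (gap t powr x)) \<partial>\<mu>)"
    proof (rule nn_integral_cong)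
      fix t
      have "gap t powr x = gap t powr (e * q) * gap t powr - e * gap t powr - \<tau>"
        by (simp add: powr_add[symmetric] x_def)
      then have "g t powr q * (T1 powr (q - 1) * gap t powr - e * (T2 * gap t powr - \<tau>))
         = K * (indicator {0..<1} t * ?n t powr q * gap t powr x)"
        using q by (cases "t \<in> {0..<1}") (simp_all add: K_def g_def powr_mult powr_powr mult_ac)
      then show "ennreal (g t powr q) * ennreal (T1 powr (q - 1) * gap t powr - e * (T2 * gap t powr - \<tau>))
        = ennreal K * (ennreal (indicator {0..<1} t * ?n t powr q) * ennreal (gap t powr x))"
        using K by (simp add: ennreal_mult'[symmetric])
    qed
    also have "\<dots> = ennreal K * (\<integral>\<^sup>+t. ennreal (indicator {0..<1} t * ?n t powr q) * ennreal (gap t powr x) \<partial>\<mu>)"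
    proof (rule nn_integral_cmult)
      have "(\<lambda>t. indicator {0..<1} t * (indicator {0..<1} t * ?n t) powr q) \<in> borel_measurable borel"
        by measurable
      also have "(\<lambda>t. indicator {0..<1} t * (indicator {0..<1} t * ?n t) powr q)
          = (\<lambda>t. indicator {0..<1} t * ?n t powr q)"
        by (auto split: split_indicator)
      finally have [measurable]: "(\<lambda>t. indicator {0..<1} t * ?n t powr q) \<in> borel_measurable borel" .
      show "(\<lambda>t. ennreal (indicator {0..<1} t * ?n t powr q) * ennreal (gap t powr x)) \<in> borel_measurable \<mu>"
        by measurable
    qed
    also have "\<dots> \<le> ennreal K * ennreal (K0 * V * enn2real (bergman_integral p \<alpha> f) powr (q / p))"
      by (intro mult_left_mono emb[rule_format, OF f _ V] shell) auto
    also have "\<dots> = ennreal (K * (K0 * V) * enn2real (bergman_integral p \<alpha> f) powr (q / p))"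
      using K by (simp add: ennreal_mult'[symmetric] mult.assoc)
    finally show "bergman_integral q (\<beta> - 2) (H_op \<mu> \<beta> f) \<le> \<dots>" .
    show "H_defined \<mu> \<beta> f" "H_op \<mu> \<beta> f holomorphic_on ball 0 1"
      using H_op_holomorphic[OF hol summ b0] H_defined[OF hol summ b0] by blast+
  qed
qed

end

section \<open>The logarithmic condition and the endpoint q = 1\<close>

lemma carleson_box_radius_subset:
  assumes l: "0 < l" "l \<le> 2 * pi"
  shows "{t \<in> {0..<1}. complex_of_real t \<in> carleson_box a l} \<subseteq> {1 - l / (2 * pi)..<1}"
proof
  fix t assume t: "t \<in> {t \<in> {0..<1}. complex_of_real t \<in> carleson_box a l}"
  then obtain r \<theta> where r: "complex_of_real t = of_real r * cis \<theta>" "1 - l / (2 * pi) \<le> r"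
    unfolding carleson_box_def by auto
  \<comment> \<open>Since l \<le> 2 pi the radius is nonnegative, so equal moduli force t = r
    whatever the angle.\<close>
  have "0 \<le> 1 - l / (2 * pi)" using l by simp
  then have "r \<ge> 0" using r(2) by linarith
  have "norm (complex_of_real t) = norm (of_real r * cis \<theta>)" by (simp only: r(1))
  then have "\<bar>t\<bar> = \<bar>r\<bar>" by (simp add: norm_mult)
  then have "t = r" using t \<open>r \<ge> 0\<close> by simp
  then show "t \<in> {1 - l / (2 * pi)..<1}" using t r by auto
qed

context radial_measure
begin

lemma measure_gap_le:
  assumes "0 < v" "v \<le> 1"
  shows "measure \<mu> (sublevel \<mu> gap v) = measure \<mu> {1 - v..<1}"
proof -
  have "AE t in \<mu>. (t \<in> sublevel \<mu> gap v) = (t \<in> {1 - v..<1})"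
    using AE_unit_interval by eventually_elim (use assms in \<open>auto simp: gap_def\<close>)
  then show ?thesis by (intro finite_measure_eq_AE) (auto simp: sets_mu)
qed

abbreviation log_tail_bound :: "real \<Rightarrow> real \<Rightarrow> bool" where
  "log_tail_bound C s \<equiv> (\<forall>b\<in>{0..<1}. measure \<mu> {b..<1} * ln (1 / (1 - b)) \<le> C * (1 - b) powr s)"

text \<open>A box meets the radius within the tail of the same height, and the arc starting at angle
  0 attains all of it. With l = 2 pi (1 - b) the logarithms agree exactly, and a factor (2 pi)^s
  passes between the constants.\<close>

lemma log_carleson_iff:
  assumes s: "s > 0"
  shows "log_carleson \<mu> 1 s \<longleftrightarrow> (\<exists>C. log_tail_bound C s)"
proof
  assume "log_carleson \<mu> 1 s"
  then obtain C where C: "\<And>a l. 0 < l \<Longrightarrow> l \<le> 2 * pi \<Longrightarrow> disc_measure \<mu> (carleson_box a l) * ennreal (ln (2 * pi / l) powr 1)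
      \<le> ennreal (C * l powr s)"
    unfolding log_carleson_def by auto
  show "\<exists>C. log_tail_bound C s"
  proof (intro exI ballI)
    fix b :: real assume b: "b \<in> {0..<1}"
    define l where "l = 2 * pi * (1 - b)"
    have l: "0 < l" "l \<le> 2 * pi" using b by (auto simp: l_def)
    have lb: "1 - l / (2 * pi) = b" "2 * pi / l = 1 / (1 - b)" using b by (auto simp: l_def)
    have ln0: "ln (1 / (1 - b)) \<ge> 0" using b by (simp add: ln_div)
    have "of_real t \<in> carleson_box 0 l" if "t \<in> {b..<1}" for t
      unfolding carleson_box_def lb using that l b by (intro CollectI exI[of _ t] exI[of _ 0]) auto
    then have eq: "{t \<in> {0..<1}. of_real t \<in> carleson_box 0 l} \<supseteq> {b..<1}"
      using b by auto
    have sub: "{t \<in> {0..<1}. complex_of_real t \<in> carleson_box 0 l} \<subseteq> {b..<1}"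
      using carleson_box_radius_subset[OF l] by (simp add: lb)
    have "ennreal (measure \<mu> {b..<1} * ln (1 / (1 - b))) = emeasure \<mu> {b..<1} * ennreal (ln (1 / (1 - b)))"
      by (simp add: emeasure_eq_measure ennreal_mult')
    also have "\<dots> = disc_measure \<mu> (carleson_box 0 l) * ennreal (ln (2 * pi / l) powr 1)"
      using ln0 sub eq by (simp add: disc_measure_def lb(2) antisym)
    also have "\<dots> \<le> ennreal (max C 0 * l powr s)"
      using C[OF l, of 0] by (rule order_trans) (auto intro!: ennreal_leI mult_right_mono)
    finally have "measure \<mu> {b..<1} * ln (1 / (1 - b)) \<le> max C 0 * l powr s"
      by (subst (asm) ennreal_le_iff) auto
    then show "measure \<mu> {b..<1} * ln (1 / (1 - b)) \<le> max C 0 * (2 * pi) powr s * (1 - b) powr s"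
      using b by (simp only: l_def powr_mult mult.assoc)
  qed
next
  assume "\<exists>C. log_tail_bound C s"
  then obtain C where C: "\<And>b. 0 \<le> b \<Longrightarrow> b < 1 \<Longrightarrow> measure \<mu> {b..<1} * ln (1 / (1 - b)) \<le> C * (1 - b) powr s"
    by (meson atLeastLessThan_iff)
  have "disc_measure \<mu> (carleson_box a l) * ennreal (ln (2 * pi / l) powr 1) \<le> ennreal (C / (2 * pi) powr s * l powr s)"
    if l: "0 < l" "l \<le> 2 * pi" for a l
  proof -
    define b where "b = 1 - l / (2 * pi)"
    have b: "0 \<le> b" "b < 1" using l by (auto simp: b_def)
    have lb: "2 * pi / l = 1 / (1 - b)" "l = 2 * pi * (1 - b)" using l by (auto simp: b_def)
    have ln0: "ln (1 / (1 - b)) \<ge> 0" using b by (simp add: ln_div)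
    have sub: "{t \<in> {0..<1}. complex_of_real t \<in> carleson_box a l} \<subseteq> {b..<1}"
      using carleson_box_radius_subset[OF l] by (simp add: b_def)
    have "disc_measure \<mu> (carleson_box a l) * ennreal (ln (2 * pi / l) powr 1) \<le> emeasure \<mu> {b..<1} * ennreal (ln (1 / (1 - b)))"
      using ln0 sub unfolding disc_measure_def lb(1) by (intro mult_mono emeasure_mono) (auto simp: sets_mu)
    also have "\<dots> = ennreal (measure \<mu> {b..<1} * ln (1 / (1 - b)))"
      by (simp add: emeasure_eq_measure ennreal_mult')
    also have "\<dots> \<le> ennreal (C * (1 - b) powr s)" by (intro ennreal_leI C b)
    also have "C * (1 - b) powr s = C / (2 * pi) powr s * l powr s"
      using b unfolding lb(2) by (simp add: powr_mult)
    finally show ?thesis .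
  qed
  then show "log_carleson \<mu> 1 s"
    unfolding log_carleson_def by (intro exI[of _ "C / (2 * pi) powr s"]) simp
qed

text \<open>For q = 1 the modulus of the image is integrated directly. The kernel integral over the
  disc then has exponent \<beta>, equal to the growth exponent of \<open>disc_gap\<close>, and its
  logarithm becomes the weight v of \<open>carleson_embedding\<close>.\<close>

theorem H_bounded_A1_of_log_carleson:
  fixes p \<alpha> \<beta> :: real
  assumes p: "p > 0" "p \<le> 1" and al: "\<alpha> > -1" and be: "\<beta> > 1"
    and car: "carleson \<mu> ((\<alpha> + 2) / p)" and log: "log_carleson \<mu> 1 ((\<alpha> + 2) / p)"
  shows "H_bounded \<mu> \<beta> p \<alpha> 1 (\<beta> - 2)"
proof -
  define s where "s = (\<alpha> + 2) / p"
  have s: "s > 0" "s \<ge> 0" using p al by (auto simp: s_def)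
  obtain C1 where C1: "C1 > 0" and N: "sublevel_growth \<mu> gap C1 s"
    using carleson_gap[OF car[folded s_def] s(2)] by blast
  obtain CL0 where CL0: "\<And>b. 0 \<le> b \<Longrightarrow> b < 1 \<Longrightarrow> measure \<mu> {b..<1} * ln (1 / (1 - b)) \<le> CL0 * (1 - b) powr s"
    using log log_carleson_iff[OF s(1)] unfolding s_def[symmetric] by (meson atLeastLessThan_iff)
  define CL where "CL = max CL0 0"
  have NL: "measure \<mu> (sublevel \<mu> gap v) * ln (1 / v) \<le> CL * v powr s" if "0 < v" "v \<le> 1" for v
  proof -
    have "measure \<mu> {1 - v..<1} * ln (1 / v) \<le> CL0 * v powr s" using CL0[of "1 - v"] that by simp
    also have "\<dots> \<le> CL * v powr s" by (intro mult_right_mono) (auto simp: CL_def)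
    finally show ?thesis unfolding measure_gap_le[OF that] .
  qed
  obtain C2 where C2: "C2 > 0" and finA: "finite_measure (disc_area (\<beta> - 2))"
    and NA: "sublevel_growth (disc_area (\<beta> - 2)) disc_gap C2 \<beta>"
    using disc_weight_sublevel[of "\<beta> - 2"] be by (auto simp del: space_density)
  obtain K0 where K0: "K0 > 0" and emb: "shell_embedding p \<alpha> 1 K0"
    by (rule carleson_embedding[OF p al]) (use that in blast)
  define V where "V = (1 + ln 8) * C1 * 4 powr s + CL * 4 powr s"
  have V: "V \<ge> 0" using C1 by (simp add: V_def CL_def)
  have kernel_z: "(\<integral>\<^sup>+z. disc_weight (\<beta> - 2) z * ennreal (max (gap t) (disc_gap z) powr - \<beta>) \<partial>lborel)
      \<le> ennreal (C2 * \<beta> * (1 + ln (2 / gap t)))" for t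
  proof -
    have "(\<integral>\<^sup>+z. disc_weight (\<beta> - 2) z * ennreal (max (gap t) (disc_gap z) powr - \<beta>) \<partial>lborel)
      = (\<integral>\<^sup>+z. ennreal (max (disc_gap z) (gap t) powr - \<beta>) \<partial>disc_area (\<beta> - 2))"
      by (subst nn_integral_density) (auto simp: max.commute)
    also have "\<dots> \<le> ennreal (C2 + C2 * \<beta> * ln (2 / gap t))"
      by (rule nn_integral_max_powr_le_log)
         (use finA gap_bounds[of t] disc_gap_bounds NA C2 be in auto)
    also have "\<dots> \<le> ennreal (C2 * \<beta> * (1 + ln (2 / gap t)))"
      using C2 be by (intro ennreal_leI) (simp add: algebra_simps)
    finally show ?thesis .
  qed
  have shell: "(\<integral>\<^sup>+t. ennreal (1 + ln (2 / gap t)) * indicator (gap_shell \<delta>) t \<partial>\<mu>)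
      \<le> ennreal (V * \<delta> powr ((\<alpha> + 2) * 1 / p))" if d: "\<delta> > 0" "\<delta> \<le> 1" for \<delta>
  proof -
    define m where "m = measure \<mu> (sublevel \<mu> gap (4 * \<delta>))"
    have ml: "m \<le> C1 * (4 * \<delta>) powr s"
      using N[rule_format, of "4 * \<delta>"] d C1 by (simp add: m_def emeasure_eq_measure)
    have m0: "m \<ge> 0" by (simp add: m_def)
    have ln2: "ln (2 / \<delta>) \<ge> 0" using d by (simp add: ln_div)
    have "(\<integral>\<^sup>+t. ennreal (1 + ln (2 / gap t)) * indicator (gap_shell \<delta>) t \<partial>\<mu>)
      \<le> (\<integral>\<^sup>+t. ennreal (1 + ln (2 / \<delta>)) * indicator (sublevel \<mu> gap (4 * \<delta>)) t \<partial>\<mu>)"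
    proof (rule nn_integral_mono)
      fix t
      show "ennreal (1 + ln (2 / gap t)) * indicator (gap_shell \<delta>) t
        \<le> ennreal (1 + ln (2 / \<delta>)) * indicator (sublevel \<mu> gap (4 * \<delta>)) t"
      proof (cases "\<delta> \<le> gap t \<and> gap t \<le> 4 * \<delta>")
        case True
        have "ln (2 / gap t) \<le> ln (2 / \<delta>)" using True d by (simp add: ln_div)
        then show ?thesis using True by (simp add: ennreal_leI)
      qed auto
    qed
    also have "\<dots> = ennreal (1 + ln (2 / \<delta>)) * ennreal m"
      unfolding m_def emeasure_eq_measure[symmetric] by (rule nn_integral_cmult_indicator) measurable
    also have "\<dots> = ennreal ((1 + ln (2 / \<delta>)) * m)"
      using ln2 m0 by (subst ennreal_mult'[symmetric]) auto
    also have "\<dots> \<le> ennreal (V * \<delta> powr s)"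
    proof (rule ennreal_leI)
      \<comment> \<open>The logarithmic bound is available at the scale 4 \<delta> of the sublevel
        set; the constant ln 8 makes up the difference and is paid for by the plain Carleson bound
        \<open>ml\<close>.\<close>
      have e: "1 + ln (2 / \<delta>) = 1 + ln 8 + ln (1 / (4 * \<delta>))"
      proof -
        have "2 / \<delta> = 8 * (1 / (4 * \<delta>))" using d by simp
        then show ?thesis using d by (simp only: ln_mult) (simp add: ln_mult)
      qed
      have "(1 + ln 8) * m \<le> (1 + ln 8) * (C1 * (4 * \<delta>) powr s)"
        using ml by (intro mult_left_mono) (auto simp: add_nonneg_nonneg)
      moreover have "m * ln (1 / (4 * \<delta>)) \<le> CL * (4 * \<delta>) powr s"
      proof (cases "4 * \<delta> \<le> 1")
        case True
        then show ?thesis unfolding m_def using NL[of "4 * \<delta>"] d by simp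
      next
        case False
        then have "ln (1 / (4 * \<delta>)) \<le> 0" using d by (simp add: ln_div)
        then have "m * ln (1 / (4 * \<delta>)) \<le> 0" using m0 by (rule mult_nonneg_nonpos[rotated])
        also have "0 \<le> CL * (4 * \<delta>) powr s" by (simp add: CL_def)
        finally show ?thesis .
      qed
      ultimately have "(1 + ln 8) * m + m * ln (1 / (4 * \<delta>)) \<le> (1 + ln 8) * (C1 * (4 * \<delta>) powr s) + CL * (4 * \<delta>) powr s"
        by (rule add_mono)
      then show "(1 + ln (2 / \<delta>)) * m \<le> V * \<delta> powr s"
        unfolding e V_def using d by (simp add: powr_mult algebra_simps)
    qed
    finally show ?thesis by (simp add: s_def)
  qed
  define K where "K = 2 powr \<beta> * (C2 * \<beta>)"
  have K: "K > 0" using C2 be by (simp add: K_def)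
  show ?thesis
  proof (rule H_boundedI[where K = "K * (K0 * V)"])
    show "p > 0" "(1::real) > 0" "\<alpha> > -1" "\<beta> - 2 > -1" "K * (K0 * V) \<ge> 0" using p al be K K0 V by auto
    fix f assume f: "in_bergman p \<alpha> f"
    have hol: "f holomorphic_on ball 0 1" using f by (simp add: in_bergman_def)
    have summ: "summable (\<lambda>k. norm (taylor_coeff f k) * moment k)"
      by (rule taylor_moment_summable[OF f p(1) al car]) (use p in auto)
    have b0: "\<beta> > 0" using be by simp
    define F where "F t = indicator {0..<1} t * norm (f (of_real t))" for t
    have [measurable]: "F \<in> borel_measurable borel"
      unfolding F_def by (rule borel_measurable_norm_on_radius[OF hol])
    have F0: "F t \<ge> 0" for t by (simp add: F_def)
    have "bergman_integral 1 (\<beta> - 2) (H_op \<mu> \<beta> f)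
      \<le> (\<integral>\<^sup>+t. ennreal (2 powr \<beta> * F t) * ennreal (C2 * \<beta> * (1 + ln (2 / gap t))) \<partial>\<mu>)"
    proof (rule bergman_integral_le_Fubini[where A = "\<lambda>_. 1" and k = "\<lambda>z t. max (gap t) (disc_gap z) powr - \<beta>"])
      show "ennreal (norm (H_op \<mu> \<beta> f z) powr 1) \<le> ennreal 1 * (\<integral>\<^sup>+t. ennreal (2 powr \<beta> * F t * max (gap t) (disc_gap z) powr - \<beta>) \<partial>\<mu>)"
        if "norm z < 1" for z
        using norm_H_op_le_max[OF hol summ b0 that] by (simp add: F_def)
    qed (simp_all add: F0 kernel_z)
    also have "\<dots> = (\<integral>\<^sup>+t. ennreal K * (ennreal (F t) * ennreal (1 + ln (2 / gap t))) \<partial>\<mu>)"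
      using F0 C2 be by (intro nn_integral_cong) (simp add: ennreal_mult'[symmetric] K_def mult_ac)
    also have "\<dots> = ennreal K * (\<integral>\<^sup>+t. ennreal (F t) * ennreal (1 + ln (2 / gap t)) \<partial>\<mu>)"
      by (rule nn_integral_cmult) measurable
    also have "\<dots> \<le> ennreal K * ennreal (K0 * V * enn2real (bergman_integral p \<alpha> f) powr (1 / p))"
      using emb[rule_format, OF f _ V shell] by (intro mult_left_mono) (auto simp: F_def)
    also have "\<dots> = ennreal (K * (K0 * V) * enn2real (bergman_integral p \<alpha> f) powr (1 / p))"
      using K by (simp add: ennreal_mult'[symmetric] mult.assoc)
    finally show "bergman_integral 1 (\<beta> - 2) (H_op \<mu> \<beta> f) \<le> \<dots>" .
    show "H_defined \<mu> \<beta> f" "H_op \<mu> \<beta> f holomorphic_on ball 0 1"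
      using H_op_holomorphic[OF hol summ b0] H_defined[OF hol summ b0] by blast+
  qed
qed

end

subsection \<open>Necessity\<close>

text \<open>An integer exponent keeps complex powers out; it is taken above (\<alpha> + 2) / p so
  that the Bergman norm is governed by the neighbourhood of 1 at scale 1 - b.\<close>

definition test_function :: "nat \<Rightarrow> real \<Rightarrow> complex \<Rightarrow> complex" where
  "test_function N b z = 1 / (1 - complex_of_real b * z) ^ N"

text \<open>\<open>R\<close> is free because \<open>test_function_summable\<close> uses a disc
  larger than the unit disc.\<close>

lemma test_function_holomorphic:
  assumes "0 \<le> b" "b * R \<le> 1"
  shows "test_function N b holomorphic_on ball 0 R"
proof -
  have "1 - complex_of_real b * z \<noteq> 0" if "norm z < R" for z
  proof
    assume h: "1 - complex_of_real b * z = 0"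
    then have "norm (complex_of_real b * z) = 1" by simp
    then have "b * norm z = 1" using assms by (simp add: norm_mult)
    moreover have "b * norm z < b * R \<or> b = 0" using that assms by (auto simp: mult_strict_left_mono)
    ultimately show False using assms by auto
  qed
  then show ?thesis
    unfolding test_function_def[abs_def] by (intro holomorphic_intros) auto
qed

lemma test_function_of_real:
  assumes "0 \<le> b" "b < 1" and t: "t \<in> {0..<1}"
  shows "0 < 1 - b * t" "test_function N b (of_real t) = of_real ((1 - b * t) powr - real N)"
proof -
  have "b * t \<le> b * 1" using assms by (intro mult_left_mono) auto
  then show *: "0 < 1 - b * t" using assms by simp
  have "test_function N b (of_real t) = of_real (1 / (1 - b * t) ^ N)"
    by (simp add: test_function_def)
  also have "1 / (1 - b * t) ^ N = (1 - b * t) powr - real N"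
    using * by (simp add: powr_minus_divide powr_realpow)
  finally show "test_function N b (of_real t) = of_real ((1 - b * t) powr - real N)" .
qed

text \<open>The point b plays the part of t in the kernel estimate, and N p > \<alpha> + 2 puts the
  area integral in the convergent case of \<open>nn_integral_max_powr_le\<close>.\<close>

lemma test_function_bergman:
  assumes p: "p > 0" and al: "\<alpha> > -1" and N: "real N > (\<alpha> + 2) / p"
  obtains K where "K > 0" "\<And>b. 0 \<le> b \<Longrightarrow> b < 1 \<Longrightarrow> in_bergman p \<alpha> (test_function N b) \<and>
     enn2real (bergman_integral p \<alpha> (test_function N b)) \<le> K * (1 - b) powr (\<alpha> + 2 - real N * p)"
proof -
  obtain C where C: "C > 0" and fin: "finite_measure (disc_area \<alpha>)"
    and le: "sublevel_growth (disc_area \<alpha>) disc_gap C (\<alpha> + 2)"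
    by (rule disc_weight_sublevel[OF al]) (use that in blast)
  define x where "x = real N * p"
  have x: "x > \<alpha> + 2" "x > 0" using N p al by (auto simp: x_def field_simps)
  define K where "K = 2 powr x * (C * x / (x - (\<alpha> + 2)))"
  have K: "K > 0" using x C by (simp add: K_def)
  show ?thesis
  proof (rule that[OF K])
    fix b :: real assume b: "0 \<le> b" "b < 1"
    have hol: "test_function N b holomorphic_on ball 0 1"
      by (rule test_function_holomorphic) (use b in auto)
    have "bergman_integral p \<alpha> (test_function N b)
      \<le> (\<integral>\<^sup>+z. ennreal (2 powr x) * (disc_weight \<alpha> z * ennreal (max (disc_gap z) (gap b) powr - x)) \<partial>lborel)"
      unfolding bergman_integral_eq
    proof (rule nn_integral_mono)
      fix z
      show "bergman_density p \<alpha> (test_function N b) z \<le> ennreal (2 powr x) * (disc_weight \<alpha> z * ennreal (max (disc_gap z) (gap b) powr - x))"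
      proof (cases "norm z < 1")
        case True
        note pos = norm_one_minus_mult_ge(2)[OF b True]
        have "norm (test_function N b z) powr p = norm (1 - of_real b * z) powr - x"
          using pos by (simp add: test_function_def norm_divide norm_power powr_divide powr_realpow[symmetric] powr_powr x_def powr_minus_divide)
        also have "\<dots> \<le> 2 powr x * max (gap b) (disc_gap z) powr - x"
          by (rule norm_one_minus_mult_powr_le) (use b True x in auto)
        finally have "ennreal (norm (test_function N b z) powr p) \<le> ennreal (2 powr x) * ennreal (max (disc_gap z) (gap b) powr - x)"
          by (simp add: ennreal_mult'[symmetric] ennreal_leI max.commute)
        then have "ennreal (norm (test_function N b z) powr p) * disc_weight \<alpha> z
           \<le> (ennreal (2 powr x) * ennreal (max (disc_gap z) (gap b) powr - x)) * disc_weight \<alpha> z"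
          by (rule mult_right_mono) simp
        then show ?thesis unfolding bergman_density_def by (simp add: mult_ac)
      qed (simp add: bergman_density_eq)
    qed
    also have "\<dots> = ennreal (2 powr x) * (\<integral>\<^sup>+z. ennreal (max (disc_gap z) (gap b) powr - x) \<partial>disc_area \<alpha>)"
      by (subst nn_integral_cmult) (auto simp: nn_integral_density)
    also have "\<dots> \<le> ennreal (2 powr x) * ennreal (C * x / (x - (\<alpha> + 2)) * gap b powr (\<alpha> + 2 - x))"
      by (intro mult_left_mono nn_integral_max_powr_le[OF fin _ le]) (use x C gap_bounds in auto)
    also have "\<dots> = ennreal (K * (1 - b) powr (\<alpha> + 2 - real N * p))"
      using b by (simp add: ennreal_mult'[symmetric] K_def gap_def x_def mult.assoc)
    finally have le: "bergman_integral p \<alpha> (test_function N b) \<le> ennreal (K * (1 - b) powr (\<alpha> + 2 - real N * p))" .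
    then have "bergman_integral p \<alpha> (test_function N b) < \<infinity>"
      by (rule le_less_trans) simp
    then show "in_bergman p \<alpha> (test_function N b) \<and>
       enn2real (bergman_integral p \<alpha> (test_function N b)) \<le> K * (1 - b) powr (\<alpha> + 2 - real N * p)"
      using hol le K by (auto simp: in_bergman_def intro!: enn2real_leI)
  qed
qed

context radial_measure
begin

text \<open>In the necessity direction the Carleson exponent is still to be proved. Instead, the
  test function extends beyond the unit disc, so its coefficients are absolutely summable, and the
  moments are bounded by the zeroth one.\<close>

lemma test_function_summable:
  assumes b: "0 \<le> b" "b < 1"
  shows "summable (\<lambda>k. norm (taylor_coeff (test_function N b) k) * moment k)"
proof -
  \<comment> \<open>The radius 2 / (1 + b) exceeds 1 and stays inside the pole at 1 / b, if there is
    one.\<close>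
  have "b * (2 / (1 + b)) \<le> 1" using b by (simp add: field_simps)
  then have "test_function N b holomorphic_on ball 0 (2 / (1 + b))"
    using b by (intro test_function_holomorphic)
  then have "summable (\<lambda>k. norm (taylor_coeff (test_function N b) k * 1 ^ k))"
    by (rule taylor_coeff_abs_summable) (use b in auto)
  then have "summable (\<lambda>k. norm (taylor_coeff (test_function N b) k) * moment 0)"
    by (intro summable_mult2) simp
  then show ?thesis
  proof (rule summable_comparison_test'[of _ 0])
    fix k
    show "norm (norm (taylor_coeff (test_function N b) k) * moment k) \<le> norm (taylor_coeff (test_function N b) k) * moment 0"
      using moment_add_le[of k 0] by (simp add: moment_nonneg mult_left_mono)
  qed
qed

text \<open>For t \<ge> b one has 1 - b t \<le> 1 - b^2 \<le> 2 (1 - b).\<close>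

lemma test_function_kernel_ge:
  fixes b t x :: real
  assumes b: "0 \<le> b" "b < 1" and t: "t \<in> {b..<1}" and x: "x \<ge> 0"
  shows "(2 * (1 - b)) powr - x \<le> (1 - b * t) powr - x"
proof (rule powr_mono2')
  have "b * t \<le> b * 1" using b t by (intro mult_left_mono) auto
  then show "0 < 1 - b * t" using b by simp
  have "b * b \<le> b * t" using b t by (intro mult_left_mono) auto
  moreover have "0 \<le> (1 - b) * (1 - b)" by simp
  ultimately show "1 - b * t \<le> 2 * (1 - b)" by (simp add: algebra_simps)
qed (use x in simp)

text \<open>The integrand is nonnegative along the radius, so there is no cancellation and the
  integral only shrinks when it is restricted to the tail.\<close>

lemma norm_integral_tail_ge:
  fixes h :: "real \<Rightarrow> complex"
  assumes int: "integrable \<mu> (\<lambda>t. indicator {0..<1} t *\<^sub>R h t)"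
    and real: "\<And>t. t \<in> {0..<1} \<Longrightarrow> h t = complex_of_real (r t)" "\<And>t. t \<in> {0..<1} \<Longrightarrow> r t \<ge> 0"
    and ge: "\<And>t. t \<in> {b..<1} \<Longrightarrow> c \<le> r t" and b: "0 \<le> b" and c: "c \<ge> 0"
  shows "c * measure \<mu> {b..<1} \<le> norm (\<integral>t. indicator {0..<1} t *\<^sub>R h t \<partial>\<mu>)"
proof -
  have eq: "(\<lambda>t. indicator {0..<1} t *\<^sub>R h t) = (\<lambda>t. complex_of_real (indicator {0..<1} t * r t))"
    using real(1) by (auto split: split_indicator)
  have intr: "integrable \<mu> (\<lambda>t. indicator {0..<1} t * r t)"
    using int unfolding eq by (simp only: complex_of_real_integrable_eq)
  have "c * measure \<mu> {b..<1} = (\<integral>t. c * indicator {b..<1} t \<partial>\<mu>)"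
    by (simp add: sets_mu)
  also have "\<dots> \<le> (\<integral>t. indicator {0..<1} t * r t \<partial>\<mu>)"
    using ge real(2) b intr
    by (intro integral_mono) (auto simp: sets_mu emeasure_eq_measure split: split_indicator)
  also have "\<dots> \<le> norm (complex_of_real (\<integral>t. indicator {0..<1} t * r t \<partial>\<mu>))" by simp
  also have "\<dots> = norm (\<integral>t. indicator {0..<1} t *\<^sub>R h t \<partial>\<mu>)"
    unfolding eq by (subst integral_complex_of_real) simp
  finally show ?thesis .
qed

lemma H_coef_test_function_ge:
  assumes b: "0 \<le> b" "b < 1" and be: "\<beta> > 0"
  shows "binomial_coeff \<beta> n * ((2 * (1 - b)) powr - real N * b ^ n * measure \<mu> {b..<1})
     \<le> norm (H_coef \<mu> \<beta> (test_function N b) n)"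
proof -
  have hol: "test_function N b holomorphic_on ball 0 1"
    by (rule test_function_holomorphic) (use b in auto)
  note H = hol test_function_summable[OF b, of N] be
  have "((2 * (1 - b)) powr - real N * b ^ n) * measure \<mu> {b..<1}
    \<le> norm (weighted_moment (test_function N b) n)"
  proof (rule norm_integral_tail_ge[OF radial_moments_sums(1)[OF H], where r = "\<lambda>t. (1 - b * t) powr - real N * t ^ n"])
    fix t :: real assume t: "t \<in> {0..<1}"
    show "test_function N b (complex_of_real t) * complex_of_real t ^ n = complex_of_real ((1 - b * t) powr - real N * t ^ n)"
      by (simp add: test_function_of_real[OF b t])
    show "0 \<le> (1 - b * t) powr - real N * t ^ n" using t by simp
  next
    fix t assume t: "t \<in> {b..<1}"
    show "(2 * (1 - b)) powr - real N * b ^ n \<le> (1 - b * t) powr - real N * t ^ n"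
      using t b by (intro mult_mono test_function_kernel_ge power_mono) auto
  qed (use b in auto)
  then have "binomial_coeff \<beta> n * ((2 * (1 - b)) powr - real N * b ^ n * measure \<mu> {b..<1})
    \<le> binomial_coeff \<beta> n * norm (weighted_moment (test_function N b) n)"
    using be by (intro mult_left_mono) (auto simp: Gamma_real_nonneg)
  also have "\<dots> = norm (H_coef \<mu> \<beta> (test_function N b) n)"
    unfolding H_coef_eq_integral[OF H] norm_mult norm_of_real
    using be by (simp add: Gamma_real_nonneg)
  finally show ?thesis .
qed

lemma H_op_test_function_ge:
  assumes b: "0 \<le> b" "b < 1" and be: "\<beta> > 0"
  shows "(2 * (1 - b)) powr - (real N + \<beta>) * measure \<mu> {b..<1} \<le> norm (H_op \<mu> \<beta> (test_function N b) (of_real b))"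
proof -
  have hol: "test_function N b holomorphic_on ball 0 1"
    by (rule test_function_holomorphic) (use b in auto)
  note H = hol test_function_summable[OF b, of N] be
  have nb: "norm (complex_of_real b) < 1" using b by simp
  show ?thesis
    unfolding H_op_eq_integral[OF H nb]
  proof (rule norm_integral_tail_ge[OF H_op_sums(2)[OF H nb], where r = "\<lambda>t. (1 - b * t) powr - (real N + \<beta>)"])
    fix t :: real assume t: "t \<in> {0..<1}"
    have "(1 - complex_of_real t * complex_of_real b) powr (- of_real \<beta>) = complex_of_real ((1 - b * t) powr - \<beta>)"
      using powr_of_real[of "1 - b * t" "- \<beta>"] test_function_of_real(1)[OF b t] by (simp add: mult.commute)
    then show "test_function N b (complex_of_real t) * (1 - complex_of_real t * complex_of_real b) powr (- of_real \<beta>)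
      = complex_of_real ((1 - b * t) powr - (real N + \<beta>))"
      unfolding test_function_of_real(2)[OF b t] by (simp add: powr_add[symmetric] flip: of_real_mult)
  next
    fix t assume t: "t \<in> {b..<1}"
    show "(2 * (1 - b)) powr - (real N + \<beta>) \<le> (1 - b * t) powr - (real N + \<beta>)"
      using t b be by (intro test_function_kernel_ge) auto
  qed (use b in auto)
qed

lemma H_op_test_function_bound:
  assumes p: "p > 0" and al: "\<alpha> > -1" and q: "q > 0" and ga: "\<gamma> > -1" and N: "real N > (\<alpha> + 2) / p"
    and bdd: "H_bounded \<mu> \<beta> p \<alpha> q \<gamma>"
  obtains K where "K > 0" "\<And>b. 0 \<le> b \<Longrightarrow> b < 1 \<Longrightarrow> in_bergman q \<gamma> (H_op \<mu> \<beta> (test_function N b)) \<and>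
     enn2real (bergman_integral q \<gamma> (H_op \<mu> \<beta> (test_function N b))) powr (1 / q) \<le> K * (1 - b) powr ((\<alpha> + 2) / p - real N)"
proof -
  obtain K1 where K1: "K1 > 0" and K1b: "\<And>f. in_bergman p \<alpha> f \<Longrightarrow> in_bergman q \<gamma> (H_op \<mu> \<beta> f) \<and>
      enn2real (bergman_integral q \<gamma> (H_op \<mu> \<beta> f)) powr (1 / q) \<le> K1 * enn2real (bergman_integral p \<alpha> f) powr (1 / p)"
    by (rule H_boundedD[OF bdd p q al ga]) (use that in blast)
  obtain K2 where K2: "K2 > 0" and K2b: "\<And>b. 0 \<le> b \<Longrightarrow> b < 1 \<Longrightarrow> in_bergman p \<alpha> (test_function N b) \<and>
     enn2real (bergman_integral p \<alpha> (test_function N b)) \<le> K2 * (1 - b) powr (\<alpha> + 2 - real N * p)"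
    by (rule test_function_bergman[OF p al N]) (use that in blast)
  show ?thesis
  proof (rule that[of "K1 * K2 powr (1 / p)"])
    show "K1 * K2 powr (1 / p) > 0" using K1 K2 by simp
    fix b :: real assume b: "0 \<le> b" "b < 1"
    note T = K2b[OF b]
    have "K1 * enn2real (bergman_integral p \<alpha> (test_function N b)) powr (1 / p)
      \<le> K1 * (K2 * (1 - b) powr (\<alpha> + 2 - real N * p)) powr (1 / p)"
      using T K1 p by (intro mult_left_mono powr_mono2) auto
    also have "\<dots> = K1 * K2 powr (1 / p) * (1 - b) powr ((\<alpha> + 2) / p - real N)"
    proof -
      have "(\<alpha> + 2 - real N * p) * (1 / p) = (\<alpha> + 2) / p - real N" using p by (simp add: field_simps)
      then show ?thesis using K2 by (simp only: powr_mult powr_powr mult.assoc)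
    qed
    finally show "in_bergman q \<gamma> (H_op \<mu> \<beta> (test_function N b)) \<and>
      enn2real (bergman_integral q \<gamma> (H_op \<mu> \<beta> (test_function N b))) powr (1 / q)
      \<le> K1 * K2 powr (1 / p) * (1 - b) powr ((\<alpha> + 2) / p - real N)"
      using K1b[of "test_function N b"] T by fastforce
  qed
qed

text \<open>At the point b the image is at least of order (1 - b)^(-N - \<beta>) times the mass of
  the tail. Its norm has order at most (1 - b)^((\<alpha> + 2)/p - N), which allows at b a value of
  at most (1 - b)^(-\<beta>/q) times that. The exponent N cancels.\<close>

theorem carleson_of_H_bounded:
  fixes p \<alpha> \<beta> q :: real
  assumes p: "p > 0" and al: "\<alpha> > -1" and be: "\<beta> > 1" and q: "q > 1"
    and bdd: "H_bounded \<mu> \<beta> p \<alpha> q (\<beta> - 2)"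
  shows "carleson \<mu> ((\<alpha> + 2) / p + \<beta> / conj_exp q)"
proof -
  obtain N :: nat where N: "real N > (\<alpha> + 2) / p" using reals_Archimedean2 by blast
  have ga: "\<beta> - 2 > -1" and q0: "q > 0" and b0: "\<beta> > 0" using be q by auto
  obtain K where K: "K > 0" and Kb: "\<And>b. 0 \<le> b \<Longrightarrow> b < 1 \<Longrightarrow> in_bergman q (\<beta> - 2) (H_op \<mu> \<beta> (test_function N b)) \<and>
     enn2real (bergman_integral q (\<beta> - 2) (H_op \<mu> \<beta> (test_function N b))) powr (1 / q) \<le> K * (1 - b) powr ((\<alpha> + 2) / p - real N)"
    by (rule H_op_test_function_bound[OF p al q0 ga N bdd]) (use that in blast)
  obtain C where C: "C > 0" and loc: "bergman_local_bound C q (\<beta> - 2)"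
    by (rule bergman_local_estimate[OF q0]) (use that in blast)
  define L where "L = (C powr (1 / q) * K) * 2 powr (real N + \<beta>)"
  define s where "s = (\<alpha> + 2) / p + \<beta> * (1 - 1 / q)"
  have "emeasure \<mu> {b..<1} \<le> ennreal (L * (1 - b) powr s)" if "b \<in> {0..<1}" for b
  proof -
    have b: "0 \<le> b" "b < 1" using that by auto
    define d where "d = 1 - b"
    have d: "d > 0" using b by (simp add: d_def)
    let ?H = "H_op \<mu> \<beta> (test_function N b)"
    let ?J = "enn2real (bergman_integral q (\<beta> - 2) ?H)" and ?Y = "C powr (1 / q) * K"
      and ?Z = "d powr ((\<alpha> + 2) / p - real N)" and ?W = "(2 * d) powr (real N + \<beta>)"
    define m where "m = measure \<mu> {b..<1}"
    define h where "h = norm (?H (of_real b))"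
    have HF: "in_bergman q (\<beta> - 2) ?H" and J: "?J powr (1 / q) \<le> K * ?Z"
      using Kb[OF b] by (auto simp: d_def)
    have "ennreal (d powr \<beta> * h powr q)
      \<le> ennreal C * (\<integral>\<^sup>+u. bergman_density q (\<beta> - 2) ?H u * indicator (ball (complex_of_real b) ((1 - norm (complex_of_real b)) / 2)) u \<partial>lborel)"
      using loc[rule_format, of "?H" "complex_of_real b"] HF b by (simp add: in_bergman_def d_def h_def)
    also have "\<dots> \<le> ennreal C * bergman_integral q (\<beta> - 2) ?H"
      unfolding bergman_integral_eq by (intro mult_left_mono nn_integral_mono) (auto split: split_indicator)
    also have "\<dots> = ennreal (C * ?J)"
      using HF C by (simp add: in_bergman_def ennreal_mult')
    finally have "(d powr \<beta> * h powr q) powr (1 / q) \<le> (C * ?J) powr (1 / q)"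
      using C q by (intro powr_mono2) auto
    also have "\<dots> = C powr (1 / q) * ?J powr (1 / q)" using C by (simp add: powr_mult)
    also have "\<dots> \<le> C powr (1 / q) * (K * ?Z)" by (intro mult_left_mono J) simp
    also have "(d powr \<beta> * h powr q) powr (1 / q) = d powr (\<beta> / q) * h"
      using q by (simp add: powr_mult powr_powr h_def)
    finally have h: "d powr (\<beta> / q) * h \<le> ?Y * ?Z" by (simp only: mult.assoc)
    have "(2 * d) powr - (real N + \<beta>) * m \<le> h"
      using H_op_test_function_ge[OF b b0, of N] by (simp add: m_def h_def d_def)
    then have "d powr (\<beta> / q) * ((2 * d) powr - (real N + \<beta>) * m) \<le> d powr (\<beta> / q) * h"
      by (intro mult_left_mono) auto
    also note h
    finally have "?W * d powr - (\<beta> / q) * (d powr (\<beta> / q) * ((2 * d) powr - (real N + \<beta>) * m))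
      \<le> ?W * d powr - (\<beta> / q) * (?Y * ?Z)"
      by (intro mult_left_mono) auto
    also have "?W * d powr - (\<beta> / q) * (d powr (\<beta> / q) * ((2 * d) powr - (real N + \<beta>) * m)) = m"
    proof -
      have "?W * (2 * d) powr - (real N + \<beta>) = 1" "d powr - (\<beta> / q) * d powr (\<beta> / q) = 1"
        using d by (simp_all only: powr_add[symmetric]) auto
      then show ?thesis by algebra
    qed
    also have "?W * d powr - (\<beta> / q) * (?Y * ?Z)
       = L * d powr s"
    proof -
      have "d powr (real N + \<beta>) * d powr - (\<beta> / q) * ?Z = d powr s"
        unfolding powr_add[symmetric] s_def by (simp add: algebra_simps)
      moreover have "?W = 2 powr (real N + \<beta>) * d powr (real N + \<beta>)"
        using d by (simp add: powr_mult)
      moreover have "X * Y * Z = S \<Longrightarrow> T = B * X \<Longrightarrow> T * Y * (A * Z) = A * B * S" for A B X Y Z S T :: real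
        by (auto simp: mult_ac)
      ultimately show ?thesis unfolding L_def by blast
    qed
    finally show ?thesis by (simp add: emeasure_eq_measure m_def d_def ennreal_leI)
  qed
  moreover have "\<beta> / conj_exp q = \<beta> * (1 - 1 / q)" using q by (simp add: conj_exp_def field_simps)
  ultimately show ?thesis unfolding carleson_def s_def by (intro exI[of _ L]) simp
qed

lemma ln_power_series_sums:
  fixes b :: real
  assumes "0 \<le> b" "b < 1"
  shows "(\<lambda>n. b ^ Suc n / (real n + 1)) sums ln (1 / (1 - b))"
proof -
  have "(\<lambda>n. - (b ^ n) / real n) sums ln (1 - b)"
    using Complex_Transcendental.ln_series'[of "- b"] assms by simp
  then have "(\<lambda>n. - (b ^ Suc n) / real (Suc n)) sums ln (1 - b)"
    by (subst sums_Suc_iff) simp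
  then have "(\<lambda>n. - (- (b ^ Suc n) / real (Suc n))) sums - ln (1 - b)"
    by (rule sums_minus)
  then show ?thesis using assms by (simp add: ln_div add.commute)
qed

text \<open>For q = 1 evaluation at the point b would yield only the exponent (\<alpha> + 2) / p
  without a logarithm; summing over all coefficients of the image retains it.\<close>

theorem log_carleson_of_H_bounded_A1:
  fixes p \<alpha> \<beta> :: real
  assumes p: "p > 0" and al: "\<alpha> > -1" and be: "\<beta> > 1"
    and bdd: "H_bounded \<mu> \<beta> p \<alpha> 1 (\<beta> - 2)"
  shows "log_carleson \<mu> 1 ((\<alpha> + 2) / p)"
proof -
  obtain N :: nat where N: "real N > (\<alpha> + 2) / p" using reals_Archimedean2 by blast
  have ga: "\<beta> - 2 > -1" and b0: "\<beta> > 0" using be by auto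
  have s0: "(\<alpha> + 2) / p > 0" using p al by simp
  obtain K where K: "K > 0" and Kb: "\<And>b. 0 \<le> b \<Longrightarrow> b < 1 \<Longrightarrow> in_bergman 1 (\<beta> - 2) (H_op \<mu> \<beta> (test_function N b)) \<and>
     enn2real (bergman_integral 1 (\<beta> - 2) (H_op \<mu> \<beta> (test_function N b))) powr (1 / 1) \<le> K * (1 - b) powr ((\<alpha> + 2) / p - real N)"
    by (rule H_op_test_function_bound[OF p al _ ga N bdd]) (use that in auto)
  define L where "L = 2 * K * \<beta> * 2 powr real N"
  have "measure \<mu> {b..<1} * ln (1 / (1 - b)) \<le> L * (1 - b) powr ((\<alpha> + 2) / p)" if "b \<in> {0..<1}" for b
  proof -
    have b: "0 \<le> b" "b < 1" using that by auto
    define d where "d = 1 - b"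
    have d: "d > 0" using b by (simp add: d_def)
    define m where "m = measure \<mu> {b..<1}"
    have m0: "m \<ge> 0" by (simp add: m_def)
    let ?F = "test_function N b"
    let ?Z = "d powr ((\<alpha> + 2) / p - real N)" and ?H = "H_op \<mu> \<beta> ?F"
    let ?J = "enn2real (bergman_integral 1 (\<beta> - 2) ?H)"
    have HF: "in_bergman 1 (\<beta> - 2) ?H" and J: "?J \<le> K * ?Z"
      using Kb[OF b] by (auto simp: d_def)
    have hol: "?F holomorphic_on ball 0 1"
      by (rule test_function_holomorphic) (use b in auto)
    \<comment> \<open>The tail mass times the lower bound for the test function on it; the division
      by \<beta> anticipates the comparison of 1 / (n + \<beta>) with 1 / (n + 1).\<close>
    define c where "c = (2 * d) powr - real N * m / \<beta>"
    have c: "c \<ge> 0" using m0 b0 by (simp add: c_def)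
    have coeff_le: "c * (b ^ Suc n / (real n + 1)) \<le> norm (taylor_coeff ?H n) * Beta (real n + 1) \<beta>" for n
    proof -
      define G where "G = binomial_coeff \<beta> n"
      have tc: "taylor_coeff ?H n = H_coef \<mu> \<beta> ?F n"
        by (rule taylor_coeff_H_op[OF hol test_function_summable[OF b] b0])
      \<comment> \<open>The coefficient factor of the operator and the Beta weight of the Hardy
        inequality are reciprocal up to one step of the Gamma recursion.\<close>
      have GB: "G * Beta (real n + 1) \<beta> = 1 / (real n + \<beta>)"
      proof -
        have "real n + \<beta> \<notin> \<int>\<^sub>\<le>\<^sub>0" using b0 nonpos_Ints_nonpos by force
        then have "Gamma (real n + \<beta> + 1) = (real n + \<beta>) * Gamma (real n + \<beta>)" by (rule Gamma_plus1)
        moreover have "Gamma (real n + 1) = fact n" using Gamma_fact[of n] by (simp add: add.commute)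
        moreover have "Gamma \<beta> \<noteq> 0" "Gamma (real n + \<beta>) \<noteq> 0"
          using Gamma_real_pos[of \<beta>] Gamma_real_pos[of "real n + \<beta>"] b0 by linarith+
        ultimately show ?thesis using b0 by (simp add: G_def Beta_def add_ac)
      qed
      have B0: "Beta (real n + 1) \<beta> \<ge> 0"
        using b0 by (auto simp: Beta_def intro!: mult_nonneg_nonneg divide_nonneg_nonneg Gamma_real_nonneg)
      have "c * (b ^ Suc n / (real n + 1)) \<le> ((2 * d) powr - real N * b ^ n * m) * (1 / (real n + \<beta>))"
      proof -
        \<comment> \<open>Holds because \<beta> \<ge> 1; the shift from b^n to b^(n + 1) below gives
          up a factor b to match the series of the logarithm.\<close>
        have "real n + \<beta> \<le> \<beta> * (real n + 1)"
          using mult_right_mono[of 1 \<beta> "real n"] be by (simp add: algebra_simps)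
        then have "1 / (\<beta> * (real n + 1)) \<le> 1 / (real n + \<beta>)"
          using b0 by (intro divide_left_mono) (auto intro!: mult_pos_pos add_nonneg_pos)
        moreover have "b ^ Suc n \<le> b ^ n" using b by (simp add: mult_left_le_one_le)
        ultimately have "((2 * d) powr - real N * m) * (b ^ Suc n * (1 / (\<beta> * (real n + 1)))) \<le> ((2 * d) powr - real N * m) * (b ^ n * (1 / (real n + \<beta>)))"
          using m0 b b0 by (intro mult_left_mono mult_mono) auto
        then show ?thesis by (simp add: c_def mult_ac)
      qed
      also have "\<dots> = (G * ((2 * d) powr - real N * b ^ n * m)) * Beta (real n + 1) \<beta>"
        unfolding GB[symmetric] by (simp add: mult_ac)
      also have "\<dots> \<le> norm (H_coef \<mu> \<beta> ?F n) * Beta (real n + 1) \<beta>"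
        using H_coef_test_function_ge[OF b b0, of n N] B0
        by (intro mult_right_mono) (auto simp: G_def d_def m_def)
      finally show ?thesis unfolding tc .
    qed
    have sums: "(\<lambda>n. c * (b ^ Suc n / (real n + 1))) sums (c * ln (1 / (1 - b)))"
      by (intro sums_mult ln_power_series_sums b)
    have "ennreal (c * ln (1 / (1 - b))) = (\<Sum>n. ennreal (c * (b ^ Suc n / (real n + 1))))"
      using sums c b by (subst suminf_ennreal2) (auto simp: sums_iff)
    also have "\<dots> \<le> (\<Sum>n. ennreal (norm (taylor_coeff ?H n) * Beta (real n + 1) \<beta>))"
      by (intro suminf_le ennreal_leI coeff_le) auto
    also have "\<dots> \<le> 2 * bergman_integral 1 (\<beta> - 2) ?H"
      unfolding bergman_integral_eq using HF by (intro bergman_coeff_sum_le b0) (simp add: in_bergman_def)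
    also have "\<dots> = ennreal (2 * ?J)"
      using HF by (simp add: in_bergman_def ennreal_mult')
    finally have "c * ln (1 / (1 - b)) \<le> 2 * ?J" by simp
    also have "\<dots> \<le> 2 * (K * ?Z)" using J by simp
    finally have "\<beta> * (2 * d) powr real N * (c * ln (1 / (1 - b)))
       \<le> \<beta> * (2 * d) powr real N * (2 * (K * ?Z))"
      using b0 by (intro mult_left_mono) auto
    also have "\<beta> * (2 * d) powr real N * (c * ln (1 / (1 - b))) = m * ln (1 / (1 - b))"
    proof -
      have "(2 * d) powr real N * (2 * d) powr - real N = 1"
        using d by (simp only: powr_add[symmetric]) auto
      moreover have "\<beta> * c = (2 * d) powr - real N * m" using b0 by (simp add: c_def)
      ultimately show ?thesis by algebra
    qed
    also have "\<beta> * (2 * d) powr real N * (2 * (K * ?Z)) = L * d powr ((\<alpha> + 2) / p)"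
    proof -
      have "d powr real N * ?Z = d powr ((\<alpha> + 2) / p)"
        by (simp only: powr_add[symmetric]) simp
      moreover have "(2 * d) powr real N = 2 powr real N * d powr real N" using d by (simp only: powr_mult)
      moreover have "X * Z = S \<Longrightarrow> T = B * X \<Longrightarrow> \<beta> * T * (2 * (A * Z)) = 2 * A * \<beta> * B * S" for A B X Z S T :: real
        by (auto simp: mult_ac)
      ultimately show ?thesis unfolding L_def by blast
    qed
    finally show ?thesis by (simp add: m_def d_def)
  qed
  then show ?thesis unfolding log_carleson_iff[OF s0] by blast
qed

end

text \<open>Each branch of \<open>W_cond\<close> is a Carleson condition with some exponent, and at
  t = 0 any such bound limits the total mass.\<close>

lemma W_cond_finite:
  assumes "W_cond \<mu> p \<alpha>" "sets \<mu> = sets borel" "emeasure \<mu> (- {0..<1}) = 0"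
  shows "radial_measure \<mu>"
proof -
  have sp: "space \<mu> = UNIV" using sets_eq_imp_space_eq[OF assms(2)] by simp
  obtain s where "carleson \<mu> s" using assms(1) by (auto simp: W_cond_def split: if_splits)
  then obtain C where "emeasure \<mu> {0..<1} \<le> ennreal (C * (1 - 0) powr s)"
    unfolding carleson_def by (metis atLeastLessThan_iff order_refl zero_less_one)
  moreover have "emeasure \<mu> (space \<mu>) \<le> emeasure \<mu> {0..<1} + emeasure \<mu> (- {0..<1})"
    unfolding sp using emeasure_subadditive[of "{0..<1}" \<mu> "- {0..<1}"] assms(2) by (simp add: Compl_partition)
  ultimately have "emeasure \<mu> (space \<mu>) \<noteq> \<infinity>"
    using assms(3) by (auto simp: top_unique)
  then have "finite_measure \<mu>" by (rule finite_measureI)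
  then show ?thesis
    using assms by (simp add: radial_measure_def radial_measure_axioms_def)
qed

theorem theorem4p1:
  fixes \<mu> :: "real measure" and p \<alpha> \<beta> :: real
  assumes "0 < p" and "\<alpha> > -1" and "\<beta> > 1"
    and "sets \<mu> = sets borel" and "emeasure \<mu> (- {0..<1}) = 0"
    and "W_cond \<mu> p \<alpha>"
  shows "(\<forall>q. q \<ge> p \<and> q > 1 \<longrightarrow>
            (H_bounded \<mu> \<beta> p \<alpha> q (\<beta> - 2) \<longrightarrow>
               carleson \<mu> ((\<alpha> + 2) / p + \<beta> / conj_exp q)) \<and>
            (carleson \<mu> (max (\<alpha> + 2) \<beta> * (1 / p + 1 / conj_exp q)) \<longrightarrow>
               H_bounded \<mu> \<beta> p \<alpha> q (\<beta> - 2)))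
       \<and> (1 \<ge> p \<longrightarrow>
            (H_bounded \<mu> \<beta> p \<alpha> 1 (\<beta> - 2) \<longleftrightarrow> log_carleson \<mu> 1 ((\<alpha> + 2) / p)))"
proof -
  interpret radial_measure \<mu>
    using assms W_cond_finite by blast
  show ?thesis
  proof (intro conjI allI impI)
    fix q assume q: "q \<ge> p \<and> q > 1"
    show "carleson \<mu> ((\<alpha> + 2) / p + \<beta> / conj_exp q)" if "H_bounded \<mu> \<beta> p \<alpha> q (\<beta> - 2)"
      using carleson_of_H_bounded assms q that by blast
    assume car: "carleson \<mu> (max (\<alpha> + 2) \<beta> * (1 / p + 1 / conj_exp q))"
    have c0: "1 / conj_exp q \<ge> 0" using q by (simp add: conj_exp_def)
    \<comment> \<open>Termwise, \<alpha> + 2 and \<beta> are at most their maximum, so the assumed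
      condition implies the one with the exponent of \<open>H_bounded_of_carleson\<close>.\<close>
    have "(\<alpha> + 2) * (1 / p) + \<beta> * (1 / conj_exp q) \<le> max (\<alpha> + 2) \<beta> * (1 / p) + max (\<alpha> + 2) \<beta> * (1 / conj_exp q)"
      using assms(1) c0 by (intro add_mono mult_right_mono) auto
    then have "(\<alpha> + 2) / p + \<beta> / conj_exp q \<le> max (\<alpha> + 2) \<beta> * (1 / p + 1 / conj_exp q)"
      by (simp add: distrib_left)
    from carleson_mono[OF car this] show "H_bounded \<mu> \<beta> p \<alpha> q (\<beta> - 2)"
      using H_bounded_of_carleson assms q by blast
  next
    assume p1: "1 \<ge> p"
    \<comment> \<open>Since p \<le> q = 1, the first branch of \<open>W_cond\<close> is in force and
      supplies the plain Carleson bound.\<close>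
    then have "carleson \<mu> ((\<alpha> + 2) / p)" using assms by (simp add: W_cond_def)
    then show "H_bounded \<mu> \<beta> p \<alpha> 1 (\<beta> - 2) \<longleftrightarrow> log_carleson \<mu> 1 ((\<alpha> + 2) / p)"
      using H_bounded_A1_of_log_carleson log_carleson_of_H_bounded_A1 assms p1 by blast
  qed
qed

end
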